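(* Consider the action $\mathrm{Sp}(4,\mathbb{R})\curvearrowright\mathfrak{H}_2\times S^1$ obtained from the normal bundle of the embedding of the Siegel upper half-space $\mathfrak{H}_2$ into the Grassmannian $P_2$, and its lift $\widetilde{\mathrm{Sp}(4,\mathbb{R})}\curvearrowright\mathfrak{H}_2\times\mathbb{R}$ to universal covers. Both actions are transitive and have compact stabilizer isomorphic to $\mathrm{SU}(2)$. Thus, after fixing basepoints, there are equivariant identifications $$\big(\mathrm{Sp}(4,\mathbb{R})\curvearrowright\mathfrak{H}_2\times S^1\big)\cong\big(\mathrm{Sp}(4,\mathbb{R})\curvearrowright\mathrm{Sp}(4,\mathbb{R})/\mathrm{SU}(2)\big),$$ $$\big(\widetilde{\mathrm{Sp}(4,\mathbb{R})}\curvearrowright\mathfrak{H}_2\times\mathbb{R}\big)\cong\big(\widetilde{\mathrm{Sp}(4,\mathbb{R})}\curvearrowright\widetilde{\mathrm{Sp}(4,\mathbb{R})}/\mathrm{SU}(2)\big).$$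
   Context: $\mathrm{Sp}(4,\mathbb{R})=\{M\in M_4(\mathbb{R}):M^T\Omega M=\Omega\}$ with $\Omega=\begin{pmatrix} 0 & I_2 \\ -I_2 & 0 \end{pmatrix}$. $\mathfrak{H}_2$ is the set of symmetric $2\times2$ complex matrices with positive definite imaginary part, with action $\begin{pmatrix} A & B \\ C & D \end{pmatrix}Z=(AZ+B)(CZ+D)^{-1}$. $P_2$ is the set of complex $4\times2$ matrices of rank $2$ modulo right multiplication by $\mathrm{GL}(2,\mathbb{C})$, with $\mathrm{Sp}(4,\mathbb{R})$ acting by left multiplication. The map $Z\mapsto\left[\begin{smallmatrix} Z \\ I_2 \end{smallmatrix}\right]$ identifies $M_{2\times2}(\mathbb{C})$ with an open chart of $P_2$ and embeds $\mathfrak{H}_2$ equivariantly in $P_2$. The normal bundle is the rank-2 real subbundle of $TP_2|_{\mathfrak{H}_2}$ spanned over each $Z\in\mathfrak{H}_2$ by the (constant in the chart) tangent vectors $vec_1=\begin{pmatrix} 0 & 1 \\ -1 & 0 \end{pmatrix}$ and $vec_2=i\cdot vec_1$. It is invariant under the tangent maps of the action of $\mathrm{Sp}(4,\mathbb{R})$ on $P_2$ and is identified with $\mathfrak{H}_2\times\mathbb{C}$ via $(Z,w)\leftrightarrow w\cdot vec_1$ at $Z$. The tangent map of $g$ sends the fiber over $Z$ to that over $gZ$ by multiplication by some $c(g,Z)\in\mathbb{C}^*$. Forgetting the radial part gives the action $\mathrm{Sp}(4,\mathbb{R})\curvearrowright\mathfrak{H}_2\times S^1$, $g\cdot(Z,u)=(gZ,\tfrac{c(g,Z)}{|c(g,Z)|}u)$.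 This action lifts to an action of the universal covering group $\widetilde{\mathrm{Sp}(4,\mathbb{R})}$ on the universal cover $\mathfrak{H}_2\times\mathbb{R}$ of $\mathfrak{H}_2\times S^1$ (the unique lift for which the identity acts as the identity, compatible with both covering maps). In the displayed identifications, $\mathrm{SU}(2)$ denotes the stabilizer of the chosen basepoint, acting group elements act by left multiplication on cosets. *)

theory Defs
  imports
    "HOL-Analysis.Analysis"
    "HOL-Algebra.Group_Action"
    "HOL-Algebra.Left_Coset"
begin

section \<open>The symplectic group and the Siegel upper half-space\<close>

text \<open>\<open>2 \<times> 2\<close> block matrices are indexed by the sum type \<open>2 + 2\<close> (which has four elements):
  \<open>Inl\<close> indexes the first two rows (columns) and \<open>Inr\<close> the last two.\<close>

type_synonym 'a mat2 = "'a^2^2"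
type_synonym 'a mat4 = "'a^(2 + 2)^(2 + 2)"
type_synonym 'a mat42 = "'a^2^(2 + 2)"

definition block_A :: "'a mat4 \<Rightarrow> 'a mat2" where
  "block_A M = (\<chi> i j. M $ Inl i $ Inl j)"

definition block_B :: "'a mat4 \<Rightarrow> 'a mat2" where
  "block_B M = (\<chi> i j. M $ Inl i $ Inr j)"

definition block_C :: "'a mat4 \<Rightarrow> 'a mat2" where
  "block_C M = (\<chi> i j. M $ Inr i $ Inl j)"

definition block_D :: "'a mat4 \<Rightarrow> 'a mat2" where
  "block_D M = (\<chi> i j. M $ Inr i $ Inr j)"

definition block_mat :: "'a mat2 \<Rightarrow> 'a mat2 \<Rightarrow> 'a mat2 \<Rightarrow> 'a mat2 \<Rightarrow> 'a mat4" where
  "block_mat A B C D =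
     (\<chi> i j. case i of
        Inl k \<Rightarrow> (case j of Inl l \<Rightarrow> A $ k $ l | Inr l \<Rightarrow> B $ k $ l)
      | Inr k \<Rightarrow> (case j of Inl l \<Rightarrow> C $ k $ l | Inr l \<Rightarrow> D $ k $ l))"

definition Omega :: "real mat4" where
  "Omega = block_mat 0 (mat 1) (- mat 1) 0"

definition Sp4 :: "real mat4 monoid" where
  "Sp4 = \<lparr>carrier = {M. transpose M ** Omega ** M = Omega}, mult = (**), one = mat 1\<rparr>"

abbreviation of_real_mat :: "real^'n^'m \<Rightarrow> complex^'n^'m" where
  "of_real_mat \<equiv> map_matrix complex_of_real"

definition Siegel :: "complex mat2 set" where
  "Siegel = {Z. transpose Z = Z \<and> (\<forall>v :: real^2. v \<noteq> 0 \<longrightarrow> v \<bullet> (map_matrix Im Z *v v) > 0)}"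

definition Siegel_act :: "real mat4 \<Rightarrow> complex mat2 \<Rightarrow> complex mat2" where
  "Siegel_act g Z =
     (of_real_mat (block_A g) ** Z + of_real_mat (block_B g)) **
     matrix_inv (of_real_mat (block_C g) ** Z + of_real_mat (block_D g))"


section \<open>The Grassmannian and the normal bundle\<close>

definition P2_rel :: "(complex mat42 \<times> complex mat42) set" where
  "P2_rel = {(M, N). rank M = 2 \<and> rank N = 2 \<and> (\<exists>Q :: complex mat2. invertible Q \<and> N = M ** Q)}"

definition P2 :: "complex mat42 set set" where
  "P2 = {M. rank M = 2} // P2_rel"

definition P2_act :: "real mat4 \<Rightarrow> complex mat42 set \<Rightarrow> complex mat42 set" where
  "P2_act g X = (\<lambda>M. of_real_mat g ** M) ` X"

definition P2_chart :: "complex mat2 \<Rightarrow> complex mat42 set" where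
  "P2_chart Z = P2_rel ``
     {\<chi> i. case i of Inl k \<Rightarrow> Z $ k | Inr k \<Rightarrow> (mat 1 :: complex mat2) $ k}"

text \<open>The action on \<^term>\<open>P2\<close> read in the chart. It is only meaningful where the moved point is
  again in the image of the chart; this is so in a neighbourhood of \<^term>\<open>Siegel\<close>.\<close>

definition P2_act_in_chart :: "real mat4 \<Rightarrow> complex mat2 \<Rightarrow> complex mat2" where
  "P2_act_in_chart g Z = (THE W. P2_chart W = P2_act g (P2_chart Z))"

definition normal_vec1 :: "complex mat2" where
  "normal_vec1 = vector [vector [0, 1], vector [-1, 0]]"

text \<open>\<^term>\<open>normal_vec w\<close> is the chart representation of the normal vector \<open>w \<cdot> vec\<^sub>1\<close>; for
  \<open>w = x + \<i> y\<close> this is \<open>x \<cdot> vec\<^sub>1 + y \<cdot> vec\<^sub>2\<close>.\<close>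

definition normal_vec :: "complex \<Rightarrow> complex mat2" where
  "normal_vec w = map_matrix ((*) w) normal_vec1"

text \<open>The factor by which the tangent map of \<open>g\<close> at \<open>Z\<close> acts on the fibre of the normal bundle.\<close>

definition normal_factor :: "real mat4 \<Rightarrow> complex mat2 \<Rightarrow> complex" where
  "normal_factor g Z =
     (THE c. \<exists>T. (P2_act_in_chart g has_derivative T) (at Z) \<and>
                 (\<forall>w. T (normal_vec w) = normal_vec (c * w)))"


section \<open>The two actions\<close>

text \<open>As required by the library locale \<^locale>\<open>group_action\<close>, the maps by which group elements act
  are extensional, i.e. \<^term>\<open>undefined\<close> outside the space acted upon.\<close>

definition SiegelS1 :: "(complex mat2 \<times> complex) set" where
  "SiegelS1 = Siegel \<times> sphere 0 1"

definition SiegelS1_act :: "real mat4 \<Rightarrow> complex mat2 \<times> complex \<Rightarrow> complex mat2 \<times> complex" where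
  "SiegelS1_act g =
     (\<lambda>(Z, u)\<in>SiegelS1.
        (Siegel_act g Z, normal_factor g Z / complex_of_real (norm (normal_factor g Z)) * u))"

definition SiegelR :: "(complex mat2 \<times> real) set" where
  "SiegelR = Siegel \<times> UNIV"

definition SiegelR_proj :: "complex mat2 \<times> real \<Rightarrow> complex mat2 \<times> complex" where
  "SiegelR_proj = (\<lambda>(Z, t). (Z, cis t))"

text \<open>\<open>(G, p)\<close> is the universal covering group of the (connected, locally path-connected)
  group \<open>H\<close>, whose carrier has the subspace topology. The predicate \<^const>\<open>simply_connected\<close>
  includes path-connectedness.\<close>

definition topological_group_on :: "('a::topological_space, 'c) monoid_scheme \<Rightarrow> bool" where
  "topological_group_on G \<longleftrightarrow>
     group G \<and>
     continuous_on (carrier G \<times> carrier G) (\<lambda>(x, y). x \<otimes>\<^bsub>G\<^esub> y) \<and>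
     continuous_on (carrier G) (\<lambda>x. inv\<^bsub>G\<^esub> x)"

definition universal_covering_group ::
  "('a::topological_space, 'c) monoid_scheme \<Rightarrow> ('a \<Rightarrow> 'b) \<Rightarrow>
   ('b::topological_space, 'd) monoid_scheme \<Rightarrow> bool" where
  "universal_covering_group G p H \<longleftrightarrow>
     topological_group_on G \<and> simply_connected (carrier G) \<and>
     covering_space (carrier G) p (carrier H) \<and> p \<in> hom G H"

text \<open>The unique lift for which the identity acts as the identity.\<close>

definition SiegelR_act ::
  "('a::topological_space, 'c) monoid_scheme \<Rightarrow> ('a \<Rightarrow> real mat4) \<Rightarrow>
   'a \<Rightarrow> complex mat2 \<times> real \<Rightarrow> complex mat2 \<times> real" where
  "SiegelR_act G p =
     (THE \<phi>. \<phi> \<in> carrier G \<rightarrow>\<^sub>E (SiegelR \<rightarrow>\<^sub>E SiegelR) \<and>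
             continuous_on (carrier G \<times> SiegelR) (\<lambda>(g, x). \<phi> g x) \<and>
             (\<forall>x\<in>SiegelR. \<phi> \<one>\<^bsub>G\<^esub> x = x) \<and>
             (\<forall>g\<in>carrier G. \<forall>x\<in>SiegelR.
                SiegelR_proj (\<phi> g x) = SiegelS1_act (p g) (SiegelR_proj x)))"


section \<open>\<open>SU(2)\<close> and homogeneous spaces\<close>

definition SU2 :: "complex mat2 monoid" where
  "SU2 = \<lparr>carrier = {U. transpose (map_matrix cnj U) ** U = mat 1 \<and> det U = 1},
          mult = (**), one = mat 1\<rparr>"

definition topological_group_isomorphic ::
  "('a::topological_space, 'c) monoid_scheme \<Rightarrow> ('b::topological_space, 'd) monoid_scheme \<Rightarrow> bool"
where
  "topological_group_isomorphic G H \<longleftrightarrow>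
     (\<exists>f\<in>iso G H. homeomorphic_map (top_of_set (carrier G)) (top_of_set (carrier H)) f)"

text \<open>The quotient topology on the set of left cosets.\<close>

definition coset_topology ::
  "('a::topological_space, 'c) monoid_scheme \<Rightarrow> 'a set \<Rightarrow> 'a set topology" where
  "coset_topology G H = topology (\<lambda>U. U \<subseteq> lcosets\<^bsub>G\<^esub> H \<and>
     openin (top_of_set (carrier G)) {g \<in> carrier G. g <#\<^bsub>G\<^esub> H \<in> U})"

lemma openin_coset_topology:
  "openin (coset_topology G H) U \<longleftrightarrow>
     U \<subseteq> lcosets\<^bsub>G\<^esub> H \<and> openin (top_of_set (carrier G)) {g \<in> carrier G. g <#\<^bsub>G\<^esub> H \<in> U}"
proof -
  let ?P = "\<lambda>U. U \<subseteq> lcosets\<^bsub>G\<^esub> H \<and>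
     openin (top_of_set (carrier G)) {g \<in> carrier G. g <#\<^bsub>G\<^esub> H \<in> U}"
  have "istopology ?P"
    unfolding istopology_def
  proof (intro conjI allI impI)
    fix S T assume S: "?P S" and T: "?P T"
    then have "openin (top_of_set (carrier G))
       ({g \<in> carrier G. g <#\<^bsub>G\<^esub> H \<in> S} \<inter> {g \<in> carrier G. g <#\<^bsub>G\<^esub> H \<in> T})"
      by blast
    then show "openin (top_of_set (carrier G)) {g \<in> carrier G. g <#\<^bsub>G\<^esub> H \<in> S \<inter> T}"
      by (rule back_subst[where P = "openin _"]) auto
    show "S \<inter> T \<subseteq> lcosets\<^bsub>G\<^esub> H" using S by auto
  next
    fix K assume K: "\<forall>S\<in>K. ?P S"
    then have "openin (top_of_set (carrier G)) (\<Union>S\<in>K. {g \<in> carrier G. g <#\<^bsub>G\<^esub> H \<in> S})"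
      by blast
    then show "openin (top_of_set (carrier G)) {g \<in> carrier G. g <#\<^bsub>G\<^esub> H \<in> \<Union> K}"
      by (rule back_subst[where P = "openin _"]) auto
    show "\<Union> K \<subseteq> lcosets\<^bsub>G\<^esub> H" using K by auto
  qed
  then show ?thesis
    by (simp add: coset_topology_def topology_inverse')
qed

text \<open>For an action \<open>\<phi>\<close> of \<open>G\<close> on \<open>X\<close> and a basepoint \<open>x\<close> with stabilizer \<open>K\<close>: there is an
  equivariant homeomorphism from \<open>G/K\<close>, on which \<open>G\<close> acts by left multiplication, to \<open>X\<close>
  taking the coset \<open>K\<close> to \<open>x\<close>.\<close>

definition equivariantly_identified ::
  "('a::topological_space, 'c) monoid_scheme \<Rightarrow> 'b::topological_space set \<Rightarrow>
   ('a \<Rightarrow> 'b \<Rightarrow> 'b) \<Rightarrow> 'b \<Rightarrow> bool" where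
  "equivariantly_identified G X \<phi> x \<longleftrightarrow>
     (let K = stabilizer G \<phi> x in
      \<exists>f. homeomorphic_map (coset_topology G K) (top_of_set X) f \<and> f K = x \<and>
          (\<forall>g\<in>carrier G. \<forall>C\<in>lcosets\<^bsub>G\<^esub> K. f (g <#\<^bsub>G\<^esub> C) = \<phi> g (f C)))"

end

theory Submission
  imports Defs
begin

text \<open>Writing \<open>N = C Z + D\<close>, the tangent map of \<open>g\<close> at \<open>Z\<close> is \<open>H \<mapsto> N\<^sup>-\<^sup>T H N\<^sup>-\<^sup>1\<close>, so on
  antisymmetric \<open>H\<close> it is multiplication by \<open>1 / det N\<close>; hence \<open>g\<close> rotates the circle by the
  phase \<open>\<bar>det N\<bar> / det N\<close>. Cholesky factors and diagonal unitary matrices provide a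
  global continuous section of the orbit map at \<open>(i I, 1)\<close>, whose stabilizer consists of the
  \<open>C i + D \<in> SU(2)\<close>. Thus \<open>Sp(4)\<close> is homeomorphic to \<open>Siegel \<times> S\<^sup>1 \<times> SU(2)\<close>, and the pairs \<open>(g, t)\<close>
  with \<open>cis t\<close> equal to the phase of \<open>g\<close> at \<open>i I\<close> form the space \<open>Siegel \<times> \<real> \<times> SU(2)\<close>, which is
  simply connected because \<open>SU(2)\<close> is a 3-sphere. By uniqueness of simply connected covers it is
  homeomorphic to the universal covering group, over which the section and the stabilizer lift.
  As the ambient type of the covering group is an arbitrary topological space, the liftings are
  obtained from the group structure instead of the library results for normed spaces.\<close>

subsection \<open>Lifting along homomorphisms with a local section\<close>

text \<open>The scalar on the fibre comes from the identity M^T J M = (det M) J, valid for every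
  antisymmetric 2 x 2 matrix J. The chart action, the normal factor and the lifted action are
  definite descriptions, so each formula for them needs its own uniqueness argument: injectivity of
  the chart, uniqueness of derivatives, uniqueness of lifts. A global section
  \<open>\<sigma>\<close> serves twice. Followed by the projection to cosets it is a continuous
  inverse of \<open>G/K \<rightarrow> X\<close>, so no open mapping argument enters; and it splits
  \<open>Sp4\<close> as a product in which the circle coordinate is exactly the phase at i I.
  Unwrapping that coordinate therefore turns the circle into the line and touches nothing else. The
  stabilizer does not grow upstairs: the elements over SU(2) form sheets indexed by the multiples of
  2 pi, and fixing the real coordinate selects one of them. Lifting is possible over an arbitrary
  domain of definition of the cover because the covering map is a homomorphism: lifts are compared
  and corrected by multiplication in the group, and only the base needs a metric.\<close>

lemma topological_group_onD:
  assumes "topological_group_on G"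
  shows "group G"
    and "continuous_on (carrier G \<times> carrier G) (\<lambda>(x, y). x \<otimes>\<^bsub>G\<^esub> y)"
    and "continuous_on (carrier G) (\<lambda>x. inv\<^bsub>G\<^esub> x)"
  using assms by (auto simp: topological_group_on_def)

lemma continuous_on_group_mult:
  assumes "topological_group_on G" "continuous_on S f" "continuous_on S g"
    and "f \<in> S \<rightarrow> carrier G" "g \<in> S \<rightarrow> carrier G"
  shows "continuous_on S (\<lambda>x. f x \<otimes>\<^bsub>G\<^esub> g x)"
proof -
  have "continuous_on S ((\<lambda>(x, y). x \<otimes>\<^bsub>G\<^esub> y) \<circ> (\<lambda>x. (f x, g x)))"
    by (rule continuous_on_compose)
      (use assms(4,5) in \<open>auto intro!: continuous_on_Pair assms
        intro: continuous_on_subset[OF topological_group_onD(2)[OF assms(1)]]\<close>)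
  then show ?thesis by (simp add: o_def)
qed

lemma continuous_on_group_inv:
  assumes "topological_group_on G" "continuous_on S f" "f \<in> S \<rightarrow> carrier G"
  shows "continuous_on S (\<lambda>x. inv\<^bsub>G\<^esub> (f x))"
  using assms(3)
  by (intro continuous_on_compose2[OF topological_group_onD(3)[OF assms(1)] assms(2)]) auto

text \<open>Meant for lifts chosen pointwise, for which an explicit formula is only available near
  each point.\<close>

lemma continuous_on_openin_local:
  assumes "\<And>x. x \<in> S \<Longrightarrow> \<exists>U. openin (top_of_set S) U \<and> x \<in> U \<and> continuous_on U f"
  shows "continuous_on S f"
  unfolding continuous_on_def
proof
  fix x assume "x \<in> S"
  then obtain U where U: "openin (top_of_set S) U" "x \<in> U" "continuous_on U f"
    using assms by blast
  then obtain W where W: "open W" "U = S \<inter> W" by (auto simp: openin_open)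
  have "at x within S = at x within U"
    by (rule at_within_nhd[of x W]) (use U W in auto)
  then show "(f \<longlongrightarrow> f x) (at x within S)"
    using U by (simp add: continuous_on_def)
qed

text \<open>Any two loops are freely homotopic, in particular two constant ones; following loop
  parameter 0 through the homotopy gives a path between the two points.\<close>

lemma simply_connected_imp_path_connected_gen:
  assumes "simply_connected S"
  shows "path_connected S"
  unfolding path_connected_def
proof (intro ballI)
  fix x y assume xy: "x \<in> S" "y \<in> S"
  then have "homotopic_loops S (\<lambda>_. x) (\<lambda>_. y)"
    using assms[unfolded simply_connected_def, rule_format, of "\<lambda>_. x" "\<lambda>_. y"]
    by (auto simp: path_def pathstart_def pathfinish_def path_image_def)
  then obtain h where h: "continuous_on ({0..1::real} \<times> {0..1::real}) h" "h \<in> {0..1} \<times> {0..1} \<rightarrow> S"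
    "\<And>t. t \<in> {0..1} \<Longrightarrow> h (0, t) = x" "\<And>t. t \<in> {0..1} \<Longrightarrow> h (1, t) = y"
    unfolding homotopic_loops by auto
  have "continuous_on {0..1} (\<lambda>t. h (t, 0))"
    by (rule continuous_on_compose2[OF h(1)]) (auto intro!: continuous_intros)
  then show "\<exists>g. path g \<and> path_image g \<subseteq> S \<and> pathstart g = x \<and> pathfinish g = y"
    using h by (intro exI[of _ "\<lambda>t. h (t, 0)"])
      (auto simp: path_def path_image_def pathstart_def pathfinish_def Pi_iff)
qed

text \<open>Abstracts what a covering homomorphism offers near the identity: a continuous local
  inverse \<open>\<kappa>\<close> on \<open>T\<close>, and a neighbourhood \<open>U\<close>
  isolating the identity in the kernel. It is instantiated both by the universal covering group and
  by \<open>cis\<close>. Only \<open>B\<close> is metric, for uniform continuity.\<close>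

locale local_section_hom =
  fixes A :: "('a::topological_space, 'c) monoid_scheme"
    and B :: "('b::metric_space, 'd) monoid_scheme"
    and p :: "'a \<Rightarrow> 'b" and T :: "'b set" and \<kappa> :: "'b \<Rightarrow> 'a" and U :: "'a set"
  assumes A: "topological_group_on A" and B: "topological_group_on B"
    and p_hom: "p \<in> hom A B" and p_cont: "continuous_on (carrier A) p"
    and T_open: "openin (top_of_set (carrier B)) T" and one_T: "\<one>\<^bsub>B\<^esub> \<in> T"
    and \<kappa>_cont: "continuous_on T \<kappa>" and \<kappa>_im: "\<kappa> \<in> T \<rightarrow> carrier A"
    and p_\<kappa>: "\<And>x. x \<in> T \<Longrightarrow> p (\<kappa> x) = x" and \<kappa>_one: "\<kappa> \<one>\<^bsub>B\<^esub> = \<one>\<^bsub>A\<^esub>"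
    and U_open: "openin (top_of_set (carrier A)) U" and one_U: "\<one>\<^bsub>A\<^esub> \<in> U"
    and kernel_discrete: "\<And>x. x \<in> U \<Longrightarrow> p x = \<one>\<^bsub>B\<^esub> \<Longrightarrow> x = \<one>\<^bsub>A\<^esub>"
begin

sublocale A: group A using A by (rule topological_group_onD)
sublocale B: group B using B by (rule topological_group_onD)
sublocale P: group_hom A B p by unfold_locales (rule p_hom)

text \<open>The quotient \<open>d\<close> of the two lifts takes values in the discrete kernel, so
  all its fibres are open; its fibre over the identity is thus clopen, and it contains
  \<open>x0\<close>.\<close>

lemma lift_unique:
  fixes c1 c2 :: "'x::topological_space \<Rightarrow> 'a"
  assumes X: "connected X" "x0 \<in> X" "x \<in> X"
    and c1: "continuous_on X c1" "c1 \<in> X \<rightarrow> carrier A"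
    and c2: "continuous_on X c2" "c2 \<in> X \<rightarrow> carrier A"
    and eq: "\<And>x. x \<in> X \<Longrightarrow> p (c1 x) = p (c2 x)" "c1 x0 = c2 x0"
  shows "c1 x = c2 x"
proof -
  define d where "d = (\<lambda>x. inv\<^bsub>A\<^esub> (c1 x) \<otimes>\<^bsub>A\<^esub> c2 x)"
  have d_im: "d x \<in> carrier A" if "x \<in> X" for x
    using c1(2) c2(2) that by (auto simp: d_def)
  have d_cont: "continuous_on X d"
    unfolding d_def using c1 c2 by (intro continuous_on_group_mult[OF A] continuous_on_group_inv[OF A]) auto
  have pd: "p (d x) = \<one>\<^bsub>B\<^esub>" if "x \<in> X" for x
  proof -
    have "c1 x \<in> carrier A" "c2 x \<in> carrier A" using c1(2) c2(2) that by auto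
    then show ?thesis unfolding d_def using eq(1)[OF that] by (simp add: P.hom_inv)
  qed
  \<comment> \<open>Translation by the inverse of \<open>z\<close> carries \<open>z\<close> to the
    identity, which \<open>U\<close> isolates in the kernel.\<close>
  have op: "openin (top_of_set X) {x \<in> X. d x = z}" if z: "z \<in> carrier A" "p z = \<one>\<^bsub>B\<^esub>" for z
  proof -
    have "continuous_on X (\<lambda>x. inv\<^bsub>A\<^esub> z \<otimes>\<^bsub>A\<^esub> d x)"
      using d_im z by (intro continuous_on_group_mult[OF A] d_cont) auto
    then have "openin (top_of_set X) (X \<inter> (\<lambda>x. inv\<^bsub>A\<^esub> z \<otimes>\<^bsub>A\<^esub> d x) -` U)"
      using d_im z by (intro continuous_openin_preimage[OF _ _ U_open]) auto
    moreover have "X \<inter> (\<lambda>x. inv\<^bsub>A\<^esub> z \<otimes>\<^bsub>A\<^esub> d x) -` U = {x \<in> X. d x = z}"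
    proof (intro equalityI subsetI)
      fix x assume "x \<in> X \<inter> (\<lambda>x. inv\<^bsub>A\<^esub> z \<otimes>\<^bsub>A\<^esub> d x) -` U"
      then have x: "x \<in> X" "inv\<^bsub>A\<^esub> z \<otimes>\<^bsub>A\<^esub> d x \<in> U" by auto
      then have "inv\<^bsub>A\<^esub> z \<otimes>\<^bsub>A\<^esub> d x = \<one>\<^bsub>A\<^esub>"
        using z d_im[of x] pd[of x] by (intro kernel_discrete) (auto simp: P.hom_inv)
      then show "x \<in> {x \<in> X. d x = z}"
        using z d_im[OF x(1)] x(1) by (metis (mono_tags) A.inv_equality A.inv_inv A.inv_closed mem_Collect_eq)
    qed (use z one_U in auto)
    ultimately show ?thesis by simp
  qed
  have d1: "openin (top_of_set X) {x \<in> X. d x = \<one>\<^bsub>A\<^esub>}"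
    by (intro op) auto
  have "openin (top_of_set X) (\<Union>z\<in>{z\<in>carrier A. p z = \<one>\<^bsub>B\<^esub> \<and> z \<noteq> \<one>\<^bsub>A\<^esub>}. {x \<in> X. d x = z})"
    by (intro openin_Union) (auto intro: op)
  also have "(\<Union>z\<in>{z\<in>carrier A. p z = \<one>\<^bsub>B\<^esub> \<and> z \<noteq> \<one>\<^bsub>A\<^esub>}. {x \<in> X. d x = z}) = X - {x \<in> X. d x = \<one>\<^bsub>A\<^esub>}"
    using d_im pd by auto
  finally have "closedin (top_of_set X) {x \<in> X. d x = \<one>\<^bsub>A\<^esub>}"
    by (simp add: closedin_def)
  with d1 X(1) have "{x \<in> X. d x = \<one>\<^bsub>A\<^esub>} = {} \<or> {x \<in> X. d x = \<one>\<^bsub>A\<^esub>} = X"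
    unfolding connected_clopen by blast
  moreover have "c2 x0 \<in> carrier A" using c2(2) X(2) by auto
  then have "d x0 = \<one>\<^bsub>A\<^esub>" using eq(2) by (simp add: d_def)
  ultimately have "d x = \<one>\<^bsub>A\<^esub>" using X by auto
  moreover have "c1 x \<in> carrier A" "c2 x \<in> carrier A" using c1(2) c2(2) X by auto
  ultimately show ?thesis unfolding d_def by (metis A.inv_equality A.inv_inv A.inv_closed)
qed

text \<open>The correction principle behind all liftings: when \<open>b\<close> differs from
  \<open>a\<close> by a factor in \<open>T\<close>, that factor is lifted by \<open>\<kappa>\<close>
  and multiplied onto the known lift of \<open>a\<close>.\<close>

lemma lift_step:
  fixes a b :: "'x::topological_space \<Rightarrow> 'b"
  assumes a: "continuous_on X a" "a \<in> X \<rightarrow> carrier B"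
    and b: "continuous_on X b" "b \<in> X \<rightarrow> carrier B"
    and ab: "\<And>x. x \<in> X \<Longrightarrow> inv\<^bsub>B\<^esub> (a x) \<otimes>\<^bsub>B\<^esub> b x \<in> T"
    and c: "continuous_on X c" "c \<in> X \<rightarrow> carrier A" "\<And>x. x \<in> X \<Longrightarrow> p (c x) = a x"
  defines "c' \<equiv> \<lambda>x. c x \<otimes>\<^bsub>A\<^esub> \<kappa> (inv\<^bsub>B\<^esub> (a x) \<otimes>\<^bsub>B\<^esub> b x)"
  shows "continuous_on X c'" "c' \<in> X \<rightarrow> carrier A" "\<And>x. x \<in> X \<Longrightarrow> p (c' x) = b x"
proof -
  have "continuous_on X (\<lambda>x. inv\<^bsub>B\<^esub> (a x) \<otimes>\<^bsub>B\<^esub> b x)"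
    using a b by (intro continuous_on_group_mult[OF B] continuous_on_group_inv[OF B]) auto
  then have "continuous_on X (\<lambda>x. \<kappa> (inv\<^bsub>B\<^esub> (a x) \<otimes>\<^bsub>B\<^esub> b x))"
    by (rule continuous_on_compose2[OF \<kappa>_cont]) (use ab in auto)
  then show "continuous_on X c'"
    unfolding c'_def using c ab \<kappa>_im by (intro continuous_on_group_mult[OF A]) auto
  show "c' \<in> X \<rightarrow> carrier A"
    unfolding c'_def using c ab \<kappa>_im by (auto simp: Pi_iff)
  show "p (c' x) = b x" if "x \<in> X" for x
  proof -
    have "\<kappa> (inv\<^bsub>B\<^esub> (a x) \<otimes>\<^bsub>B\<^esub> b x) \<in> carrier A" "c x \<in> carrier A" "a x \<in> carrier B" "b x \<in> carrier B"
      using ab \<kappa>_im c that a b by (auto simp: Pi_iff)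
    then show ?thesis
      using that ab c(3) by (simp add: c'_def p_\<kappa> B.m_assoc[symmetric])
  qed
qed

text \<open>Uniform continuity makes \<open>h (\<tau>, s)\<^sup>-\<^sup>1 h (\<tau>', s)\<close> small for \<open>\<tau>'\<close> close to \<open>\<tau>\<close>, uniformly
  in \<open>s\<close>, so a lift at time \<open>\<tau>\<close> is corrected by the local section to a lift at time \<open>\<tau>'\<close>; closed
  lifts of loops stay closed.\<close>

lemma lift_homotopy:
  fixes h :: "real \<times> real \<Rightarrow> 'b"
  assumes h: "continuous_on ({0..1} \<times> {0..1}) h" "h \<in> {0..1} \<times> {0..1} \<rightarrow> carrier B"
    and c: "continuous_on {0..1} c" "c \<in> {0..1} \<rightarrow> carrier A" "\<And>s. s \<in> {0..1} \<Longrightarrow> p (c s) = h (0, s)"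
  obtains c' where "continuous_on {0..1} c'" "c' \<in> {0..1} \<rightarrow> carrier A"
    "\<And>s. s \<in> {0..1} \<Longrightarrow> p (c' s) = h (1, s)"
    "c 0 = c 1 \<Longrightarrow> (\<And>\<tau>. \<tau> \<in> {0..1} \<Longrightarrow> h (\<tau>, 0) = h (\<tau>, 1)) \<Longrightarrow> c' 0 = c' 1"
proof -
  define I where "I = {0..1::real}"
  note IX = I_def[symmetric]
  define F where "F = (\<lambda>(\<tau>, \<tau>', s). inv\<^bsub>B\<^esub> (h (\<tau>, s)) \<otimes>\<^bsub>B\<^esub> h (\<tau>', s))"
  have hI: "h (\<tau>, s) \<in> carrier B" if "\<tau> \<in> I" "s \<in> I" for \<tau> s
    using h(2) that by (auto simp: I_def)
  have "continuous_on (I \<times> I \<times> I) F"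
    unfolding F_def split_def
    by (intro continuous_on_group_mult[OF B] continuous_on_group_inv[OF B]
          continuous_on_compose2[OF h(1)] continuous_intros)
      (use hI in \<open>auto simp: I_def\<close>)
  then have F_unif: "uniformly_continuous_on (I \<times> I \<times> I) F"
    by (intro compact_uniformly_continuous) (auto simp: I_def intro!: compact_Times)
  obtain W where W: "open W" "T = carrier B \<inter> W" using T_open by (auto simp: openin_open)
  then obtain e where e: "e > 0" "ball \<one>\<^bsub>B\<^esub> e \<subseteq> W"
    using one_T open_contains_ball by blast
  obtain d where d: "d > 0"
    "\<And>x y. x \<in> I \<times> I \<times> I \<Longrightarrow> y \<in> I \<times> I \<times> I \<Longrightarrow> dist y x < d \<Longrightarrow> dist (F y) (F x) < e"
    using F_unif e unfolding uniformly_continuous_on_def by metis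
  have near: "inv\<^bsub>B\<^esub> (h (\<tau>, s)) \<otimes>\<^bsub>B\<^esub> h (\<tau>', s) \<in> T"
    if "\<tau> \<in> I" "\<tau>' \<in> I" "s \<in> I" "\<bar>\<tau>' - \<tau>\<bar> < d" for \<tau> \<tau>' s
  proof -
    \<comment> \<open>On the diagonal \<open>F\<close> is the identity, so closeness to the diagonal
      value is closeness to the identity.\<close>
    have "dist (F (\<tau>, \<tau>', s)) (F (\<tau>, \<tau>, s)) < e"
      using that by (intro d) (auto simp: dist_Pair_Pair dist_real_def)
    moreover have "F (\<tau>, \<tau>, s) = \<one>\<^bsub>B\<^esub>" using hI that by (simp add: F_def)
    ultimately have "F (\<tau>, \<tau>', s) \<in> W" using e by (auto simp: dist_commute)
    then show ?thesis using hI that W by (simp add: F_def)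
  qed
  obtain n :: nat where n: "n > 0" "1 / real n < d"
    using d(1) by (metis nat_approx_posE zero_less_Suc)
  have "\<exists>c'. continuous_on I c' \<and> c' \<in> I \<rightarrow> carrier A \<and>
    (\<forall>s\<in>I. p (c' s) = h (real k / real n, s)) \<and>
    (c 0 = c 1 \<longrightarrow> (\<forall>\<tau>\<in>I. h (\<tau>, 0) = h (\<tau>, 1)) \<longrightarrow> c' 0 = c' 1)" if "k \<le> n" for k
    using that
  proof (induction k)
    case 0
    then show ?case using c by (intro exI[of _ c]) (auto simp: I_def)
  next
    case (Suc k)
    then obtain c' where c': "continuous_on I c'" "c' \<in> I \<rightarrow> carrier A"
      "\<And>s. s \<in> I \<Longrightarrow> p (c' s) = h (real k / real n, s)"
      "c 0 = c 1 \<longrightarrow> (\<forall>\<tau>\<in>I. h (\<tau>, 0) = h (\<tau>, 1)) \<longrightarrow> c' 0 = c' 1" by auto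
    have kn: "real k / real n \<in> I" "real (Suc k) / real n \<in> I"
      using Suc.prems by (auto simp: I_def)
    have "real (Suc k) / real n - real k / real n = 1 / real n"
      using n by (simp add: field_simps)
    then have dk: "\<bar>real (Suc k) / real n - real k / real n\<bar> < d" using n by simp
    have cont: "continuous_on I (\<lambda>s. h (\<tau>, s))" if "\<tau> \<in> I" for \<tau>
      by (rule continuous_on_compose2[OF h(1)]) (use that in \<open>auto simp: I_def intro!: continuous_intros\<close>)
    note st = lift_step[OF cont[OF kn(1)] _ cont[OF kn(2)] _ near[OF kn(1) kn(2) _ dk] c'(1-3)]
    show ?case
    proof (rule exI, intro conjI ballI impI)
      fix s assume "s \<in> I"
      with st(3)[of s] hI kn show "p (c' s \<otimes>\<^bsub>A\<^esub> \<kappa> (inv\<^bsub>B\<^esub> h (real k / real n, s) \<otimes>\<^bsub>B\<^esub>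
        h (real (Suc k) / real n, s))) = h (real (Suc k) / real n, s)" by auto
    next
      assume "c 0 = c 1" "\<forall>\<tau>\<in>I. h (\<tau>, 0) = h (\<tau>, 1)"
      with kn c'(4) show "c' 0 \<otimes>\<^bsub>A\<^esub> \<kappa> (inv\<^bsub>B\<^esub> h (real k / real n, 0) \<otimes>\<^bsub>B\<^esub>
        h (real (Suc k) / real n, 0)) = c' 1 \<otimes>\<^bsub>A\<^esub> \<kappa> (inv\<^bsub>B\<^esub> h (real k / real n, 1) \<otimes>\<^bsub>B\<^esub>
        h (real (Suc k) / real n, 1))" by metis
    qed (use st(1,2) hI kn in auto)
  qed
  from this[of n] n show thesis by (auto simp: I_def intro: that)
qed

text \<open>\<open>(\<tau>, s) \<mapsto> g (\<tau> s)\<close> contracts the path to its starting point, whose lift is constant.\<close>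

lemma lift_path:
  fixes g :: "real \<Rightarrow> 'b"
  assumes g: "continuous_on {0..1} g" "g \<in> {0..1} \<rightarrow> carrier B"
    and a: "a \<in> carrier A" "p a = g 0"
  obtains c where "continuous_on {0..1} c" "c \<in> {0..1} \<rightarrow> carrier A"
    "\<And>s. s \<in> {0..1} \<Longrightarrow> p (c s) = g s" "c 0 = a"
proof -
  have "continuous_on ({0..1} \<times> {0..1}) (\<lambda>(\<tau>, s). g (\<tau> * s))"
    unfolding split_def
    by (rule continuous_on_compose2[OF g(1)]) (auto intro!: continuous_intros simp: mult_le_one)
  moreover have "(\<lambda>(\<tau>, s). g (\<tau> * s)) \<in> {0..1} \<times> {0..1} \<rightarrow> carrier B"
    using g(2) by (auto simp: Pi_iff mult_le_one)
  ultimately obtain c where c: "continuous_on {0..1} c" "c \<in> {0..1} \<rightarrow> carrier A"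
    "\<And>s. s \<in> {0..1} \<Longrightarrow> p (c s) = g s"
    using a by (elim lift_homotopy[where c = "\<lambda>_. a"]) (auto intro!: continuous_intros)
  have c0: "c s \<in> carrier A" if "s \<in> {0..1}" for s using c(2) that by auto
  have g0: "g s \<in> carrier B" if "s \<in> {0..1}" for s using g(2) that by auto
  show thesis
  \<comment> \<open>The homotopy fixes the start of the lift only up to the kernel. As
    \<open>a\<close> and \<open>c 0\<close> lie over the same point, left translation by the kernel
    element \<open>a\<close> times the inverse of \<open>c 0\<close> repairs this.\<close>
  proof (rule that[of "\<lambda>s. a \<otimes>\<^bsub>A\<^esub> inv\<^bsub>A\<^esub> (c 0) \<otimes>\<^bsub>A\<^esub> c s"])
    show "continuous_on {0..1} (\<lambda>s. a \<otimes>\<^bsub>A\<^esub> inv\<^bsub>A\<^esub> (c 0) \<otimes>\<^bsub>A\<^esub> c s)"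
      using a c c0 by (intro continuous_on_group_mult[OF A]) auto
    show "p (a \<otimes>\<^bsub>A\<^esub> inv\<^bsub>A\<^esub> (c 0) \<otimes>\<^bsub>A\<^esub> c s) = g s" if "s \<in> {0..1}" for s
      using a c(3)[of 0] c(3)[OF that] c0[of 0] c0[OF that] g0[of 0] g0[OF that] by (simp add: P.hom_inv)
  qed (use a c0 in \<open>auto simp: A.m_assoc\<close>)
qed

section \<open>Lifting maps from simply connected spaces\<close>

definition lift_rel :: "'y::topological_space set \<Rightarrow> ('y \<Rightarrow> 'b) \<Rightarrow> 'y \<Rightarrow> 'a \<Rightarrow> 'y \<Rightarrow> 'a \<Rightarrow> bool" where
  "lift_rel Y f y0 a0 y a \<longleftrightarrow> (\<exists>\<gamma> c. path \<gamma> \<and> path_image \<gamma> \<subseteq> Y \<and> pathstart \<gamma> = y0 \<and> pathfinish \<gamma> = y \<and>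
     continuous_on {0..1} c \<and> c \<in> {0..1} \<rightarrow> carrier A \<and> (\<forall>s\<in>{0..1}. p (c s) = f (\<gamma> s)) \<and>
     c 0 = a0 \<and> c 1 = a)"

text \<open>The first path followed by the reverse of the second is a loop homotopic to a constant
  one, so it has a closed lift. The halves of this lift, traversed from its two ends, are lifts of
  the two paths starting at \<open>a0\<close>; both reach its midpoint value.\<close>

lemma lift_rel_unique:
  assumes Y: "simply_connected Y" "y0 \<in> Y"
    and f: "continuous_on Y f" "f \<in> Y \<rightarrow> carrier B"
    and a0: "a0 \<in> carrier A" "p a0 = f y0"
    and R1: "lift_rel Y f y0 a0 y a1" and R2: "lift_rel Y f y0 a0 y a2"
  shows "a1 = a2"
proof -
  obtain \<gamma>1 c1 where 1: "path \<gamma>1" "path_image \<gamma>1 \<subseteq> Y" "pathstart \<gamma>1 = y0" "pathfinish \<gamma>1 = y"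
    "continuous_on {0..1} c1" "c1 \<in> {0..1} \<rightarrow> carrier A" "\<And>s. s \<in> {0..1} \<Longrightarrow> p (c1 s) = f (\<gamma>1 s)"
    "c1 0 = a0" "c1 1 = a1" using R1 unfolding lift_rel_def by blast
  obtain \<gamma>2 c2 where 2: "path \<gamma>2" "path_image \<gamma>2 \<subseteq> Y" "pathstart \<gamma>2 = y0" "pathfinish \<gamma>2 = y"
    "continuous_on {0..1} c2" "c2 \<in> {0..1} \<rightarrow> carrier A" "\<And>s. s \<in> {0..1} \<Longrightarrow> p (c2 s) = f (\<gamma>2 s)"
    "c2 0 = a0" "c2 1 = a2" using R2 unfolding lift_rel_def by blast
  define \<gamma> where "\<gamma> = \<gamma>1 +++ reversepath \<gamma>2"
  have \<gamma>: "path \<gamma>" "path_image \<gamma> \<subseteq> Y" "pathstart \<gamma> = y0" "pathfinish \<gamma> = y0"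
    using 1 2 by (auto simp: \<gamma>_def path_image_join)
  have "homotopic_loops Y (\<lambda>_. y0) \<gamma>"
    using Y(1)[unfolded simply_connected_def, rule_format, of "\<lambda>_. y0" \<gamma>] Y(2) \<gamma>
    by (auto simp: path_def pathstart_def pathfinish_def path_image_def)
  then obtain h where h: "continuous_on ({0..1::real} \<times> {0..1::real}) h" "h \<in> {0..1} \<times> {0..1} \<rightarrow> Y"
    "\<forall>x\<in>{0..1}. h (0, x) = y0" "\<forall>x\<in>{0..1}. h (1, x) = \<gamma> x"
    "\<forall>t\<in>{0..1}. h (t, 1) = h (t, 0)"
    unfolding homotopic_loops pathfinish_def pathstart_def o_def by blast
  have "continuous_on ({0..1} \<times> {0..1}) (\<lambda>x. f (h x))"
    by (rule continuous_on_compose2[OF f(1) h(1)]) (use h(2) in auto)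
  moreover have "(\<lambda>x. f (h x)) \<in> {0..1} \<times> {0..1} \<rightarrow> carrier B"
    using h(2) f(2) by (auto simp: Pi_iff)
  ultimately obtain d where d: "continuous_on {0..1} d" "d \<in> {0..1} \<rightarrow> carrier A"
    "\<And>s. s \<in> {0..1} \<Longrightarrow> p (d s) = f (\<gamma> s)" "d 0 = d 1"
    using a0 h by (elim lift_homotopy[where c = "\<lambda>_. a0"]) (auto intro!: continuous_intros)
  \<comment> \<open>The closed lift may start at another point over \<open>f y0\<close>; a
    translation by a kernel element moves it to \<open>a0\<close>.\<close>
  define d' where "d' = (\<lambda>s. a0 \<otimes>\<^bsub>A\<^esub> inv\<^bsub>A\<^esub> (d 0) \<otimes>\<^bsub>A\<^esub> d s)"
  have dA: "d s \<in> carrier A" if "s \<in> {0..1}" for s using d(2) that by auto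
  have \<gamma>0: "\<gamma> 0 = y0" "\<gamma> 1 = y0" using \<gamma> by (auto simp: pathstart_def pathfinish_def)
  have fB: "f (\<gamma> s) \<in> carrier B" if "s \<in> {0..1}" for s
    using that \<gamma>(2) f(2) by (auto simp: path_image_def Pi_iff image_subset_iff)
  have d'1: "continuous_on {0..1} d'"
    unfolding d'_def using a0 d dA by (intro continuous_on_group_mult[OF A]) auto
  have d'2: "d' \<in> {0..1} \<rightarrow> carrier A" using a0 dA by (auto simp: d'_def)
  have d'3: "p (d' s) = f (\<gamma> s)" if "s \<in> {0..1}" for s
    using a0 d(3)[of 0] d(3)[OF that] dA[of 0] dA[OF that] fB[of 0] fB[OF that] \<gamma>0
    by (simp add: d'_def P.hom_inv)
  have d'4: "d' 0 = a0" "d' 1 = a0"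
    using a0 dA[of 0] dA[of 1] d(4) by (auto simp: d'_def A.m_assoc)
  have "c1 1 = d' (1 / 2 * 1)"
  proof (rule lift_unique[of "{0..1}" 0 1 c1 "\<lambda>s. d' (1 / 2 * s)"])
    show "continuous_on {0..1} (\<lambda>s. d' (1 / 2 * s))"
      by (rule continuous_on_compose2[OF d'1]) (auto intro!: continuous_intros)
    show "p (c1 s) = p (d' (1 / 2 * s))" if "s \<in> {0..1}" for s
      using that by (subst d'3) (auto simp: 1 \<gamma>_def joinpaths_def)
  qed (use 1 d'2 d'4 in auto)
  moreover have "c2 1 = d' (1 - 1 / 2 * 1)"
  proof (rule lift_unique[of "{0..1}" 0 1 c2 "\<lambda>s. d' (1 - 1 / 2 * s)"])
    show "continuous_on {0..1} (\<lambda>s. d' (1 - 1 / 2 * s))"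
      by (rule continuous_on_compose2[OF d'1]) (auto intro!: continuous_intros)
    show "p (c2 s) = p (d' (1 - 1 / 2 * s))" if "s \<in> {0..1}" for s
    \<comment> \<open>At \<open>s = 1\<close> the parameter is 1/2, which \<open>joinpaths\<close>
      assigns to the first path; there one needs that both paths end at \<open>y\<close>.\<close>
    proof (cases "s = 1")
      case True
      then show ?thesis
        by (subst d'3) (use 1 2 in \<open>auto simp: \<gamma>_def joinpaths_def pathfinish_def pathstart_def\<close>)
    next
      case False
      then show ?thesis
        using that by (subst d'3) (auto simp: 2 \<gamma>_def joinpaths_def reversepath_def)
    qed
  qed (use 2 d'2 d'4 in auto)
  ultimately show ?thesis using 1 2 by simp
qed

text \<open>The value at \<open>y\<close> is the endpoint of a lift along any path from
  \<open>y0\<close>. Near \<open>y\<close> it equals \<open>F y\<close> times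
  \<open>\<kappa>\<close> of the quotient of \<open>f\<close> values, because a short path can be
  appended; this formula gives continuity.\<close>

lemma lift_simply_connected:
  fixes f :: "'y::topological_space \<Rightarrow> 'b"
  assumes Y: "simply_connected Y" "locally path_connected Y" "y0 \<in> Y"
    and f: "continuous_on Y f" "f \<in> Y \<rightarrow> carrier B"
    and a0: "a0 \<in> carrier A" "p a0 = f y0"
  obtains F where "continuous_on Y F" "F \<in> Y \<rightarrow> carrier A"
    "\<And>y. y \<in> Y \<Longrightarrow> p (F y) = f y" "F y0 = a0"
proof -
  note unique = lift_rel_unique[OF Y(1,3) f a0]
  have RA: "a \<in> carrier A \<and> p a = f y \<and> y \<in> Y" if "lift_rel Y f y0 a0 y a" for y a
    using that unfolding lift_rel_def
    by (auto simp: pathfinish_def path_image_def Pi_iff image_subset_iff)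
  \<comment> \<open>Along a path in \<open>V\<close> the quotients stay in \<open>T\<close>, so
    \<open>lift_step\<close> applied to the constant lift \<open>a\<close> lifts the whole appended
    path; \<open>\<kappa>_one\<close> makes it start at \<open>a\<close>.\<close>
  have ext: "lift_rel Y f y0 a0 y' (a \<otimes>\<^bsub>A\<^esub> \<kappa> (inv\<^bsub>B\<^esub> (f y) \<otimes>\<^bsub>B\<^esub> f y'))"
    if R: "lift_rel Y f y0 a0 y a" and \<gamma>: "path \<gamma>" "path_image \<gamma> \<subseteq> V" "pathstart \<gamma> = y" "pathfinish \<gamma> = y'"
      and V: "V \<subseteq> Y" "\<And>z. z \<in> V \<Longrightarrow> inv\<^bsub>B\<^esub> (f y) \<otimes>\<^bsub>B\<^esub> f z \<in> T" for y y' a \<gamma> V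
  proof -
    obtain \<gamma>1 c where 1: "path \<gamma>1" "path_image \<gamma>1 \<subseteq> Y" "pathstart \<gamma>1 = y0" "pathfinish \<gamma>1 = y"
      "continuous_on {0..1} c" "c \<in> {0..1} \<rightarrow> carrier A" "\<And>s. s \<in> {0..1} \<Longrightarrow> p (c s) = f (\<gamma>1 s)"
      "c 0 = a0" "c 1 = a" using R unfolding lift_rel_def by blast
    have im: "\<gamma> s \<in> V" if "s \<in> {0..1}" for s using \<gamma>(2) that by (auto simp: path_image_def)
    have f\<gamma>: "continuous_on {0..1} (\<lambda>s. f (\<gamma> s))"
      by (rule continuous_on_compose2[OF f(1)]) (use \<gamma>(1) im V in \<open>auto simp: path_def\<close>)
    note Ra = RA[OF R]
    define c' where "c' = (\<lambda>s. a \<otimes>\<^bsub>A\<^esub> \<kappa> (inv\<^bsub>B\<^esub> (f y) \<otimes>\<^bsub>B\<^esub> f (\<gamma> s)))"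
    have c': "continuous_on {0..1} c'" "c' \<in> {0..1} \<rightarrow> carrier A" "\<And>s. s \<in> {0..1} \<Longrightarrow> p (c' s) = f (\<gamma> s)"
      unfolding c'_def
      by (rule lift_step[of "{0..1}" "\<lambda>_. f y" "\<lambda>s. f (\<gamma> s)" "\<lambda>_. a"];
          use f\<gamma> Ra V im f(2) in \<open>auto simp: Pi_iff subset_iff\<close>)+
    have "f y \<in> carrier B" using Ra f by auto
    then have c'0: "c' 0 = a" using \<gamma>(3) Ra by (simp add: c'_def pathstart_def \<kappa>_one)
    have "path (c +++ c')" using 1 c' c'0 by (intro path_join_imp) (auto simp: path_def pathstart_def pathfinish_def)
    moreover have "(c +++ c') s \<in> carrier A \<and> p ((c +++ c') s) = f ((\<gamma>1 +++ \<gamma>) s)" if "s \<in> {0..1}" for s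
      using 1(6,7) c'(2,3) that by (auto simp: joinpaths_def Pi_iff)
    moreover have "(c +++ c') 0 = a0" "(c +++ c') 1 = a \<otimes>\<^bsub>A\<^esub> \<kappa> (inv\<^bsub>B\<^esub> (f y) \<otimes>\<^bsub>B\<^esub> f y')"
      using 1 \<gamma>(4) by (auto simp: joinpaths_def c'_def pathfinish_def)
    moreover have "path (\<gamma>1 +++ \<gamma>)" "path_image (\<gamma>1 +++ \<gamma>) \<subseteq> Y" "pathstart (\<gamma>1 +++ \<gamma>) = y0"
      "pathfinish (\<gamma>1 +++ \<gamma>) = y'"
      using 1(1-4) \<gamma> V(1) by (auto simp: path_image_join)
    ultimately show ?thesis unfolding lift_rel_def path_def[of "c +++ c'"] by blast
  qed
  have ex: "\<exists>a. lift_rel Y f y0 a0 y a" if "y \<in> Y" for y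
  proof -
    obtain \<gamma> where \<gamma>: "path \<gamma>" "path_image \<gamma> \<subseteq> Y" "pathstart \<gamma> = y0" "pathfinish \<gamma> = y"
      using simply_connected_imp_path_connected_gen[OF Y(1), unfolded path_connected_def, rule_format, OF Y(3) \<open>y \<in> Y\<close>]
      by blast
    have im: "\<gamma> s \<in> Y" if "s \<in> {0..1}" for s using \<gamma>(2) that by (auto simp: path_image_def)
    have "continuous_on {0..1} (\<lambda>s. f (\<gamma> s))"
      by (rule continuous_on_compose2[OF f(1)]) (use \<gamma> im in \<open>auto simp: path_def\<close>)
    moreover have "(\<lambda>s. f (\<gamma> s)) \<in> {0..1} \<rightarrow> carrier B" using im f(2) by auto
    moreover have "p a0 = f (\<gamma> 0)" using a0 \<gamma>(3) by (simp add: pathstart_def)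
    ultimately obtain c where c: "continuous_on {0..1} c" "c \<in> {0..1} \<rightarrow> carrier A"
      "\<And>s. s \<in> {0..1} \<Longrightarrow> p (c s) = f (\<gamma> s)" "c 0 = a0"
      using lift_path[of "\<lambda>s. f (\<gamma> s)" a0] a0(1) by metis
    then show ?thesis unfolding lift_rel_def using \<gamma> c by (intro exI[of _ "c 1"] exI[of _ \<gamma>] exI[of _ c]) auto
  qed
  define F where "F = (\<lambda>y. SOME a. lift_rel Y f y0 a0 y a)"
  have F: "lift_rel Y f y0 a0 y (F y)" if "y \<in> Y" for y
    unfolding F_def using ex[OF that] by (rule someI_ex)
  show thesis
  proof (rule that[of F])
    show "continuous_on Y F"
    proof (rule continuous_on_openin_local)
      fix y assume y: "y \<in> Y"
      have fy: "f y \<in> carrier B" using f y by auto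
      have cont: "continuous_on Y (\<lambda>z. inv\<^bsub>B\<^esub> (f y) \<otimes>\<^bsub>B\<^esub> f z)"
        using f fy by (intro continuous_on_group_mult[OF B] f) auto
      define V where "V = Y \<inter> (\<lambda>z. inv\<^bsub>B\<^esub> (f y) \<otimes>\<^bsub>B\<^esub> f z) -` T"
      have "openin (top_of_set Y) V"
        unfolding V_def using f fy by (intro continuous_openin_preimage[OF cont _ T_open]) auto
      moreover have "y \<in> V" using y one_T fy by (simp add: V_def)
      ultimately obtain u v where uv: "openin (top_of_set Y) u" "path_connected v" "y \<in> u" "u \<subseteq> v" "v \<subseteq> V"
        using Y(2)[unfolded locally_def, rule_format, of V y] by blast
      have Feq: "F z = F y \<otimes>\<^bsub>A\<^esub> \<kappa> (inv\<^bsub>B\<^esub> (f y) \<otimes>\<^bsub>B\<^esub> f z)" if "z \<in> u" for z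
      proof -
        have "y \<in> v" "z \<in> v" using uv \<open>z \<in> u\<close> by auto
        from uv(2)[unfolded path_connected_def, rule_format, OF this]
        obtain \<gamma> where \<gamma>: "path \<gamma>" "path_image \<gamma> \<subseteq> v" "pathstart \<gamma> = y" "pathfinish \<gamma> = z"
          by blast
        have "lift_rel Y f y0 a0 z (F y \<otimes>\<^bsub>A\<^esub> \<kappa> (inv\<^bsub>B\<^esub> (f y) \<otimes>\<^bsub>B\<^esub> f z))"
          by (rule ext[OF F[OF y] \<gamma>]) (use uv in \<open>auto simp: V_def\<close>)
        moreover have "z \<in> Y" using that uv by (auto simp: V_def)
        ultimately show ?thesis using unique[OF F[of z]] by metis
      qed
      have "continuous_on u (\<lambda>z. \<kappa> (inv\<^bsub>B\<^esub> (f y) \<otimes>\<^bsub>B\<^esub> f z))"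
        by (rule continuous_on_compose2[OF \<kappa>_cont continuous_on_subset[OF cont]]) (use uv in \<open>auto simp: V_def\<close>)
      then have "continuous_on u (\<lambda>z. F y \<otimes>\<^bsub>A\<^esub> \<kappa> (inv\<^bsub>B\<^esub> (f y) \<otimes>\<^bsub>B\<^esub> f z))"
        using RA[OF F[OF y]] uv \<kappa>_im by (intro continuous_on_group_mult[OF A]) (auto simp: V_def)
      then have "continuous_on u F" by (rule continuous_on_eq) (simp add: Feq)
      then show "\<exists>U. openin (top_of_set Y) U \<and> y \<in> U \<and> continuous_on U F" using uv by blast
    qed
    have "lift_rel Y f y0 a0 y0 a0"
      unfolding lift_rel_def
      by (intro exI[of _ "\<lambda>_. y0"] exI[of _ "\<lambda>_. a0"])
        (use Y a0 in \<open>auto simp: path_def path_image_def pathstart_def pathfinish_def\<close>)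
    then show "F y0 = a0" using unique[OF F[OF Y(3)]] by metis
  qed (use RA F in auto)
qed

end

subsection \<open>Covers of the circle and universal covering groups\<close>

text \<open>A sheet through the identity supplies everything: the inverse of \<open>p\<close> on it
  is the section, and injectivity of \<open>p\<close> on it isolates the identity in the
  kernel.\<close>

lemma covering_hom_local_section:
  fixes G :: "('a::topological_space, 'c) monoid_scheme" and H :: "('b::metric_space, 'd) monoid_scheme"
  assumes G: "topological_group_on G" and H: "topological_group_on H"
    and cov: "covering_space (carrier G) p (carrier H)" and hom: "p \<in> hom G H"
  obtains T \<kappa> U where "local_section_hom G H p T \<kappa> U"
proof -
  interpret G: group G using G by (rule topological_group_onD)
  interpret H: group H using H by (rule topological_group_onD)
  have p1: "p \<one>\<^bsub>G\<^esub> = \<one>\<^bsub>H\<^esub>" using hom by (intro hom_one) auto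
  obtain U T \<kappa> where U: "\<one>\<^bsub>G\<^esub> \<in> U" "openin (top_of_set (carrier G)) U" "p \<one>\<^bsub>G\<^esub> \<in> T"
    "openin (top_of_set (carrier H)) T" and hm: "homeomorphism U T p \<kappa>"
    using covering_space_local_homeomorphism[OF cov G.one_closed] by metis
  have UG: "U \<subseteq> carrier G" using U(2) by (rule openin_imp_subset)
  have "local_section_hom G H p T \<kappa> U"
  proof (unfold_locales)
    show "continuous_on (carrier G) p" using cov by (rule covering_space_imp_continuous)
    show "\<kappa> \<in> T \<rightarrow> carrier G" using hm UG by (auto simp: homeomorphism_def)
    show "x = \<one>\<^bsub>G\<^esub>" if "x \<in> U" "p x = \<one>\<^bsub>H\<^esub>" for x
      using hm U(1) that p1 by (metis homeomorphism_apply1)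
  qed (use hm U p1 G H hom in \<open>auto simp: homeomorphism_def\<close>)
  then show thesis by (rule that)
qed

text \<open>Local path connectedness is pulled back through the local homeomorphisms of the
  cover.\<close>

lemma covering_space_locally_path_connected_gen:
  assumes cov: "covering_space C p S" and S: "locally path_connected S"
  shows "locally path_connected C"
  unfolding locally_def
proof (intro allI impI, elim conjE)
  fix w x assume w: "openin (top_of_set C) w" "x \<in> w"
  then have x: "x \<in> C" using openin_imp_subset by blast
  obtain u T q where u: "x \<in> u" "openin (top_of_set C) u" "p x \<in> T" "openin (top_of_set S) T"
    and hm: "homeomorphism u T p q"
    using covering_space_local_homeomorphism[OF cov x] by metis
  have "openin (top_of_set u) (u \<inter> w)"
    using w u by (auto simp: openin_open)
  then have "openin (top_of_set T) (p ` (u \<inter> w))"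
    using hm by (rule homeomorphism_imp_open_map[rotated])
  then have "openin (top_of_set S) (p ` (u \<inter> w))" using u(4) by (rule openin_trans)
  moreover have "p x \<in> p ` (u \<inter> w)" using u w by auto
  ultimately obtain u2 v2 where v: "openin (top_of_set S) u2" "path_connected v2" "p x \<in> u2" "u2 \<subseteq> v2"
    "v2 \<subseteq> p ` (u \<inter> w)"
    using S[unfolded locally_def, rule_format, of "p ` (u \<inter> w)" "p x"] by blast
  have im: "p ` (u \<inter> w) \<subseteq> T" using hm by (auto simp: homeomorphism_def)
  then have v2T: "v2 \<subseteq> T" using v by blast
  have "openin (top_of_set T) u2"
    by (rule openin_subset_trans[OF v(1)]) (use v v2T openin_imp_subset[OF u(4)] in auto)
  then have "openin (top_of_set u) (q ` u2)"
    using homeomorphism_imp_open_map[OF homeomorphism_symD[OF hm]] by blast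
  then have "openin (top_of_set C) (q ` u2)" using u(2) by (rule openin_trans)
  moreover have "path_connected (q ` v2)"
    using v(2) hm v2T by (intro path_connected_continuous_image) (auto simp: homeomorphism_def intro: continuous_on_subset)
  moreover have "x \<in> q ` u2" using v(3) hm u(1) by (metis homeomorphism_apply1 image_eqI)
  moreover have "q ` v2 \<subseteq> w" using v(5) hm by (auto simp: homeomorphism_def)
  ultimately show "\<exists>U V. openin (top_of_set C) U \<and> path_connected V \<and> x \<in> U \<and> U \<subseteq> V \<and> V \<subseteq> w"
    using v(4) by blast
qed

section \<open>The real line as a covering group of the circle\<close>

definition additive_real :: "real monoid" where
  "additive_real = \<lparr>carrier = UNIV, mult = (+), one = 0\<rparr>"

definition circle :: "complex monoid" where
  "circle = \<lparr>carrier = sphere 0 1, mult = (*), one = 1\<rparr>"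

lemma group_additive_real: "group additive_real" and group_circle: "group circle"
proof -
  show "group additive_real"
    by (rule groupI) (auto simp: additive_real_def intro: exI[of _ "- _"])
  show "group circle"
    by (rule groupI)
      (auto simp: circle_def norm_mult complex_norm_square[symmetric] mult.commute intro!: bexI[of _ "cnj _"])
qed

text \<open>On the right half of the circle \<open>Arg\<close> is a continuous inverse of
  \<open>cis\<close> with value 0 at 1, and 0 is the only point of (-pi, pi) that \<open>cis\<close>
  sends to 1.\<close>

lemma cis_local_section:
  "local_section_hom additive_real circle cis {z \<in> sphere 0 1. Re z > 0} Arg {-pi<..<pi}"
proof (unfold_locales)
  show "topological_group_on additive_real"
    unfolding topological_group_on_def
  proof (intro conjI group_additive_real)
    have "inv\<^bsub>additive_real\<^esub> x = - x" for x
      by (rule group.inv_equality[OF group_additive_real]) (auto simp: additive_real_def)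
    then show "continuous_on (carrier additive_real) (\<lambda>x. inv\<^bsub>additive_real\<^esub> x)"
      by (simp add: continuous_intros)
  qed (auto simp: additive_real_def split_def intro!: continuous_intros)
  show "topological_group_on circle"
    unfolding topological_group_on_def
  proof (intro conjI group_circle)
    have "inv\<^bsub>circle\<^esub> x = cnj x" if "x \<in> carrier circle" for x
      by (rule group.inv_equality[OF group_circle])
        (use that in \<open>auto simp: circle_def mult.commute complex_norm_square[symmetric]\<close>)
    then show "continuous_on (carrier circle) (\<lambda>x. inv\<^bsub>circle\<^esub> x)"
      by (subst continuous_on_cong[OF refl]) (auto intro!: continuous_intros)
  qed (auto simp: circle_def split_def intro!: continuous_intros)
  show "cis \<in> hom additive_real circle"
    by (auto simp: hom_def additive_real_def circle_def cis_mult)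
  show "continuous_on {z \<in> sphere 0 1. 0 < Re z} Arg"
    by (intro continuous_at_imp_continuous_on ballI continuous_at_Arg) (auto simp: complex_nonpos_Reals_iff)
  show "cis (Arg x) = x" if "x \<in> {z \<in> sphere 0 1. 0 < Re z}" for x
    using that by (subst cis_Arg) (auto simp: sgn_eq)
  show "x = \<one>\<^bsub>additive_real\<^esub>" if "x \<in> {-pi<..<pi}" "cis x = \<one>\<^bsub>circle\<^esub>" for x
  proof -
    have "cos x = 1" using that by (simp add: circle_def complex_eq_iff)
    then have "x = 0" using that by (metis cos_one_2pi_int cos_zero_iff_int2 sin_zero_pi_iff sin_zero_iff abs_less_iff cos_one_sin_zero greaterThanLessThan_iff minus_less_iff)
    then show ?thesis by (simp add: additive_real_def)
  qed
qed (auto simp: additive_real_def circle_def openin_open intro!: exI[of _ "{z. Re z > 0}"] open_halfspace_Re_gt continuous_intros)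

lemma lift_to_circle_cover:
  fixes f :: "'y::topological_space \<Rightarrow> complex"
  assumes Y: "simply_connected Y" "locally path_connected Y" "y0 \<in> Y"
    and f: "continuous_on Y f" "\<And>y. y \<in> Y \<Longrightarrow> norm (f y) = 1" and t0: "cis t0 = f y0"
  obtains F where "continuous_on Y F" "\<And>y. y \<in> Y \<Longrightarrow> cis (F y) = f y" "F y0 = t0"
proof -
  interpret local_section_hom additive_real circle cis "{z \<in> sphere 0 1. Re z > 0}" Arg "{-pi<..<pi}"
    by (rule cis_local_section)
  show thesis
    by (rule lift_simply_connected[OF Y f(1), of t0])
      (use f t0 that in \<open>auto simp: additive_real_def circle_def\<close>)
qed

lemma cis_lift_unique:
  fixes f g :: "'y::topological_space \<Rightarrow> real"
  assumes "connected Y" "y0 \<in> Y" "y \<in> Y" "continuous_on Y f" "continuous_on Y g"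
    and "\<And>y. y \<in> Y \<Longrightarrow> cis (f y) = cis (g y)" "f y0 = g y0"
  shows "f y = g y"
proof -
  interpret local_section_hom additive_real circle cis "{z \<in> sphere 0 1. Re z > 0}" Arg "{-pi<..<pi}"
    by (rule cis_local_section)
  show ?thesis
    by (rule lift_unique[of Y y0 y f g]) (use assms in \<open>auto simp: additive_real_def\<close>)
qed

text \<open>\<open>\<theta>\<close> lifts \<open>f \<circ> p\<close> through \<^const>\<open>cis\<close> and \<open>\<psi>\<close> lifts \<^const>\<open>fst\<close> through \<open>p\<close>; that they are mutually
  inverse is uniqueness of lifts.\<close>

lemma universal_cover_model:
  fixes G :: "('a::topological_space, 'c) monoid_scheme" and H :: "('b::metric_space, 'd) monoid_scheme"
  assumes ucg: "universal_covering_group G p H" and H: "topological_group_on H"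
    and lpc: "locally path_connected (carrier H)"
    and f: "continuous_on (carrier H) f" "\<And>h. h \<in> carrier H \<Longrightarrow> norm (f h) = 1" "f \<one>\<^bsub>H\<^esub> = (1::complex)"
  defines "E \<equiv> {(h, t). h \<in> carrier H \<and> cis t = f h}"
  assumes E: "simply_connected E" "locally path_connected E"
  obtains \<theta> \<psi> where "homeomorphism (carrier G) E (\<lambda>g. (p g, \<theta> g)) \<psi>" "\<theta> \<one>\<^bsub>G\<^esub> = 0"
proof -
  have G: "topological_group_on G" and scG: "simply_connected (carrier G)"
    and cov: "covering_space (carrier G) p (carrier H)" and hom: "p \<in> hom G H"
    using ucg by (auto simp: universal_covering_group_def)
  interpret G: group G using G by (rule topological_group_onD)
  interpret H: group H using H by (rule topological_group_onD)
  have p1: "p \<one>\<^bsub>G\<^esub> = \<one>\<^bsub>H\<^esub>" using hom by (intro hom_one) auto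
  have pH: "p g \<in> carrier H" if "g \<in> carrier G" for g
    using hom that by (auto simp: hom_def)
  have pc: "continuous_on (carrier G) p" using cov by (rule covering_space_imp_continuous)
  have lpG: "locally path_connected (carrier G)"
    using covering_space_locally_path_connected_gen[OF cov lpc] .
  have fpc: "continuous_on (carrier G) (\<lambda>g. f (p g))"
    by (rule continuous_on_compose2[OF f(1) pc]) (use pH in auto)
  obtain \<theta> where \<theta>: "continuous_on (carrier G) \<theta>" "\<And>g. g \<in> carrier G \<Longrightarrow> cis (\<theta> g) = f (p g)" "\<theta> \<one>\<^bsub>G\<^esub> = 0"
    by (rule lift_to_circle_cover[OF scG lpG G.one_closed fpc, of 0]) (use f p1 pH in auto)
  obtain T \<kappa> U where "local_section_hom G H p T \<kappa> U"
    using covering_hom_local_section[OF G H cov hom] .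
  then interpret local_section_hom G H p T \<kappa> U .
  have E1: "(\<one>\<^bsub>H\<^esub>, 0) \<in> E" using f by (simp add: E_def)
  obtain \<psi> where \<psi>: "continuous_on E \<psi>" "\<psi> \<in> E \<rightarrow> carrier G" "\<And>y. y \<in> E \<Longrightarrow> p (\<psi> y) = fst y"
    "\<psi> (\<one>\<^bsub>H\<^esub>, 0) = \<one>\<^bsub>G\<^esub>"
    by (rule lift_simply_connected[OF E E1, of fst "\<one>\<^bsub>G\<^esub>"])
      (use p1 in \<open>auto simp: E_def intro!: continuous_intros\<close>)
  have conG: "connected (carrier G)"
    using simply_connected_imp_path_connected_gen[OF scG] by (rule path_connected_imp_connected)
  have conE: "connected E"
    using simply_connected_imp_path_connected_gen[OF E(1)] by (rule path_connected_imp_connected)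
  have qE: "(p g, \<theta> g) \<in> E" if "g \<in> carrier G" for g using \<theta> pH that by (simp add: E_def)
  have qc: "continuous_on (carrier G) (\<lambda>g. (p g, \<theta> g))" by (intro continuous_on_Pair pc \<theta>)
  have inv1: "\<psi> (p g, \<theta> g) = g" if "g \<in> carrier G" for g
  proof (rule lift_unique[of "carrier G" "\<one>\<^bsub>G\<^esub>" g "\<lambda>g. \<psi> (p g, \<theta> g)" "\<lambda>g. g"])
    show "continuous_on (carrier G) (\<lambda>g. \<psi> (p g, \<theta> g))"
      by (rule continuous_on_compose2[OF \<psi>(1) qc]) (use qE in auto)
    show "(\<lambda>g. \<psi> (p g, \<theta> g)) \<in> carrier G \<rightarrow> carrier G" using \<psi>(2) qE by (auto simp: Pi_iff)
  qed (use \<psi> \<theta> qE p1 conG that in \<open>auto intro: continuous_on_id\<close>)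
  \<comment> \<open>Both sides lift \<open>f\<close> of the first component through
    \<open>cis\<close> and vanish at the identity.\<close>
  have inv2: "\<theta> (\<psi> y) = snd y" if "y \<in> E" for y
  proof (rule cis_lift_unique[of E "(\<one>\<^bsub>H\<^esub>, 0)" y])
    show "continuous_on E (\<lambda>y. \<theta> (\<psi> y))"
      by (rule continuous_on_compose2[OF \<theta>(1) \<psi>(1)]) (use \<psi> in auto)
    show "cis (\<theta> (\<psi> y)) = cis (snd y)" if "y \<in> E" for y
    proof -
      have "cis (\<theta> (\<psi> y)) = f (fst y)" using \<psi> \<theta> that by (auto simp: Pi_iff)
      then show ?thesis using that by (auto simp: E_def)
    qed
  qed (use conE E1 \<psi> \<theta> that in \<open>auto intro!: continuous_intros\<close>)
  have "homeomorphism (carrier G) E (\<lambda>g. (p g, \<theta> g)) \<psi>"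
    by (rule homeomorphismI) (use qc \<psi> qE inv1 inv2 in auto)
  then show thesis using \<theta>(3) that by blast
qed

subsection \<open>Homogeneous spaces\<close>

lemma homeomorphism_imp_homeomorphic_map:
  assumes "homeomorphism S T f g"
  shows "homeomorphic_map (top_of_set S) (top_of_set T) f"
  unfolding homeomorphic_map_maps
  by (rule exI[of _ g])
    (use assms in \<open>auto simp: homeomorphic_maps_def homeomorphism_def continuous_map_in_subtopology\<close>)

lemma topspace_coset_topology:
  assumes "group G" "H \<subseteq> carrier G"
  shows "topspace (coset_topology G H) = lcosets\<^bsub>G\<^esub> H"
proof -
  have "openin (coset_topology G H) (lcosets\<^bsub>G\<^esub> H)"
  proof -
    have "{g \<in> carrier G. g <#\<^bsub>G\<^esub> H \<in> lcosets\<^bsub>G\<^esub> H} = carrier G"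
      by (auto simp: LCOSETS_def)
    then show ?thesis by (simp add: openin_coset_topology)
  qed
  moreover have "topspace (coset_topology G H) \<subseteq> lcosets\<^bsub>G\<^esub> H"
    using openin_topspace[of "coset_topology G H"] unfolding openin_coset_topology by blast
  ultimately show ?thesis using openin_subset by blast
qed

text \<open>Travel from \<open>x\<close> to \<open>y\<close> through \<open>x0\<close>, backwards
  along the section and then forwards.\<close>

lemma (in group_action) transitive_of_section:
  assumes "\<And>y. y \<in> E \<Longrightarrow> \<sigma> y \<in> carrier G" "\<And>y. y \<in> E \<Longrightarrow> \<phi> (\<sigma> y) x0 = y" and x0: "x0 \<in> E"
  shows "transitive_action G E \<phi>"
proof (unfold_locales)
  interpret group G using group_hom group_hom.axioms(1) by auto
  fix x y assume xy: "x \<in> E" "y \<in> E"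
  have "\<phi> (inv (\<sigma> x)) x = x0"
    using assms xy by (intro orbit_sym_aux) auto
  then have "\<phi> (\<sigma> y \<otimes> inv (\<sigma> x)) x = y"
    using assms xy by (subst composition_rule) auto
  then show "\<exists>g\<in>carrier G. \<phi> g x = y" using assms xy by blast
qed

text \<open>The map induced by the orbit map is continuous by the quotient topology; its inverse
  sends \<open>y\<close> to the coset of \<open>\<sigma> y\<close>, a composition of continuous
  maps.\<close>

lemma equivariantly_identified_of_section:
  fixes G :: "('a::topological_space, 'c) monoid_scheme"
  assumes G: "topological_group_on G" and act: "group_action G X \<phi>" and x: "x \<in> X"
    and orbit: "continuous_on (carrier G) (\<lambda>g. \<phi> g x)"
    and \<sigma>: "continuous_on X \<sigma>" "\<sigma> \<in> X \<rightarrow> carrier G" "\<And>y. y \<in> X \<Longrightarrow> \<phi> (\<sigma> y) x = y"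
  shows "equivariantly_identified G X \<phi> x"
proof -
  interpret group_action G X \<phi> by (rule act)
  interpret group G using G by (rule topological_group_onD)
  define K where "K = stabilizer G \<phi> x"
  have K: "K \<subseteq> carrier G" "\<one>\<^bsub>G\<^esub> \<in> K" "\<And>k. k \<in> K \<Longrightarrow> \<phi> k x = x"
    using x id_eq_one by (auto simp: K_def stabilizer_def) (metis restrict_apply')
  \<comment> \<open>Cosets of the stabilizer are the fibres of the orbit map, so the representative
    chosen in \<open>f\<close> below does not matter.\<close>
  have coset_eq: "g <#\<^bsub>G\<^esub> K = {h \<in> carrier G. \<phi> h x = \<phi> g x}" if g: "g \<in> carrier G" for g
  proof (intro equalityI subsetI)
    fix h assume "h \<in> g <#\<^bsub>G\<^esub> K"
    then obtain k where k: "k \<in> K" "h = g \<otimes>\<^bsub>G\<^esub> k" by (auto simp: l_coset_def)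
    then show "h \<in> {h \<in> carrier G. \<phi> h x = \<phi> g x}"
      using K g x by (auto simp: subset_iff composition_rule)
  next
    fix h assume "h \<in> {h \<in> carrier G. \<phi> h x = \<phi> g x}"
    then have h: "h \<in> carrier G" "\<phi> h x = \<phi> g x" by auto
    have "\<phi> (inv\<^bsub>G\<^esub> g \<otimes>\<^bsub>G\<^esub> h) x = \<phi> (inv\<^bsub>G\<^esub> g) (\<phi> g x)"
      using h g x by (simp add: composition_rule)
    also have "\<dots> = x" using g x by (intro orbit_sym_aux) auto
    finally have "inv\<^bsub>G\<^esub> g \<otimes>\<^bsub>G\<^esub> h \<in> K" using g h by (simp add: K_def stabilizer_def)
    moreover have "h = g \<otimes>\<^bsub>G\<^esub> (inv\<^bsub>G\<^esub> g \<otimes>\<^bsub>G\<^esub> h)" using g h by (simp add: m_assoc[symmetric])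
    ultimately show "h \<in> g <#\<^bsub>G\<^esub> K" by (auto simp: l_coset_def)
  qed
  define f where "f = (\<lambda>C. \<phi> (SOME g. g \<in> C) x)"
  have f: "f (g <#\<^bsub>G\<^esub> K) = \<phi> g x" if g: "g \<in> carrier G" for g
  proof -
    have "(SOME h. h \<in> g <#\<^bsub>G\<^esub> K) \<in> g <#\<^bsub>G\<^esub> K"
      by (rule someI[of _ g]) (use g in \<open>simp add: coset_eq\<close>)
    then show ?thesis using g by (simp add: f_def coset_eq)
  qed
  have lc: "C \<in> lcosets\<^bsub>G\<^esub> K \<longleftrightarrow> (\<exists>g\<in>carrier G. C = g <#\<^bsub>G\<^esub> K)" for C
    by (auto simp: LCOSETS_def)
  have \<phi>X: "\<phi> g x \<in> X" if "g \<in> carrier G" for g using element_image that x by blast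
  have \<sigma>G: "\<sigma> y \<in> carrier G" if "y \<in> X" for y using \<sigma> that by auto
  note ts = topspace_coset_topology[OF is_group K(1)]
  have "homeomorphic_maps (coset_topology G K) (top_of_set X) f (\<lambda>y. \<sigma> y <#\<^bsub>G\<^esub> K)"
    unfolding homeomorphic_maps_def
  proof (intro conjI ballI)
    show "continuous_map (coset_topology G K) (top_of_set X) f"
      unfolding continuous_map_def
    proof (intro conjI allI impI)
      show "f \<in> topspace (coset_topology G K) \<rightarrow> topspace (top_of_set X)"
        using f \<phi>X by (auto simp: ts lc)
      fix V assume V: "openin (top_of_set X) V"
      have "{g \<in> carrier G. g <#\<^bsub>G\<^esub> K \<in> {C \<in> topspace (coset_topology G K). f C \<in> V}} =
         carrier G \<inter> (\<lambda>g. \<phi> g x) -` V"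
        using f by (auto simp: ts lc)
      moreover have "openin (top_of_set (carrier G)) (carrier G \<inter> (\<lambda>g. \<phi> g x) -` V)"
        using \<phi>X by (intro continuous_openin_preimage[OF orbit _ V]) auto
      ultimately show "openin (coset_topology G K) {C \<in> topspace (coset_topology G K). f C \<in> V}"
        by (auto simp: openin_coset_topology ts)
    qed
    show "continuous_map (top_of_set X) (coset_topology G K) (\<lambda>y. \<sigma> y <#\<^bsub>G\<^esub> K)"
      unfolding continuous_map_def
    proof (intro conjI allI impI)
      show "(\<lambda>y. \<sigma> y <#\<^bsub>G\<^esub> K) \<in> topspace (top_of_set X) \<rightarrow> topspace (coset_topology G K)"
        using \<sigma>G lc by (force simp: ts)
      fix V assume "openin (coset_topology G K) V"
      then have "openin (top_of_set (carrier G)) {g \<in> carrier G. g <#\<^bsub>G\<^esub> K \<in> V}"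
        by (simp add: openin_coset_topology)
      then have "openin (top_of_set X) (X \<inter> \<sigma> -` {g \<in> carrier G. g <#\<^bsub>G\<^esub> K \<in> V})"
        by (rule continuous_openin_preimage[OF \<sigma>(1,2)])
      also have "X \<inter> \<sigma> -` {g \<in> carrier G. g <#\<^bsub>G\<^esub> K \<in> V} = {y \<in> topspace (top_of_set X). \<sigma> y <#\<^bsub>G\<^esub> K \<in> V}"
        using \<sigma>G by auto
      finally show "openin (top_of_set X) {y \<in> topspace (top_of_set X). \<sigma> y <#\<^bsub>G\<^esub> K \<in> V}" .
    qed
    show "\<sigma> (f C) <#\<^bsub>G\<^esub> K = C" if "C \<in> topspace (coset_topology G K)" for C
    proof -
      from that[unfolded ts lc] obtain g where g: "g \<in> carrier G" "C = g <#\<^bsub>G\<^esub> K" by (rule bexE)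
      have "f C = \<phi> g x" using g by (simp add: f)
      then show ?thesis using \<phi>X[OF g(1)] \<sigma>G \<sigma>(3) g by (simp add: coset_eq)
    qed
    show "f (\<sigma> y <#\<^bsub>G\<^esub> K) = y" if "y \<in> topspace (top_of_set X)" for y
      using that \<sigma>G \<sigma>(3) by (simp add: f)
  qed
  then have "homeomorphic_map (coset_topology G K) (top_of_set X) f"
    using homeomorphic_map_maps by blast
  moreover have "f K = x"
  proof -
    have one: "\<phi> \<one>\<^bsub>G\<^esub> x = x" using K by blast
    have "\<one>\<^bsub>G\<^esub> <#\<^bsub>G\<^esub> K = K" by (simp add: coset_eq one) (simp add: K_def stabilizer_def)
    then show ?thesis using f[of "\<one>\<^bsub>G\<^esub>"] one by simp
  qed
  moreover have "f (g <#\<^bsub>G\<^esub> C) = \<phi> g (f C)" if g: "g \<in> carrier G" and C: "C \<in> lcosets\<^bsub>G\<^esub> K" for g C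
  proof -
    from C[unfolded lc] obtain h where h: "h \<in> carrier G" "C = h <#\<^bsub>G\<^esub> K" by (rule bexE)
    then have "g <#\<^bsub>G\<^esub> C = (g \<otimes>\<^bsub>G\<^esub> h) <#\<^bsub>G\<^esub> K" using g K by (simp add: lcos_m_assoc)
    moreover have "f C = \<phi> h x" "f ((g \<otimes>\<^bsub>G\<^esub> h) <#\<^bsub>G\<^esub> K) = \<phi> (g \<otimes>\<^bsub>G\<^esub> h) x" using g h by (simp_all add: f)
    ultimately show ?thesis using g h x by (simp add: composition_rule)
  qed
  ultimately show ?thesis unfolding equivariantly_identified_def Let_def K_def[symmetric] by blast
qed

text \<open>Conjugation by \<open>g\<close> is a homeomorphic isomorphism between the stabilizers of
  \<open>x0\<close> and of its translate, so compactness and the isomorphism type need to be checked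
  at one point only.\<close>

lemma stabilizer_translate:
  fixes G :: "('a::topological_space, 'c) monoid_scheme" and S :: "('s::topological_space, 'd) monoid_scheme"
  assumes G: "topological_group_on G" and act: "group_action G X \<phi>" and x: "x0 \<in> X"
    and g: "g \<in> carrier G"
    and iso: "topological_group_isomorphic (G\<lparr>carrier := stabilizer G \<phi> x0\<rparr>) S"
    and cpt: "compact (stabilizer G \<phi> x0)"
  shows "topological_group_isomorphic (G\<lparr>carrier := stabilizer G \<phi> (\<phi> g x0)\<rparr>) S"
    and "compact (stabilizer G \<phi> (\<phi> g x0))"
proof -
  interpret group_action G X \<phi> by (rule act)
  interpret group G using G by (rule topological_group_onD)
  define c where "c = (\<lambda>g h. g \<otimes>\<^bsub>G\<^esub> h \<otimes>\<^bsub>G\<^esub> inv\<^bsub>G\<^esub> g)"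
  have c_cont: "continuous_on Y (c a)" if "a \<in> carrier G" "Y \<subseteq> carrier G" for a Y
    unfolding c_def using that by (intro continuous_on_group_mult[OF G]) (auto intro: continuous_on_id)
  have stab: "c a h \<in> stabilizer G \<phi> (\<phi> a y)" if "a \<in> carrier G" "h \<in> stabilizer G \<phi> y" "y \<in> X" for a h y
  proof -
    have h: "h \<in> carrier G" "\<phi> h y = y" using that by (auto simp: stabilizer_def)
    have ay: "\<phi> a y \<in> X" using element_image that by blast
    have "\<phi> (inv\<^bsub>G\<^esub> a) (\<phi> a y) = y" using that by (intro orbit_sym_aux) auto
    then have "\<phi> (c a h) (\<phi> a y) = \<phi> a y"
      using that h ay by (simp add: c_def composition_rule)
    then show ?thesis using that h by (simp add: stabilizer_def c_def)
  qed
  define y where "y = \<phi> g x0"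
  have yX: "y \<in> X" using element_image g x y_def by blast
  have orig: "\<phi> (inv\<^bsub>G\<^esub> g) y = x0" using g x y_def by (intro orbit_sym_aux) auto
  have sub: "stabilizer G \<phi> z \<subseteq> carrier G" for z by (auto simp: stabilizer_def)
  have cc: "c (inv\<^bsub>G\<^esub> g) (c g h) = h" "c g (c (inv\<^bsub>G\<^esub> g) h) = h" if "h \<in> carrier G" for h
    using g that by (simp_all add: c_def m_assoc) (simp_all add: m_assoc[symmetric])
  have im: "c g h \<in> stabilizer G \<phi> y" if "h \<in> stabilizer G \<phi> x0" for h
    using stab[OF g that x] by (simp add: y_def)
  have im': "c (inv\<^bsub>G\<^esub> g) h \<in> stabilizer G \<phi> x0" if "h \<in> stabilizer G \<phi> y" for h
    using stab[of "inv\<^bsub>G\<^esub> g" h y] g that yX by (simp add: orig)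
  have hm: "homeomorphism (stabilizer G \<phi> y) (stabilizer G \<phi> x0) (c (inv\<^bsub>G\<^esub> g)) (c g)"
    by (rule homeomorphismI) (use c_cont g sub im im' cc subsetD[OF sub] in auto)
  have "compact (c g ` stabilizer G \<phi> x0)"
    using cpt c_cont[OF g sub] by (intro compact_continuous_image)
  moreover have "c g ` stabilizer G \<phi> x0 = stabilizer G \<phi> y" using hm by (simp add: homeomorphism_def)
  ultimately show "compact (stabilizer G \<phi> (\<phi> g x0))" by (simp add: y_def)
  obtain f where f: "f \<in> iso (G\<lparr>carrier := stabilizer G \<phi> x0\<rparr>) S"
    "homeomorphic_map (top_of_set (stabilizer G \<phi> x0)) (top_of_set (carrier S)) f"
    using iso by (auto simp: topological_group_isomorphic_def)
  have hmult: "c (inv\<^bsub>G\<^esub> g) (a \<otimes>\<^bsub>G\<^esub> b) = c (inv\<^bsub>G\<^esub> g) a \<otimes>\<^bsub>G\<^esub> c (inv\<^bsub>G\<^esub> g) b"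
    if "a \<in> carrier G" "b \<in> carrier G" for a b
    using g that by (simp add: c_def m_assoc) (simp add: m_assoc[symmetric])
  have "c (inv\<^bsub>G\<^esub> g) \<in> iso (G\<lparr>carrier := stabilizer G \<phi> y\<rparr>) (G\<lparr>carrier := stabilizer G \<phi> x0\<rparr>)"
    unfolding iso_def hom_def bij_betw_def
  proof (safe; clarsimp?)
    show "inj_on (c (inv\<^bsub>G\<^esub> g)) (stabilizer G \<phi> y)"
      by (rule inj_on_inverseI[where g = "c g"]) (use hm in \<open>simp add: homeomorphism_def\<close>)
  qed (use im' im cc hmult sub hm in \<open>auto simp: subset_iff homeomorphism_def\<close>)
  then have "f \<circ> c (inv\<^bsub>G\<^esub> g) \<in> iso (G\<lparr>carrier := stabilizer G \<phi> y\<rparr>) S"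
    using f(1) by (rule iso_set_trans)
  moreover have "homeomorphic_map (top_of_set (stabilizer G \<phi> y)) (top_of_set (carrier S)) (f \<circ> c (inv\<^bsub>G\<^esub> g))"
    by (rule homeomorphic_map_compose[OF homeomorphism_imp_homeomorphic_map[OF hm] f(2)])
  ultimately show "topological_group_isomorphic (G\<lparr>carrier := stabilizer G \<phi> (\<phi> g x0)\<rparr>) S"
    unfolding topological_group_isomorphic_def y_def by auto
qed

text \<open>One base point suffices. For another point \<open>x\<close> the orbit map is the old one
  after right translation by \<open>\<sigma> x\<close>, and right translation of
  \<open>\<sigma>\<close> by the inverse of \<open>\<sigma> x\<close> is a section for it.\<close>

lemma homogeneous_of_section:
  fixes G :: "('a::topological_space, 'c) monoid_scheme" and S :: "('s::topological_space, 'd) monoid_scheme"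
  assumes G: "topological_group_on G" and act: "group_action G X \<phi>" and x0: "x0 \<in> X"
    and orbit: "continuous_on (carrier G) (\<lambda>g. \<phi> g x0)"
    and \<sigma>: "continuous_on X \<sigma>" "\<And>y. y \<in> X \<Longrightarrow> \<sigma> y \<in> carrier G" "\<And>y. y \<in> X \<Longrightarrow> \<phi> (\<sigma> y) x0 = y"
    and iso: "topological_group_isomorphic (G\<lparr>carrier := stabilizer G \<phi> x0\<rparr>) S"
    and cpt: "compact (stabilizer G \<phi> x0)"
  shows "transitive_action G X \<phi> \<and>
    (\<forall>x\<in>X. compact (stabilizer G \<phi> x) \<and>
      topological_group_isomorphic (G\<lparr>carrier := stabilizer G \<phi> x\<rparr>) S \<and>
      equivariantly_identified G X \<phi> x)"
proof (intro conjI ballI)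
  interpret group_action G X \<phi> by (rule act)
  interpret group G using G by (rule topological_group_onD)
  show "transitive_action G X \<phi>" by (rule transitive_of_section[OF \<sigma>(2,3) x0])
  fix x assume x: "x \<in> X"
  note st = stabilizer_translate[OF G act x0 \<sigma>(2)[OF x] iso cpt, unfolded \<sigma>(3)[OF x]]
  show "compact (stabilizer G \<phi> x)" "topological_group_isomorphic (G\<lparr>carrier := stabilizer G \<phi> x\<rparr>) S"
    by (rule st)+
  show "equivariantly_identified G X \<phi> x"
  proof (rule equivariantly_identified_of_section[OF G act x])
    have "continuous_on (carrier G) (\<lambda>g. \<phi> (g \<otimes>\<^bsub>G\<^esub> \<sigma> x) x0)"
      using \<sigma>(2)[OF x]
      by (intro continuous_on_compose2[OF orbit] continuous_on_group_mult[OF G] continuous_intros) auto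
    then show "continuous_on (carrier G) (\<lambda>g. \<phi> g x)"
      by (rule continuous_on_eq) (simp add: composition_rule[OF x0] \<sigma> x)
    show "continuous_on X (\<lambda>y. \<sigma> y \<otimes>\<^bsub>G\<^esub> inv\<^bsub>G\<^esub> (\<sigma> x))"
      using \<sigma>(2) x by (intro continuous_on_group_mult[OF G] \<sigma>(1) continuous_intros) auto
    show "(\<lambda>y. \<sigma> y \<otimes>\<^bsub>G\<^esub> inv\<^bsub>G\<^esub> (\<sigma> x)) \<in> X \<rightarrow> carrier G" using \<sigma>(2) x by auto
    have "\<phi> (inv\<^bsub>G\<^esub> (\<sigma> x)) x = x0" using \<sigma> x x0 by (intro orbit_sym_aux) auto
    then show "\<phi> (\<sigma> y \<otimes>\<^bsub>G\<^esub> inv\<^bsub>G\<^esub> (\<sigma> x)) x = y" if "y \<in> X" for y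
      using \<sigma> x that by (simp add: composition_rule)
  qed
qed

subsection \<open>Matrices and their blocks\<close>

lemmas mat2_simps = vec_eq_iff forall_2 matrix_matrix_mult_def sum_2 transpose_def mat_def det_2

lemma sum_UNIV_Plus:
  "sum f (UNIV :: ('i::finite + 'j::finite) set) = (\<Sum>i\<in>UNIV. f (Inl i)) + (\<Sum>j\<in>UNIV. f (Inr j))"
  by (subst UNIV_Plus_UNIV[symmetric], subst sum.Plus) auto

lemma matrix_add_rdistrib: "(A + B) ** C = A ** C + B ** (C :: 'a::ring_1^'n^'m)"
  and matrix_diff_ldistrib: "D ** (E - F) = D ** E - D ** (F :: 'a::ring_1^'n^'m)"
  and matrix_diff_rdistrib: "(A - B) ** C = A ** C - B ** (C :: 'a::ring_1^'n^'m)"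
  by (simp_all add: vec_eq_iff matrix_matrix_mult_def algebra_simps sum.distrib sum_subtractf)

lemma matrix_uminus_left: "(- A) ** B = - (A ** (B :: 'a::ring_1^'n^'m))"
  and matrix_uminus_right: "C ** (- B) = - (C ** (B :: 'a::ring_1^'n^'m))"
  by (simp_all add: vec_eq_iff matrix_matrix_mult_def sum_negf)

lemma matrix_scaleR_left: "(r *\<^sub>R A) ** B = r *\<^sub>R (A ** (B :: complex^'n^'m))"
  and matrix_scaleR_right: "C ** (r *\<^sub>R B) = r *\<^sub>R (C ** (B :: complex^'n^'m))"
  by (simp_all add: vec_eq_iff matrix_matrix_mult_def scaleR_sum_right)

lemma map_matrix_mult:
  fixes A :: "'a::semiring_1^'n^'m" and f :: "'a \<Rightarrow> 'b::semiring_1"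
  assumes "f 0 = 0" "\<And>x y. f (x + y) = f x + f y" "\<And>x y. f (x * y) = f x * f y"
  shows "map_matrix f (A ** B) = map_matrix f A ** map_matrix f B"
proof -
  have "f (sum h S) = (\<Sum>i\<in>S. f (h i))" for h and S :: "'n set"
    by (induction S rule: infinite_finite_induct) (auto simp: assms)
  then show ?thesis by (simp add: vec_eq_iff matrix_matrix_mult_def assms)
qed

lemma of_real_mat_mult: "of_real_mat (A ** B) = of_real_mat A ** of_real_mat B"
  by (rule map_matrix_mult) auto

lemma cnj_mat_mult: "map_matrix cnj (A ** B) = map_matrix cnj A ** map_matrix cnj B"
  by (rule map_matrix_mult) auto

lemma continuous_on_matrix_mult:
  fixes f :: "'x::topological_space \<Rightarrow> 'a::real_normed_algebra_1^'n^'m" and g :: "'x \<Rightarrow> 'a^'k^'n"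
  assumes "continuous_on S f" "continuous_on S g"
  shows "continuous_on S (\<lambda>x. f x ** g x)"
  unfolding matrix_matrix_mult_def by (intro continuous_intros assms)

lemma continuous_on_map_matrix:
  fixes f :: "'x::topological_space \<Rightarrow> 'a::topological_space^'n^'m"
  assumes "continuous_on UNIV h" "continuous_on S f"
  shows "continuous_on S (\<lambda>x. map_matrix h (f x))"
  unfolding map_matrix_def
  by (intro continuous_intros continuous_on_compose2[OF assms(1)] assms) auto

lemma matrix_inv_eqI:
  fixes A :: "'a::field^'n^'n"
  assumes "A ** B = mat 1"
  shows "matrix_inv A = B"
proof -
  have BA: "B ** A = mat 1" using assms by (simp add: matrix_left_right_inverse)
  show ?thesis
    unfolding matrix_inv_def
  proof (rule some_equality)
    fix C assume "A ** C = mat 1 \<and> C ** A = mat 1"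
    then have "C = (B ** A) ** C" "B ** (A ** C) = B" by (simp_all add: BA)
    then show "C = B" by (simp add: matrix_mul_assoc)
  qed (use assms BA in auto)
qed

lemma matrix_inv_mult:
  fixes A :: "'a::field^'n^'n"
  assumes "det A \<noteq> 0"
  shows "A ** matrix_inv A = mat 1" "matrix_inv A ** A = mat 1"
proof -
  obtain B where "A ** B = mat 1" "B ** A = mat 1"
    using assms by (auto simp: invertible_det_nz[symmetric] invertible_def)
  then show "A ** matrix_inv A = mat 1" "matrix_inv A ** A = mat 1" using matrix_inv_eqI by metis+
qed

lemma matrix_inv_2:
  fixes A :: "'a::field^2^2"
  assumes "det A \<noteq> 0"
  shows "matrix_inv A = map_matrix (\<lambda>x. x / det A)
    (vector [vector [A $ 2 $ 2, - A $ 1 $ 2], vector [- A $ 2 $ 1, A $ 1 $ 1]])"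
proof (rule matrix_inv_eqI)
  have "A $ 1 $ 1 * A $ 2 $ 2 - A $ 1 $ 2 * A $ 2 $ 1 = det A" by (simp add: det_2)
  then show "A ** map_matrix (\<lambda>x. x / det A)
    (vector [vector [A $ 2 $ 2, - A $ 1 $ 2], vector [- A $ 2 $ 1, A $ 1 $ 1]]) = mat 1"
    using assms
    by (simp add: vec_eq_iff forall_2 matrix_matrix_mult_def sum_2 mat_def diff_divide_distrib[symmetric] mult.commute)
qed

lemma continuous_on_det_2:
  fixes f :: "'x::topological_space \<Rightarrow> complex mat2"
  assumes "continuous_on S f"
  shows "continuous_on S (\<lambda>x. det (f x))"
  unfolding det_2 by (intro continuous_intros assms)

lemma continuous_on_matrix_inv_2:
  fixes f :: "'x::topological_space \<Rightarrow> complex mat2"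
  assumes f: "continuous_on S f" "\<And>x. x \<in> S \<Longrightarrow> det (f x) \<noteq> 0"
  shows "continuous_on S (\<lambda>x. matrix_inv (f x))"
proof -
  \<comment> \<open>The adjugate divided by the determinant, written entrywise: diagonal entries
    swapped, the others negated.\<close>
  have "continuous_on S (\<lambda>x. \<chi> i j. (if i = j then f x $ (if i = 1 then 2 else 1) $ (if i = 1 then 2 else 1)
      else - f x $ i $ j) / det (f x))"
  proof (intro continuous_on_vec_lambda continuous_on_divide continuous_on_det_2 f)
    fix i j :: 2
    show "continuous_on S (\<lambda>x. if i = j then f x $ (if i = 1 then 2 else 1) $ (if i = 1 then 2 else 1)
      else - f x $ i $ j)"
      by (cases "i = j") (auto intro!: continuous_intros f(1))
  qed (use f in auto)
  then show ?thesis
    by (rule continuous_on_eq) (use f in \<open>auto simp: matrix_inv_2 vec_eq_iff forall_2\<close>)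
qed

section \<open>Block calculus for 4 x 4 matrices\<close>

lemma block_mat_simps [simp]:
  "block_A (block_mat A B C D) = A" "block_B (block_mat A B C D) = B"
  "block_C (block_mat A B C D) = C" "block_D (block_mat A B C D) = D"
  by (simp_all add: block_A_def block_B_def block_C_def block_D_def block_mat_def vec_eq_iff)

lemma block_eq_iff:
  "M = N \<longleftrightarrow> block_A M = block_A N \<and> block_B M = block_B N \<and> block_C M = block_C N \<and> block_D M = block_D N"
  by (auto simp: block_A_def block_B_def block_C_def block_D_def vec_eq_iff split_sum_all)

lemma block_mult:
  fixes M N :: "'a::semiring_1 mat4"
  shows "block_A (M ** N) = block_A M ** block_A N + block_B M ** block_C N"
    "block_B (M ** N) = block_A M ** block_B N + block_B M ** block_D N"
    "block_C (M ** N) = block_C M ** block_A N + block_D M ** block_C N"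
    "block_D (M ** N) = block_C M ** block_B N + block_D M ** block_D N"
  by (simp_all add: block_A_def block_B_def block_C_def block_D_def vec_eq_iff matrix_matrix_mult_def sum_UNIV_Plus)

lemma block_transpose:
  "block_A (transpose M) = transpose (block_A M)" "block_B (transpose M) = transpose (block_C M)"
  "block_C (transpose M) = transpose (block_B M)" "block_D (transpose M) = transpose (block_D M)"
  by (simp_all add: block_A_def block_B_def block_C_def block_D_def vec_eq_iff transpose_def)

lemma block_one [simp]:
  "block_A (mat 1) = mat 1" "block_B (mat 1) = 0" "block_C (mat 1) = 0" "block_D (mat 1) = mat 1"
  by (simp_all add: block_A_def block_B_def block_C_def block_D_def vec_eq_iff mat_def)

lemma block_uminus:
  "block_A (- M) = - block_A M" "block_B (- M) = - block_B M"
  "block_C (- M) = - block_C M" "block_D (- M) = - block_D M"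
  by (simp_all add: block_A_def block_B_def block_C_def block_D_def vec_eq_iff)

lemma continuous_on_block:
  fixes f :: "'x::topological_space \<Rightarrow> real mat4"
  assumes "continuous_on S f"
  shows "continuous_on S (\<lambda>x. block_A (f x))" "continuous_on S (\<lambda>x. block_B (f x))"
    "continuous_on S (\<lambda>x. block_C (f x))" "continuous_on S (\<lambda>x. block_D (f x))"
  unfolding block_A_def block_B_def block_C_def block_D_def by (intro continuous_intros assms)+

lemma continuous_on_block_mat:
  fixes A B C D :: "'x::topological_space \<Rightarrow> real mat2"
  assumes "continuous_on S A" "continuous_on S B" "continuous_on S C" "continuous_on S D"
  shows "continuous_on S (\<lambda>x. block_mat (A x) (B x) (C x) (D x))"
  unfolding block_mat_def
proof (intro continuous_on_vec_lambda)
  fix i j :: "2 + 2"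
  show "continuous_on S (\<lambda>x. case i of
        Inl k \<Rightarrow> (case j of Inl l \<Rightarrow> A x $ k $ l | Inr l \<Rightarrow> B x $ k $ l)
      | Inr k \<Rightarrow> (case j of Inl l \<Rightarrow> C x $ k $ l | Inr l \<Rightarrow> D x $ k $ l))"
    by (cases i; cases j) (auto intro!: continuous_intros assms)
qed

section \<open>The symplectic group as a topological group\<close>

lemma Sp4_iff:
  "M \<in> carrier Sp4 \<longleftrightarrow>
     transpose (block_A M) ** block_C M = transpose (block_C M) ** block_A M \<and>
     transpose (block_B M) ** block_D M = transpose (block_D M) ** block_B M \<and>
     transpose (block_A M) ** block_D M - transpose (block_C M) ** block_B M = mat 1"
proof -
  define A B C D where "A = block_A M" "B = block_B M" "C = block_C M" "D = block_D M"
  have "M \<in> carrier Sp4 \<longleftrightarrow> transpose A ** C - transpose C ** A = 0 \<and> transpose A ** D - transpose C ** B = mat 1 \<and>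
    transpose B ** C - transpose D ** A = - mat 1 \<and> transpose B ** D - transpose D ** B = 0"
    by (simp add: Sp4_def block_eq_iff Omega_def block_mult block_transpose A_B_C_D_def
        matrix_uminus_left matrix_uminus_right)
  \<comment> \<open>The lower left block of the defining equation is minus the transpose of the
    upper right one, which leaves three conditions.\<close>
  moreover have "transpose B ** C - transpose D ** A = - transpose (transpose A ** D - transpose C ** B)"
    by (simp add: mat2_simps algebra_simps)
  ultimately show ?thesis unfolding A_B_C_D_def
    by (auto simp: transpose_mat)
qed

lemma Sp4_simps [simp]: "mult Sp4 = (**)" "one Sp4 = mat 1"
  by (simp_all add: Sp4_def)

lemma Omega_sq: "Omega ** Omega = - mat 1"
  by (simp add: block_eq_iff Omega_def block_mult block_uminus matrix_uminus_left matrix_uminus_right)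

text \<open>Multiply the defining equation by \<open>Omega\<close> and use that its square is -1.
  The inverse is thus linear in the entries of \<open>M\<close>, which makes inversion
  continuous.\<close>

lemma Sp4_inverse:
  assumes "M \<in> carrier Sp4"
  shows "- (Omega ** transpose M ** Omega) \<in> carrier Sp4" "- (Omega ** transpose M ** Omega) ** M = mat 1"
proof -
  define N where "N = - (Omega ** transpose M ** Omega)"
  have M: "transpose M ** Omega ** M = Omega" using assms by (simp add: Sp4_def)
  have "N ** M = - (Omega ** (transpose M ** Omega ** M))"
    by (simp add: N_def matrix_uminus_left matrix_mul_assoc)
  also have "\<dots> = mat 1" by (simp add: M Omega_sq)
  finally show NM: "N ** M = mat 1" .
  then have MN: "M ** N = mat 1" by (simp add: matrix_left_right_inverse)
  have "transpose N ** Omega ** N = transpose N ** (transpose M ** Omega ** M) ** N" by (simp add: M)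
  also have "\<dots> = transpose (M ** N) ** Omega ** (M ** N)"
    by (simp add: matrix_transpose_mul matrix_mul_assoc)
  also have "\<dots> = Omega" by (simp add: MN)
  finally show "N \<in> carrier Sp4" by (simp add: Sp4_def)
qed

lemma group_Sp4: "group Sp4"
proof (rule groupI)
  fix M N assume "M \<in> carrier Sp4" "N \<in> carrier Sp4"
  then have "transpose (M ** N) ** Omega ** (M ** N) = transpose N ** (transpose M ** Omega ** M) ** N"
    by (simp add: matrix_transpose_mul matrix_mul_assoc)
  then show "M \<otimes>\<^bsub>Sp4\<^esub> N \<in> carrier Sp4"
    using \<open>M \<in> carrier Sp4\<close> \<open>N \<in> carrier Sp4\<close> by (simp add: Sp4_def)
next
  fix M assume "M \<in> carrier Sp4"
  then show "\<exists>N\<in>carrier Sp4. N \<otimes>\<^bsub>Sp4\<^esub> M = \<one>\<^bsub>Sp4\<^esub>" using Sp4_inverse by auto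
qed (auto simp: Sp4_def matrix_mul_assoc)

lemma topological_group_Sp4: "topological_group_on Sp4"
  unfolding topological_group_on_def
proof (intro conjI group_Sp4)
  show "continuous_on (carrier Sp4 \<times> carrier Sp4) (\<lambda>(x, y). x \<otimes>\<^bsub>Sp4\<^esub> y)"
    by (auto simp: split_def intro!: continuous_on_matrix_mult continuous_intros)
  have "continuous_on (carrier Sp4) (\<lambda>M. - (Omega ** transpose M ** Omega))"
    unfolding transpose_def by (intro continuous_intros continuous_on_matrix_mult)
  then show "continuous_on (carrier Sp4) (\<lambda>x. inv\<^bsub>Sp4\<^esub> x)"
  proof (rule continuous_on_eq)
    fix M assume "M \<in> carrier Sp4"
    then show "- (Omega ** transpose M ** Omega) = inv\<^bsub>Sp4\<^esub> M"
      using Sp4_inverse by (intro group.inv_equality[OF group_Sp4, symmetric]) auto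
  qed
qed

subsection \<open>The action on the Siegel upper half-space\<close>

text \<open>\<open>num\<close> and \<open>den\<close> are the upper and lower halves of
  \<open>g\<close> times the column (Z, 1). That product equals (gZ, 1) times \<open>den\<close>, so
  \<open>den\<close> is the automorphy factor of the action.\<close>

definition num :: "real mat4 \<Rightarrow> complex mat2 \<Rightarrow> complex mat2" where
  "num g Z = of_real_mat (block_A g) ** Z + of_real_mat (block_B g)"

definition den :: "real mat4 \<Rightarrow> complex mat2 \<Rightarrow> complex mat2" where
  "den g Z = of_real_mat (block_C g) ** Z + of_real_mat (block_D g)"

definition stack :: "complex mat2 \<Rightarrow> complex mat2 \<Rightarrow> complex mat42" where
  "stack P N = (\<chi> i. case i of Inl k \<Rightarrow> P $ k | Inr k \<Rightarrow> N $ k)"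

lemma Siegel_act_num_den: "Siegel_act g Z = num g Z ** matrix_inv (den g Z)"
  by (simp add: Siegel_act_def num_def den_def)

lemma Siegel_act_eqI:
  assumes "num g Z = W ** den g Z" "det (den g Z) \<noteq> 0"
  shows "Siegel_act g Z = W"
  using assms by (simp add: Siegel_act_num_den matrix_mul_assoc[symmetric] matrix_inv_mult)

lemma num_eq:
  assumes "det (den g Z) \<noteq> 0"
  shows "num g Z = Siegel_act g Z ** den g Z"
  using assms by (simp add: Siegel_act_num_den matrix_mul_assoc[symmetric] matrix_inv_mult)

lemma stack_inject [simp]: "stack P N = stack P' N' \<longleftrightarrow> P = P' \<and> N = N'"
  by (auto simp: stack_def vec_eq_iff split_sum_all)

lemma stack_mult: "stack P N ** Q = stack (P ** Q) (N ** Q)"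
  by (simp add: stack_def vec_eq_iff matrix_matrix_mult_def split_sum_all)

lemma mult_stack:
  "of_real_mat g ** stack P N =
    stack (of_real_mat (block_A g) ** P + of_real_mat (block_B g) ** N)
      (of_real_mat (block_C g) ** P + of_real_mat (block_D g) ** N)"
  by (simp add: stack_def vec_eq_iff matrix_matrix_mult_def split_sum_all sum_UNIV_Plus
      block_A_def block_B_def block_C_def block_D_def)

lemma mult_stack_one: "of_real_mat g ** stack Z (mat 1) = stack (num g Z) (den g Z)"
  by (simp add: mult_stack num_def den_def)

text \<open>The symplectic form makes every identity between \<^const>\<open>num\<close> and \<^const>\<open>den\<close> below an instance of
  \<open>stack_pairing_invariant\<close>.\<close>

lemma stack_pairing:
  "transpose (stack P N) ** of_real_mat Omega ** stack P' N' = transpose P ** N' - transpose N ** P'"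
  by (simp add: vec_eq_iff matrix_matrix_mult_def split_sum_all sum_UNIV_Plus stack_def transpose_def
      Omega_def block_mat_def mat_def sum_2 forall_2)

lemma stack_pairing_invariant:
  assumes g: "g \<in> carrier Sp4"
    and X: "of_real_mat g ** stack P N = stack P1 N1" and Y: "of_real_mat g ** stack P' N' = stack P1' N1'"
  shows "transpose P1 ** N1' - transpose N1 ** P1' = transpose P ** N' - transpose N ** P'"
proof -
  have tr: "of_real_mat (transpose g) = transpose (of_real_mat g)" by (simp add: vec_eq_iff transpose_def)
  have "transpose g ** Omega ** g = Omega" using g by (simp add: Sp4_def)
  then have *: "transpose (of_real_mat g) ** of_real_mat Omega ** of_real_mat g = of_real_mat Omega"
    by (metis of_real_mat_mult tr)
  have "transpose (stack P1 N1) ** of_real_mat Omega ** stack P1' N1' =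
    transpose (stack P N) ** (transpose (of_real_mat g) ** of_real_mat Omega ** of_real_mat g) ** stack P' N'"
    unfolding X[symmetric] Y[symmetric] by (simp add: matrix_transpose_mul matrix_mul_assoc)
  then show ?thesis by (simp add: * stack_pairing)
qed

lemma cnj_stack: "map_matrix cnj (stack P N) = stack (map_matrix cnj P) (map_matrix cnj N)"
  by (simp add: stack_def vec_eq_iff split_sum_all)

text \<open>Sylvester's criterion for the imaginary part. The strict inequalities later legitimize
  the square roots and divisions of the Cholesky factor.\<close>

lemma Siegel_iff:
  "Z \<in> Siegel \<longleftrightarrow> Z $ 1 $ 2 = Z $ 2 $ 1 \<and> Im (Z $ 1 $ 1) > 0 \<and>
     Im (Z $ 1 $ 1) * Im (Z $ 2 $ 2) - (Im (Z $ 1 $ 2))\<^sup>2 > 0"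
proof -
  define a b c where abc: "a = Im (Z $ 1 $ 1)" "b = Im (Z $ 1 $ 2)" "c = Im (Z $ 2 $ 2)"
  have form: "v \<bullet> (map_matrix Im Z *v v) = a * (v $ 1)\<^sup>2 + 2 * b * v $ 1 * v $ 2 + c * (v $ 2)\<^sup>2"
    if "Z $ 1 $ 2 = Z $ 2 $ 1" for v
    using that by (simp add: inner_vec_def matrix_vector_mult_def sum_2 abc power2_eq_square algebra_simps)
  have sym: "transpose Z = Z \<longleftrightarrow> Z $ 1 $ 2 = Z $ 2 $ 1"
    by (auto simp: mat2_simps)
  have "(\<forall>v::real^2. v \<noteq> 0 \<longrightarrow> a * (v $ 1)\<^sup>2 + 2 * b * v $ 1 * v $ 2 + c * (v $ 2)\<^sup>2 > 0) \<longleftrightarrow>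
    a > 0 \<and> a * c - b\<^sup>2 > 0" (is "?L \<longleftrightarrow> ?R")
  proof
    assume L: ?L
    have a: "a > 0"
      using L[rule_format, of "vector [1, 0]"] by (simp add: vec_eq_iff forall_2)
    \<comment> \<open>The vector (-b, a) annihilates the square
      \<open>(a * v $ 1 + b * v $ 2)\<^sup>2\<close> obtained by completing the square, so it
      isolates the determinant.\<close>
    have "a * b\<^sup>2 + 2 * b * (- b) * a + c * a\<^sup>2 > 0"
      using L[rule_format, of "vector [-b, a]"] a by (simp add: vec_eq_iff forall_2)
    then have "a * (a * c - b\<^sup>2) > 0" by (simp add: algebra_simps power2_eq_square)
    with a show ?R by (simp add: zero_less_mult_iff)
  next
    assume R: ?R
    show ?L
    proof (intro allI impI)
      fix v :: "real^2" assume v: "v \<noteq> 0"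
      have eq: "a * (a * (v $ 1)\<^sup>2 + 2 * b * v $ 1 * v $ 2 + c * (v $ 2)\<^sup>2) =
        (a * v $ 1 + b * v $ 2)\<^sup>2 + (a * c - b\<^sup>2) * (v $ 2)\<^sup>2"
        by (simp add: algebra_simps power2_eq_square)
      have "(a * v $ 1 + b * v $ 2)\<^sup>2 + (a * c - b\<^sup>2) * (v $ 2)\<^sup>2 > 0"
      proof (cases "v $ 2 = 0")
        case True
        then show ?thesis using v R by (simp add: vec_eq_iff forall_2)
      next
        case False
        then show ?thesis using R by (intro add_nonneg_pos) auto
      qed
      then show "a * (v $ 1)\<^sup>2 + 2 * b * v $ 1 * v $ 2 + c * (v $ 2)\<^sup>2 > 0"
        using R unfolding eq[symmetric] by (simp add: zero_less_mult_iff)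
    qed
  qed
  then show ?thesis unfolding Siegel_def mem_Collect_eq sym abc[symmetric] using form by auto
qed

lemma Siegel_sym: "Z \<in> Siegel \<Longrightarrow> transpose Z = Z"
  by (simp add: Siegel_def)

section \<open>Hermitian positivity and invariance of the Siegel upper half-space\<close>

definition herm :: "complex mat2 \<Rightarrow> complex^2 \<Rightarrow> complex" where
  "herm M w = (\<Sum>i\<in>UNIV. \<Sum>j\<in>UNIV. cnj (w $ i) * M $ i $ j * w $ j)"

lemma herm_mult: "herm (transpose (map_matrix cnj N) ** M ** N) w = herm M (N *v w)"
  by (simp add: herm_def mat2_simps matrix_vector_mult_def algebra_simps)

text \<open>\<open>Siegel\<close> speaks of real vectors, whereas \<open>den\<close> is complex and
  so are its kernel vectors. For w = a + i b the real part of the form is the sum of the values at a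
  and at b.\<close>

lemma herm_Im_pos:
  assumes Z: "Z \<in> Siegel" and w: "w \<noteq> 0"
  shows "Re (herm (of_real_mat (map_matrix Im Z)) w) > 0"
proof -
  define a b :: "real^2" where ab: "a = (\<chi> i. Re (w $ i))" "b = (\<chi> i. Im (w $ i))"
  let ?q = "\<lambda>v. v \<bullet> (map_matrix Im Z *v v)"
  have pos: "v \<noteq> 0 \<Longrightarrow> ?q v > 0" for v using Z by (auto simp: Siegel_def)
  have nonneg: "?q v \<ge> 0" for v using pos[of v] by (cases "v = 0") (auto simp: less_imp_le)
  have "Z $ 1 $ 2 = Z $ 2 $ 1" using Z by (simp add: Siegel_iff)
  then have "Re (herm (of_real_mat (map_matrix Im Z)) w) = ?q a + ?q b"
    by (simp add: herm_def sum_2 inner_vec_def matrix_vector_mult_def ab algebra_simps)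
  moreover have "a \<noteq> 0 \<or> b \<noteq> 0" using w by (auto simp: ab vec_eq_iff complex_eq_iff)
  ultimately show ?thesis using pos[of a] pos[of b] nonneg[of a] nonneg[of b] by linarith
qed

text \<open>As \<open>g\<close> is real, it sends (cnj Z, 1) to the conjugate of (num, den).
  Invariance of the pairing reduces the left side to cnj Z - Z for symmetric
  \<open>Z\<close>.\<close>

lemma pairing_cnj:
  assumes g: "g \<in> carrier Sp4" and Z: "Z \<in> Siegel"
  shows "transpose (map_matrix cnj (num g Z)) ** den g Z - transpose (map_matrix cnj (den g Z)) ** num g Z =
    map_matrix ((*) (-2 * \<i>)) (of_real_mat (map_matrix Im Z))"
proof -
  have "of_real_mat g ** stack (map_matrix cnj Z) (mat 1) = map_matrix cnj (of_real_mat g ** stack Z (mat 1))"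
  proof -
    have "map_matrix cnj (of_real_mat g) = of_real_mat g" by (simp add: vec_eq_iff)
    moreover have "map_matrix cnj (mat 1) = (mat 1 :: complex mat2)" by (simp add: vec_eq_iff mat_def)
    ultimately show ?thesis by (simp add: cnj_mat_mult cnj_stack)
  qed
  then have "of_real_mat g ** stack (map_matrix cnj Z) (mat 1) =
      stack (map_matrix cnj (num g Z)) (map_matrix cnj (den g Z))"
    by (simp add: mult_stack_one cnj_stack)
  note stack_pairing_invariant[OF g this mult_stack_one]
  moreover have "Z $ 1 $ 2 = Z $ 2 $ 1" using Z by (simp add: Siegel_iff)
  then have "transpose (map_matrix cnj Z) ** mat 1 - transpose (mat 1) ** Z =
    map_matrix ((*) (-2 * \<i>)) (of_real_mat (map_matrix Im Z))"
    unfolding transpose_mat matrix_mul_lid matrix_mul_rid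
    by (simp add: vec_eq_iff transpose_def complex_eq_iff forall_2)
  ultimately show ?thesis by simp
qed

text \<open>At a kernel vector of \<open>den\<close> the left side of \<open>pairing_cnj\<close>
  vanishes as a Hermitian form, but the right side is a nonzero multiple of a form positive
  there.\<close>

lemma den_det_nz:
  assumes g: "g \<in> carrier Sp4" and Z: "Z \<in> Siegel"
  shows "det (den g Z) \<noteq> 0"
proof
  assume "det (den g Z) = 0"
  then have "\<not> (\<exists>B. B ** den g Z = mat 1)"
    using invertible_det_nz[of "den g Z"] invertible_left_inverse by blast
  then obtain w where w: "w \<noteq> 0" "den g Z *v w = 0"
    unfolding matrix_left_invertible_ker by blast
  let ?P = "num g Z" and ?N = "den g Z"
  have "herm (transpose (map_matrix cnj ?P) ** ?N - transpose (map_matrix cnj ?N) ** ?P) w =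
    (\<Sum>i\<in>UNIV. cnj ((?P *v w) $ i) * (?N *v w) $ i - cnj ((?N *v w) $ i) * (?P *v w) $ i)"
    by (simp add: herm_def mat2_simps matrix_vector_mult_def algebra_simps)
  then have "herm (map_matrix ((*) (-2 * \<i>)) (of_real_mat (map_matrix Im Z))) w = 0"
    unfolding pairing_cnj[OF g Z] w(2) by simp
  then have "-2 * \<i> * herm (of_real_mat (map_matrix Im Z)) w = 0"
    by (simp add: herm_def sum_2 algebra_simps)
  then show False using herm_Im_pos[OF Z w(1)] by simp
qed

text \<open>The column (Z, 1) pairs to zero with itself exactly because \<open>Z\<close> is
  symmetric; invariance transfers this to (num, den), and cancelling \<open>den\<close> on both
  sides yields symmetry of the image.\<close>

lemma Siegel_act_sym:
  assumes g: "g \<in> carrier Sp4" and Z: "Z \<in> Siegel"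
  shows "transpose (Siegel_act g Z) = Siegel_act g Z"
proof -
  let ?W = "Siegel_act g Z" and ?N = "den g Z"
  have "transpose (num g Z) ** ?N = transpose ?N ** num g Z"
    using stack_pairing_invariant[OF g mult_stack_one mult_stack_one, of Z Z] Siegel_sym[OF Z] by simp
  then have "transpose ?N ** transpose ?W ** ?N = transpose ?N ** ?W ** ?N"
    unfolding num_eq[OF den_det_nz[OF g Z]] by (simp add: matrix_transpose_mul matrix_mul_assoc)
  then have "matrix_inv (transpose ?N) ** (transpose ?N ** transpose ?W ** ?N) ** matrix_inv ?N =
    matrix_inv (transpose ?N) ** (transpose ?N ** ?W ** ?N) ** matrix_inv ?N"
    by simp
  moreover have "matrix_inv (transpose ?N) ** (transpose ?N ** X ** ?N) ** matrix_inv ?N = X" for X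
  proof -
    have "matrix_inv (transpose ?N) ** (transpose ?N ** X ** ?N) ** matrix_inv ?N =
      (matrix_inv (transpose ?N) ** transpose ?N) ** X ** (?N ** matrix_inv ?N)"
      by (simp only: matrix_mul_assoc)
    then show ?thesis using den_det_nz[OF g Z] by (simp add: matrix_inv_mult det_transpose)
  qed
  ultimately show ?thesis by simp
qed

lemma matrix_times_const:
  fixes A :: "'a::comm_semiring_1^'n^'m"
  shows "A ** map_matrix ((*) c) B = map_matrix ((*) c) (A ** B)"
    and "map_matrix ((*) c) A ** B = map_matrix ((*) c) (A ** B)"
  by (simp_all add: vec_eq_iff matrix_matrix_mult_def sum_distrib_left mult_ac)

text \<open>With W = gZ and N = \<open>den g Z\<close>, \<open>pairing_cnj\<close> becomes Im Z =
  N^H (Im W) N, where N^H is the conjugate transpose. Since N is invertible, positivity passes to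
  W.\<close>

lemma Siegel_act_closed:
  assumes g: "g \<in> carrier Sp4" and Z: "Z \<in> Siegel"
  shows "Siegel_act g Z \<in> Siegel"
proof -
  let ?W = "Siegel_act g Z" and ?N = "den g Z"
  have nz: "det ?N \<noteq> 0" by (rule den_det_nz[OF g Z])
  have "transpose ?W $ 1 $ 2 = ?W $ 1 $ 2" by (simp only: Siegel_act_sym[OF g Z])
  then have sym: "?W $ 1 $ 2 = ?W $ 2 $ 1" by (simp add: transpose_def)
  have Ws: "transpose (map_matrix cnj ?W) - ?W = map_matrix ((*) (-2 * \<i>)) (of_real_mat (map_matrix Im ?W))"
    using sym by (simp add: vec_eq_iff transpose_def complex_eq_iff forall_2)
  have "map_matrix ((*) (-2 * \<i>)) (of_real_mat (map_matrix Im Z)) =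
    transpose (map_matrix cnj ?N) ** (transpose (map_matrix cnj ?W) - ?W) ** ?N"
    unfolding pairing_cnj[OF g Z, symmetric] num_eq[OF nz] cnj_mat_mult
    by (simp add: matrix_transpose_mul matrix_mul_assoc matrix_diff_ldistrib matrix_diff_rdistrib)
  then have eq: "of_real_mat (map_matrix Im Z) =
    transpose (map_matrix cnj ?N) ** of_real_mat (map_matrix Im ?W) ** ?N"
    unfolding Ws matrix_times_const by (simp add: vec_eq_iff)
  have "v \<bullet> (map_matrix Im ?W *v v) > 0" if v: "v \<noteq> 0" for v :: "real^2"
  proof -
    define u :: "complex^2" where "u = (\<chi> i. complex_of_real (v $ i))"
    define w where "w = matrix_inv ?N *v u"
    have Nw: "?N *v w = u" by (simp add: w_def matrix_vector_mul_assoc matrix_inv_mult nz)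
    have "u \<noteq> 0" using v by (auto simp: u_def vec_eq_iff)
    then have "w \<noteq> 0" using Nw by auto
    from herm_Im_pos[OF Z this] have "Re (herm (of_real_mat (map_matrix Im ?W)) u) > 0"
      unfolding eq herm_mult Nw .
    then show ?thesis by (simp add: herm_def u_def inner_vec_def matrix_vector_mult_def sum_2 algebra_simps)
  qed
  then show ?thesis using Siegel_act_sym[OF g Z] by (simp add: Siegel_def)
qed

text \<open>Apply the product to the column (Z, 1) in two ways and compare the halves.\<close>

lemma Siegel_act_cocycle:
  assumes g: "g \<in> carrier Sp4" and h: "h \<in> carrier Sp4" and Z: "Z \<in> Siegel"
  shows "Siegel_act (g ** h) Z = Siegel_act g (Siegel_act h Z)"
    and "den (g ** h) Z = den g (Siegel_act h Z) ** den h Z"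
proof -
  let ?W = "Siegel_act h Z"
  have nz: "det (den h Z) \<noteq> 0" by (rule den_det_nz[OF h Z])
  have "stack (num (g ** h) Z) (den (g ** h) Z) = of_real_mat g ** (of_real_mat h ** stack Z (mat 1))"
    by (simp add: mult_stack_one[symmetric] of_real_mat_mult matrix_mul_assoc)
  also have "\<dots> = of_real_mat g ** (stack ?W (mat 1) ** den h Z)"
    by (simp add: mult_stack_one stack_mult num_eq[OF nz, symmetric])
  also have "\<dots> = stack (num g ?W ** den h Z) (den g ?W ** den h Z)"
    unfolding matrix_mul_assoc mult_stack_one by (rule stack_mult)
  finally have *: "num (g ** h) Z = num g ?W ** den h Z" "den (g ** h) Z = den g ?W ** den h Z"
    by simp_all
  then show "den (g ** h) Z = den g ?W ** den h Z" by simp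
  have nz2: "det (den g ?W) \<noteq> 0" using den_det_nz[OF g Siegel_act_closed[OF h Z]] .
  show "Siegel_act (g ** h) Z = Siegel_act g ?W"
    by (rule Siegel_act_eqI) (use * nz nz2 num_eq[OF nz2] in \<open>simp_all add: det_mul matrix_mul_assoc\<close>)
qed

lemma Siegel_act_one [simp]: "Siegel_act (mat 1) Z = Z" and den_one [simp]: "den (mat 1) Z = mat 1"
proof -
  have 1: "of_real_mat (mat 1) = (mat 1 :: complex mat2)" "of_real_mat 0 = (0 :: complex mat2)"
    by (simp_all add: vec_eq_iff mat_def)
  show d: "den (mat 1) Z = mat 1" by (simp add: den_def 1)
  show "Siegel_act (mat 1) Z = Z" by (rule Siegel_act_eqI) (simp_all add: d num_def 1)
qed

lemma continuous_on_num_den: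
  fixes f :: "'x::topological_space \<Rightarrow> real mat4"
  assumes "continuous_on S f" "continuous_on S h"
  shows "continuous_on S (\<lambda>x. num (f x) (h x))" "continuous_on S (\<lambda>x. den (f x) (h x))"
  unfolding num_def den_def
  by (intro continuous_intros continuous_on_matrix_mult continuous_on_map_matrix continuous_on_block assms)+

lemma continuous_on_Siegel_act:
  fixes f :: "'x::topological_space \<Rightarrow> real mat4"
  assumes "continuous_on S f" "continuous_on S h" "\<And>x. x \<in> S \<Longrightarrow> det (den (f x) (h x)) \<noteq> 0"
  shows "continuous_on S (\<lambda>x. Siegel_act (f x) (h x))"
  unfolding Siegel_act_num_den
  by (intro continuous_on_matrix_mult continuous_on_matrix_inv_2 continuous_on_num_den assms)

subsection \<open>The normal factor\<close>

lemma rank_stack: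
  assumes "invertible Q"
  shows "rank (stack P Q) = 2"
proof -
  obtain R where "R ** Q = mat 1" using assms by (auto simp: invertible_def)
  then have "vec.span (rows Q) = UNIV" using matrix_left_invertible_span_rows_gen by blast
  moreover have "rows Q \<subseteq> rows (stack P Q)"
  proof
    fix r assume "r \<in> rows Q"
    then obtain i where "r = row i Q" by (auto simp: rows_def)
    then have "r = row (Inr i) (stack P Q)" by (simp add: row_def stack_def)
    then show "r \<in> rows (stack P Q)" by (auto simp: rows_def)
  qed
  ultimately have "vec.span (rows (stack P Q)) = UNIV" using vec.span_mono by blast
  then have "vec.dim (rows (stack P Q)) = CARD(2)" by (metis vec.dim_span vec_dim_card)
  then show ?thesis by (simp add: row_rank_def_gen)
qed

lemma P2_chart_eq: "P2_chart Z = {stack (Z ** Q) Q | Q. invertible Q}"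
proof -
  have "(\<chi> i. case i of Inl k \<Rightarrow> Z $ k | Inr k \<Rightarrow> (mat 1 :: complex mat2) $ k) = stack Z (mat 1)"
    by (simp add: stack_def)
  then have "P2_chart Z = P2_rel `` {stack Z (mat 1)}" by (simp add: P2_chart_def)
  also have "\<dots> = {stack (Z ** Q) Q | Q. invertible Q}"
    using rank_stack[of "mat 1" Z] rank_stack by (auto simp: P2_rel_def stack_mult invertible_def)
  finally show ?thesis .
qed

text \<open>A class in the chart has only one representative with lower half 1. This is the
  uniqueness behind \<open>P2_act_in_chart\<close>.\<close>

lemma P2_chart_inject: "P2_chart Z = P2_chart W \<longleftrightarrow> Z = W"
proof
  assume eq: "P2_chart Z = P2_chart W"
  have "stack (Z ** mat 1) (mat 1) \<in> P2_chart Z"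
    unfolding P2_chart_eq using invertible_def matrix_mul_lid by blast
  then have "stack Z (mat 1) \<in> P2_chart W" by (simp add: eq)
  then show "Z = W" by (auto simp: P2_chart_eq)
qed simp

text \<open>The image of the representative with lower half \<open>Q\<close> has lower half
  \<open>den g Z ** Q\<close>, and multiplication by \<open>den g Z\<close> permutes the invertible
  matrices.\<close>

lemma P2_act_chart:
  assumes nz: "det (den g Z) \<noteq> 0"
  shows "P2_act g (P2_chart Z) = P2_chart (Siegel_act g Z)"
proof -
  let ?N = "den g Z" and ?W = "Siegel_act g Z"
  have act: "of_real_mat g ** stack (Z ** Q) Q = stack (?W ** (?N ** Q)) (?N ** Q)" for Q
  proof -
    have "of_real_mat g ** stack (Z ** Q) Q = (of_real_mat g ** stack Z (mat 1)) ** Q"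
      by (simp add: stack_mult matrix_mul_assoc[symmetric])
    also have "\<dots> = stack (?W ** (?N ** Q)) (?N ** Q)"
      by (simp add: mult_stack_one stack_mult num_eq[OF nz] matrix_mul_assoc)
    finally show ?thesis .
  qed
  have N: "invertible ?N" using nz by (simp add: invertible_det_nz)
  show ?thesis
  proof (intro equalityI subsetI)
    fix X assume "X \<in> P2_act g (P2_chart Z)"
    then obtain Q where "invertible Q" "X = stack (?W ** (?N ** Q)) (?N ** Q)"
      by (auto simp: P2_act_def P2_chart_eq act)
    then show "X \<in> P2_chart ?W" using invertible_mult[OF N] unfolding P2_chart_eq by blast
  next
    fix X assume "X \<in> P2_chart ?W"
    then obtain Q where Q: "invertible Q" "X = stack (?W ** Q) Q" by (auto simp: P2_chart_eq)
    have NQ: "?N ** (matrix_inv ?N ** Q) = Q" by (simp add: matrix_mul_assoc matrix_inv_mult nz)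
    have "invertible (matrix_inv ?N)" using matrix_inv_mult[OF nz] by (auto simp: invertible_def)
    then have "invertible (matrix_inv ?N ** Q)" using Q by (intro invertible_mult)
    then have "stack (Z ** (matrix_inv ?N ** Q)) (matrix_inv ?N ** Q) \<in> P2_chart Z" unfolding P2_chart_eq by blast
    then have "of_real_mat g ** stack (Z ** (matrix_inv ?N ** Q)) (matrix_inv ?N ** Q) \<in> P2_act g (P2_chart Z)"
      by (auto simp: P2_act_def)
    then show "X \<in> P2_act g (P2_chart Z)" by (simp only: act NQ Q(2))
  qed
qed

lemma P2_act_in_chart_eq: "det (den g Z) \<noteq> 0 \<Longrightarrow> P2_act_in_chart g Z = Siegel_act g Z"
  by (simp add: P2_act_in_chart_def P2_act_chart P2_chart_inject)

text \<open>Bounds the remainder of the derivative by a product of two norms, that of the increment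
  of the action and that of the displacement.\<close>

lemma bounded_bilinear_matrix_mult:
  fixes C M :: "complex mat2"
  shows "bounded_bilinear (\<lambda>(X :: complex mat2) H. X ** C ** H ** M)"
  unfolding bilinear_conv_bounded_bilinear[symmetric] bilinear_def
  by (auto intro!: linearI simp: matrix_add_rdistrib matrix_add_ldistrib matrix_scaleR_left matrix_scaleR_right)

text \<open>With \<open>F = Siegel_act g\<close> one has the exact identity
  \<open>F z - F Z = (A - F z C) (z - Z) (C Z + D)\<^sup>-\<^sup>1\<close>, so continuity of \<open>F\<close> at \<open>Z\<close> suffices.\<close>

lemma Siegel_act_has_derivative:
  assumes nz: "det (den g Z) \<noteq> 0"
  defines "T \<equiv> \<lambda>H. (of_real_mat (block_A g) - Siegel_act g Z ** of_real_mat (block_C g)) ** H ** matrix_inv (den g Z)"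
  shows "(P2_act_in_chart g has_derivative T) (at Z)"
proof -
  let ?A = "of_real_mat (block_A g)" and ?B = "of_real_mat (block_B g)"
    and ?C = "of_real_mat (block_C g)" and ?D = "of_real_mat (block_D g)"
  let ?F = "Siegel_act g" and ?M = "matrix_inv (den g Z)"
  define S where "S = {z. det (den g z) \<noteq> 0}"
  have den_cont: "continuous_on UNIV (\<lambda>z. det (den g z))"
    by (intro continuous_on_det_2 continuous_on_num_den continuous_intros)
  have "open S" unfolding S_def
    by (rule open_Collect_neq[OF den_cont]) (intro continuous_intros)
  have ZS: "Z \<in> S" using nz by (simp add: S_def)
  have "continuous_on S ?F"
    by (rule continuous_on_Siegel_act) (auto simp: S_def intro!: continuous_intros)
  then have F_cont: "isCont ?F Z" using \<open>open S\<close> ZS continuous_on_eq_continuous_at by blast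
  \<comment> \<open>\<open>T\<close> carries \<open>?F Z\<close> where the exact identity has
    \<open>?F z\<close>; the error is their difference times the displacement, hence of smaller
    order.\<close>
  have diff: "?F z - ?F Z - T (z - Z) = (?F Z - ?F z) ** ?C ** (z - Z) ** ?M" if "z \<in> S" for z
  proof -
    have "num g z = ?F z ** den g z" "num g Z = ?F Z ** den g Z"
      using num_eq that nz by (auto simp: S_def)
    moreover have "num g z - num g Z = ?A ** (z - Z)" "den g z - den g Z = ?C ** (z - Z)"
      by (simp_all add: num_def den_def matrix_diff_ldistrib)
    ultimately have "?A ** (z - Z) = ?F z ** (den g Z + ?C ** (z - Z)) - ?F Z ** den g Z"
      by (metis add.commute diff_add_cancel)
    then have "(?F z - ?F Z) ** den g Z = (?A - ?F z ** ?C) ** (z - Z)"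
      by (simp add: matrix_add_ldistrib matrix_diff_rdistrib matrix_mul_assoc)
    then have "(?F z - ?F Z) ** den g Z ** ?M = (?A - ?F z ** ?C) ** (z - Z) ** ?M" by simp
    then have "?F z - ?F Z = (?A - ?F z ** ?C) ** (z - Z) ** ?M"
      by (simp add: matrix_mul_assoc[symmetric] matrix_inv_mult nz)
    then show ?thesis unfolding T_def by (simp add: matrix_diff_rdistrib)
  qed
  obtain K where K: "K > 0" "\<And>(X :: complex mat2) H. norm (X ** ?C ** H ** ?M) \<le> norm X * norm H * K"
    using bounded_bilinear.pos_bounded[OF bounded_bilinear_matrix_mult[of ?C ?M]] by blast
  have "bounded_linear T"
    unfolding T_def linear_conv_bounded_linear[symmetric]
    by (auto intro!: linearI simp: matrix_add_rdistrib matrix_add_ldistrib matrix_scaleR_left matrix_scaleR_right)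
  moreover have "\<exists>d>0. \<forall>z. 0 < norm (z - Z) \<and> norm (z - Z) < d \<longrightarrow>
      norm (?F z - ?F Z - T (z - Z)) / norm (z - Z) < e" if e: "e > 0" for e
  proof -
    obtain d1 where d1: "d1 > 0" "\<And>z. dist z Z < d1 \<Longrightarrow> dist (?F z) (?F Z) < e / K"
      using F_cont e K(1) unfolding continuous_at_eps_delta by (metis divide_pos_pos)
    obtain d2 where d2: "d2 > 0" "ball Z d2 \<subseteq> S" using \<open>open S\<close> ZS open_contains_ball by blast
    show ?thesis
    proof (intro exI[of _ "min d1 d2"] conjI allI impI)
      fix z assume z: "0 < norm (z - Z) \<and> norm (z - Z) < min d1 d2"
      then have "z \<in> S" using d2 by (auto simp: dist_norm norm_minus_commute)
      then have "norm (?F z - ?F Z - T (z - Z)) \<le> norm (?F Z - ?F z) * norm (z - Z) * K"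
        unfolding diff[OF \<open>z \<in> S\<close>] by (intro K(2))
      also have "\<dots> < e * norm (z - Z)"
      proof -
        have "norm (?F Z - ?F z) < e / K" using d1(2)[of z] z by (simp add: dist_norm norm_minus_commute)
        then have "norm (?F Z - ?F z) * K < e" using K(1) by (simp add: field_simps)
        then have "norm (?F Z - ?F z) * K * norm (z - Z) < e * norm (z - Z)"
          using z by (intro mult_strict_right_mono) auto
        then show ?thesis by (simp add: mult_ac)
      qed
      finally show "norm (?F z - ?F Z - T (z - Z)) / norm (z - Z) < e" using z by (simp add: field_simps)
    qed (use d1 d2 in auto)
  qed
  ultimately have "(?F has_derivative T) (at Z)" unfolding has_derivative_at' by blast
  then show ?thesis
    by (rule has_derivative_transform_within_open[OF _ \<open>open S\<close> ZS])
      (simp add: S_def P2_act_in_chart_eq)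
qed

lemma normal_vec_congruence: "transpose M ** normal_vec w ** M = normal_vec (det M * w)"
  by (simp add: normal_vec_def normal_vec1_def mat2_simps algebra_simps)

text \<open>Symplecticity turns the left factor A - W C of the derivative into the inverse transpose
  of N, so the derivative is a congruence and \<open>normal_vec_congruence\<close> applies.\<close>

lemma normal_factor_eq:
  assumes g: "g \<in> carrier Sp4" and Z: "Z \<in> Siegel"
  shows "normal_factor g Z = inverse (det (den g Z))"
proof -
  let ?A = "of_real_mat (block_A g)" and ?C = "of_real_mat (block_C g)"
  let ?W = "Siegel_act g Z" and ?N = "den g Z"
  have nz: "det ?N \<noteq> 0" by (rule den_det_nz[OF g Z])
  define T where "T = (\<lambda>H. (?A - ?W ** ?C) ** H ** matrix_inv ?N)"
  have der: "(P2_act_in_chart g has_derivative T) (at Z)"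
    unfolding T_def by (rule Siegel_act_has_derivative[OF nz])
  have WN: "transpose ?N ** ?W = transpose (num g Z)"
    using Siegel_act_sym[OF g Z] by (simp add: num_eq[OF nz] matrix_transpose_mul)
  \<comment> \<open>The column (1, 0) extracts the blocks A and C; its pairing with (Z, 1) is
    constant.\<close>
  have "of_real_mat g ** stack (mat 1) 0 = stack ?A ?C" by (simp add: mult_stack)
  from stack_pairing_invariant[OF g mult_stack_one this, of Z]
  have "transpose ?N ** ?A - transpose (num g Z) ** ?C = mat 1"
    by (simp add: transpose_mat) (metis minus_diff_eq minus_minus)
  then have "transpose ?N ** (?A - ?W ** ?C) = mat 1"
    by (simp add: matrix_diff_ldistrib matrix_mul_assoc WN)
  moreover have "transpose ?N ** transpose (matrix_inv ?N) = mat 1"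
    by (simp add: matrix_transpose_mul[symmetric] matrix_inv_mult nz transpose_mat)
  ultimately have AC: "?A - ?W ** ?C = transpose (matrix_inv ?N)"
    by (metis matrix_inv_eqI)
  have "det (matrix_inv ?N) * det ?N = 1" by (simp add: det_mul[symmetric] matrix_inv_mult nz)
  then have "det (matrix_inv ?N) = inverse (det ?N)" using nz by (simp add: field_simps)
  then have T: "T (normal_vec w) = normal_vec (inverse (det ?N) * w)" for w
    by (simp add: T_def AC normal_vec_congruence)
  show ?thesis
    unfolding normal_factor_def
  proof (rule the_equality)
    show "\<exists>T. (P2_act_in_chart g has_derivative T) (at Z) \<and>
       (\<forall>w. T (normal_vec w) = normal_vec (inverse (det ?N) * w))"
      using der T by blast
    fix c assume "\<exists>T. (P2_act_in_chart g has_derivative T) (at Z) \<and> (\<forall>w. T (normal_vec w) = normal_vec (c * w))"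
    then obtain T' where T': "(P2_act_in_chart g has_derivative T') (at Z)"
      "\<And>w. T' (normal_vec w) = normal_vec (c * w)" by blast
    \<comment> \<open>The derivative is unique, and its value on the nonzero vector
      \<open>normal_vec 1\<close> determines the factor.\<close>
    have "T' = T" using has_derivative_unique[OF T'(1) der] .
    then have "normal_vec (c * 1) = normal_vec (inverse (det ?N) * 1)" using T T'(2) by metis
    then show "c = inverse (det ?N)"
      by (simp add: normal_vec_def normal_vec1_def vec_eq_iff forall_2)
  qed
qed

definition phase :: "real mat4 \<Rightarrow> complex mat2 \<Rightarrow> complex" where
  "phase g Z = complex_of_real (norm (det (den g Z))) / det (den g Z)"

lemma SiegelS1_act_eq:
  assumes "g \<in> carrier Sp4" "Z \<in> Siegel" "u \<in> sphere 0 1"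
  shows "SiegelS1_act g (Z, u) = (Siegel_act g Z, phase g Z * u)"
  using assms by (simp add: SiegelS1_act_def SiegelS1_def normal_factor_eq phase_def norm_inverse norm_divide field_simps)

lemma norm_phase:
  assumes "g \<in> carrier Sp4" "Z \<in> Siegel"
  shows "norm (phase g Z) = 1"
  using den_det_nz[OF assms] by (simp add: phase_def norm_divide)

lemma phase_one [simp]: "phase (mat 1) Z = 1"
  by (simp add: phase_def)

lemma phase_mult:
  assumes "g \<in> carrier Sp4" "h \<in> carrier Sp4" "Z \<in> Siegel"
  shows "phase (g ** h) Z = phase g (Siegel_act h Z) * phase h Z"
  by (simp add: phase_def Siegel_act_cocycle[OF assms] det_mul norm_mult)

lemma continuous_on_phase:
  fixes f :: "'x::topological_space \<Rightarrow> real mat4"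
  assumes "continuous_on S f" "continuous_on S h"
    and "\<And>x. x \<in> S \<Longrightarrow> f x \<in> carrier Sp4" "\<And>x. x \<in> S \<Longrightarrow> h x \<in> Siegel"
  shows "continuous_on S (\<lambda>x. phase (f x) (h x))"
  unfolding phase_def
  by (intro continuous_intros continuous_on_det_2 continuous_on_num_den assms ballI)
    (use assms den_det_nz in auto)

text \<open>The pointwise laws suffice: the inverse element provides the inverse map, and
  extensionality makes the maps elements of \<open>BijGroup\<close>.\<close>

lemma group_actionI:
  assumes "group G"
    and im: "\<And>g x. g \<in> carrier G \<Longrightarrow> x \<in> E \<Longrightarrow> \<phi> g x \<in> E"
    and ext: "\<And>g. g \<in> carrier G \<Longrightarrow> \<phi> g \<in> extensional E"
    and one: "\<And>x. x \<in> E \<Longrightarrow> \<phi> \<one>\<^bsub>G\<^esub> x = x"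
    and mult: "\<And>g h x. g \<in> carrier G \<Longrightarrow> h \<in> carrier G \<Longrightarrow> x \<in> E \<Longrightarrow> \<phi> (g \<otimes>\<^bsub>G\<^esub> h) x = \<phi> g (\<phi> h x)"
  shows "group_action G E \<phi>"
proof -
  interpret group G by fact
  have inv: "\<phi> (inv\<^bsub>G\<^esub> g) (\<phi> g x) = x" "\<phi> g (\<phi> (inv\<^bsub>G\<^esub> g) x) = x" if "g \<in> carrier G" "x \<in> E" for g x
    using that one by (simp_all flip: mult)
  have Bij: "\<phi> g \<in> Bij E" if g: "g \<in> carrier G" for g
  proof -
    have "bij_betw (\<phi> g) E E"
      by (rule bij_betw_byWitness[where f' = "\<phi> (inv\<^bsub>G\<^esub> g)"]) (use g im inv in auto)
    then show ?thesis using ext g by (simp add: Bij_def)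
  qed
  have "\<phi> \<in> hom G (BijGroup E)"
  proof (rule homI)
    fix g h assume gh: "g \<in> carrier G" "h \<in> carrier G"
    have "\<phi> (g \<otimes>\<^bsub>G\<^esub> h) = compose E (\<phi> g) (\<phi> h)"
      by (rule extensionalityI[of _ E]) (use gh ext mult in \<open>auto simp: compose_eq\<close>)
    then show "\<phi> (g \<otimes>\<^bsub>G\<^esub> h) = \<phi> g \<otimes>\<^bsub>BijGroup E\<^esub> \<phi> h"
      using Bij gh by (simp add: BijGroup_def)
  qed (use Bij in \<open>simp add: BijGroup_def\<close>)
  then show ?thesis
    by (intro group_action.intro group_hom.intro group_hom_axioms.intro is_group group_BijGroup)
qed

lemma group_action_SiegelS1: "group_action Sp4 SiegelS1 SiegelS1_act"
proof (rule group_actionI[OF group_Sp4])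
  fix g x assume g: "g \<in> carrier Sp4" and x: "x \<in> SiegelS1"
  then obtain Z u where Zu: "x = (Z, u)" "Z \<in> Siegel" "norm u = 1" by (auto simp: SiegelS1_def)
  then show "SiegelS1_act g x \<in> SiegelS1"
    using g by (simp add: SiegelS1_act_eq Siegel_act_closed norm_mult norm_phase SiegelS1_def)
  fix h assume h: "h \<in> carrier Sp4"
  have "g ** h \<in> carrier Sp4"
    using g h monoid.m_closed[OF group.is_monoid[OF group_Sp4], of g h] by simp
  then show "SiegelS1_act (g \<otimes>\<^bsub>Sp4\<^esub> h) x = SiegelS1_act g (SiegelS1_act h x)"
    using g h Zu by (simp add: SiegelS1_act_eq Siegel_act_closed norm_mult norm_phase phase_mult Siegel_act_cocycle(1))
next
  have "mat 1 \<in> carrier Sp4" using monoid.one_closed[OF group.is_monoid[OF group_Sp4]] by simp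
  then show "SiegelS1_act \<one>\<^bsub>Sp4\<^esub> x = x" if "x \<in> SiegelS1" for x
    using that by (auto simp: SiegelS1_def SiegelS1_act_eq)
qed (auto simp: SiegelS1_act_def)

subsection \<open>A continuous section of the orbit map\<close>

abbreviation base_point :: "complex mat2" where
  "base_point \<equiv> mat \<i>"

lemma base_point_Siegel: "base_point \<in> Siegel"
  by (simp add: Siegel_iff mat_def)

text \<open>For symmetric \<open>Z\<close> this is the determinant of the imaginary part.\<close>

definition im_disc :: "complex mat2 \<Rightarrow> real" where
  "im_disc Z = Im (Z $ 1 $ 1) * Im (Z $ 2 $ 2) - (Im (Z $ 1 $ 2))\<^sup>2"

text \<open>\<open>chol\<close> is the Cholesky factor \<open>L\<close> of the imaginary part \<open>Y = L L\<^sup>T\<close>, and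
  \<open>chol_inv\<close> is the inverse of \<open>L\<^sup>T\<close>.\<close>

definition chol :: "complex mat2 \<Rightarrow> real mat2" where
  "chol Z = vector [vector [sqrt (Im (Z $ 1 $ 1)), 0],
     vector [Im (Z $ 1 $ 2) / sqrt (Im (Z $ 1 $ 1)), sqrt (im_disc Z) / sqrt (Im (Z $ 1 $ 1))]]"

definition chol_inv :: "complex mat2 \<Rightarrow> real mat2" where
  "chol_inv Z = vector [vector [1 / sqrt (Im (Z $ 1 $ 1)),
       - Im (Z $ 1 $ 2) / (sqrt (Im (Z $ 1 $ 1)) * sqrt (im_disc Z))],
     vector [0, sqrt (Im (Z $ 1 $ 1)) / sqrt (im_disc Z)]]"

lemma chol_eqs:
  assumes Z: "Z \<in> Siegel"
  shows "transpose (chol Z) ** chol_inv Z = mat 1" "chol Z ** transpose (chol Z) = map_matrix Im Z"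
    and "det (chol_inv Z) > 0"
proof -
  define a b c d where abc: "a = Im (Z $ 1 $ 1)" "b = Im (Z $ 1 $ 2)" "c = Im (Z $ 2 $ 2)" "d = im_disc Z"
  have pos: "a > 0" "d > 0" "d = a * c - b\<^sup>2" and sym: "Z $ 2 $ 1 = Z $ 1 $ 2"
    using Z by (auto simp: Siegel_iff abc im_disc_def)
  define s where "s = sqrt a"
  define r where "r = sqrt d"
  have sr: "s > 0" "r > 0" "s * s = a" "r * r = d" using pos by (auto simp: s_def r_def)
  have L: "chol Z = vector [vector [s, 0], vector [b / s, r / s]]"
    and M: "chol_inv Z = vector [vector [1 / s, - b / (s * r)], vector [0, s / r]]"
    by (simp_all add: chol_def chol_inv_def s_def r_def abc)
  show "transpose (chol Z) ** chol_inv Z = mat 1"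
    unfolding L M using sr by (simp add: mat2_simps)
  have "b * b + r * r = s * s * c" using sr pos by (simp add: power2_eq_square)
  then have "(b * b + r * r) / (s * s) = c" using sr(1) by simp
  then have "(b / s) * (b / s) + (r / s) * (r / s) = c" by (simp add: add_divide_distrib)
  then show "chol Z ** transpose (chol Z) = map_matrix Im Z"
    unfolding L using sr sym by (simp add: mat2_simps abc)
  show "det (chol_inv Z) > 0" unfolding M using sr by (simp add: det_2)
qed

text \<open>With Z = X + i Y and Y = L L^T, this is the block triangular matrix with rows (L, X
  L^-T) and (0, L^-T); it sends i I to X + i L L^T.\<close>

definition siegel_section :: "complex mat2 \<Rightarrow> real mat4" where
  "siegel_section Z = block_mat (chol Z) (map_matrix Re Z ** chol_inv Z) 0 (chol_inv Z)"

lemma siegel_section_Sp4: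
  assumes Z: "Z \<in> Siegel"
  shows "siegel_section Z \<in> carrier Sp4"
proof -
  have "transpose (map_matrix Re Z) = map_matrix Re Z"
    using Z by (auto simp: Siegel_iff vec_eq_iff transpose_def forall_2)
  then have "transpose (map_matrix Re Z ** chol_inv Z) ** chol_inv Z =
      transpose (chol_inv Z) ** (map_matrix Re Z ** chol_inv Z)"
    by (simp add: matrix_transpose_mul matrix_mul_assoc)
  moreover have "transpose (0 :: real mat2) = 0" by (simp add: vec_eq_iff transpose_def)
  ultimately show ?thesis using chol_eqs(1)[OF Z] by (simp add: Sp4_iff siegel_section_def)
qed

lemma of_real_mat_simps [simp]:
  "of_real_mat 0 = (0 :: complex^'n^'m)" "of_real_mat (mat 1) = (mat 1 :: complex^'k^'k)"
  by (simp_all add: vec_eq_iff mat_def)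

lemma matrix_mult_base: "A ** base_point = map_matrix ((*) \<i>) A" "base_point ** A = map_matrix ((*) \<i>) A"
  by (simp_all add: mat2_simps)

text \<open>The factor \<open>den\<close> is here the real matrix \<open>chol_inv Z\<close>, of
  positive determinant because the Cholesky diagonal is positive; hence the phase is
  trivial.\<close>

lemma siegel_section_act:
  assumes Z: "Z \<in> Siegel"
  shows "Siegel_act (siegel_section Z) base_point = Z" "phase (siegel_section Z) base_point = 1"
proof -
  let ?L = "chol Z" and ?M = "chol_inv Z"
  have den: "den (siegel_section Z) base_point = of_real_mat ?M"
    by (simp add: den_def siegel_section_def)
  have d: "det (of_real_mat ?M) = complex_of_real (det ?M)" by (simp add: det_2)
  have "?L = ?L ** (transpose ?L ** ?M)" by (simp add: chol_eqs[OF Z])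
  also have "\<dots> = map_matrix Im Z ** ?M" by (simp only: matrix_mul_assoc chol_eqs(2)[OF Z])
  finally have L: "?L = map_matrix Im Z ** ?M" .
  have split: "Z = map_matrix ((*) \<i>) (of_real_mat (map_matrix Im Z)) + of_real_mat (map_matrix Re Z)"
    by (simp add: vec_eq_iff complex_eq_iff)
  have "num (siegel_section Z) base_point =
    map_matrix ((*) \<i>) (of_real_mat (map_matrix Im Z ** ?M)) + of_real_mat (map_matrix Re Z ** ?M)"
    by (simp add: num_def siegel_section_def matrix_mult_base flip: L)
  also have "\<dots> = (map_matrix ((*) \<i>) (of_real_mat (map_matrix Im Z)) + of_real_mat (map_matrix Re Z)) ** of_real_mat ?M"
    by (simp add: of_real_mat_mult matrix_times_const matrix_add_rdistrib)
  also have "\<dots> = Z ** of_real_mat ?M" using split by simp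
  finally show "Siegel_act (siegel_section Z) base_point = Z"
    using chol_eqs(3)[OF Z] by (intro Siegel_act_eqI) (simp_all add: den d)
  show "phase (siegel_section Z) base_point = 1"
    using chol_eqs(3)[OF Z] by (simp add: phase_def den d)
qed

text \<open>The standard embedding of U(2), with the sign for which C i + D gives back
  \<open>U\<close> itself rather than its conjugate.\<close>

definition unitary_embed :: "complex mat2 \<Rightarrow> real mat4" where
  "unitary_embed U = block_mat (map_matrix Re U) (- map_matrix Im U) (map_matrix Im U) (map_matrix Re U)"

lemma den_unitary_embed: "den (unitary_embed U) base_point = U"
  and num_unitary_embed: "num (unitary_embed U) base_point = base_point ** U"
  by (simp_all add: den_def num_def unitary_embed_def matrix_mult_base vec_eq_iff complex_eq_iff)

text \<open>The real and imaginary parts of the unitarity equation are the symplectic block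
  conditions.\<close>

lemma unitary_embed_Sp4:
  assumes "transpose (map_matrix cnj U) ** U = mat 1"
  shows "unitary_embed U \<in> carrier Sp4"
proof -
  define V where "V = transpose (map_matrix cnj U) ** U"
  have "map_matrix Re V = mat 1" "map_matrix Im V = 0" using assms by (simp_all add: V_def vec_eq_iff mat_def)
  moreover have "map_matrix Re V = transpose (map_matrix Re U) ** map_matrix Re U + transpose (map_matrix Im U) ** map_matrix Im U"
    "map_matrix Im V = transpose (map_matrix Re U) ** map_matrix Im U - transpose (map_matrix Im U) ** map_matrix Re U"
    by (simp_all add: V_def mat2_simps)
  ultimately have "transpose (map_matrix Re U) ** map_matrix Re U + transpose (map_matrix Im U) ** map_matrix Im U = mat 1"
    "transpose (map_matrix Re U) ** map_matrix Im U = transpose (map_matrix Im U) ** map_matrix Re U"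
    by simp_all
  moreover have "transpose (- A) = - transpose A" for A :: "real mat2" by (simp add: vec_eq_iff transpose_def)
  ultimately show ?thesis
    by (simp add: Sp4_iff unitary_embed_def matrix_uminus_left matrix_uminus_right)
qed

lemma unitary_embed_act:
  assumes "transpose (map_matrix cnj U) ** U = mat 1"
  shows "Siegel_act (unitary_embed U) base_point = base_point" "phase (unitary_embed U) base_point = cnj (det U)"
proof -
  have "det (transpose (map_matrix cnj U)) * det U = 1" using assms by (metis det_mul det_I)
  then have n: "cnj (det U) * det U = 1" by (simp add: det_2 transpose_def algebra_simps)
  then have nz: "det U \<noteq> 0" by auto
  show "Siegel_act (unitary_embed U) base_point = base_point"
    by (rule Siegel_act_eqI) (simp_all add: den_unitary_embed num_unitary_embed nz)
  have "norm (cnj (det U) * det U) = 1" using n by simp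
  then have "(norm (det U))\<^sup>2 = 1\<^sup>2" by (simp add: norm_mult power2_eq_square)
  then have "norm (det U) = 1" by (rule power2_eq_imp_eq) auto
  then show "phase (unitary_embed U) base_point = cnj (det U)"
    using n nz by (simp add: phase_def den_unitary_embed field_simps)
qed

text \<open>A unitary matrix acts on the circle over i I by the conjugate of its determinant, so the
  entry \<open>cnj u\<close> produces rotation by \<open>u\<close>.\<close>

definition S1_section :: "complex mat2 \<times> complex \<Rightarrow> real mat4" where
  "S1_section = (\<lambda>(Z, u). siegel_section Z ** unitary_embed (vector [vector [cnj u, 0], vector [0, 1]]))"

lemma Sp4_closed: "g \<in> carrier Sp4 \<Longrightarrow> h \<in> carrier Sp4 \<Longrightarrow> g ** h \<in> carrier Sp4"
  using monoid.m_closed[OF group.is_monoid[OF group_Sp4], of g h] by simp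

lemma S1_section:
  assumes x: "x \<in> SiegelS1"
  shows "S1_section x \<in> carrier Sp4" "SiegelS1_act (S1_section x) (base_point, 1) = x"
proof -
  obtain Z u where Zu: "x = (Z, u)" "Z \<in> Siegel" "norm u = 1" using x by (auto simp: SiegelS1_def)
  define R :: "complex mat2" where "R = vector [vector [cnj u, 0], vector [0, 1]]"
  have "u * cnj u = 1" using Zu by (simp add: complex_norm_square[symmetric])
  then have R: "transpose (map_matrix cnj R) ** R = mat 1" by (simp add: R_def mat2_simps)
  have dR: "det R = cnj u" by (simp add: R_def det_2)
  have s: "S1_section x = siegel_section Z ** unitary_embed R" by (simp add: S1_section_def Zu R_def)
  note RS = unitary_embed_Sp4[OF R] and ZS = siegel_section_Sp4[OF Zu(2)]
  show "S1_section x \<in> carrier Sp4" unfolding s by (intro Sp4_closed RS ZS)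
  then show "SiegelS1_act (S1_section x) (base_point, 1) = x"
    unfolding s
    by (simp add: SiegelS1_act_eq base_point_Siegel Siegel_act_cocycle(1) phase_mult RS ZS
        unitary_embed_act[OF R] siegel_section_act Zu dR)
qed

lemma continuous_on_map_matrix_Re_Im:
  fixes f :: "'x::topological_space \<Rightarrow> complex^'n^'m"
  assumes "continuous_on S f"
  shows "continuous_on S (\<lambda>x. map_matrix Re (f x))" "continuous_on S (\<lambda>x. map_matrix Im (f x))"
  by (intro continuous_on_map_matrix assms continuous_intros)+

lemma continuous_on_vector_2:
  fixes a b :: "'x::topological_space \<Rightarrow> 'a::{topological_space, zero}"
  assumes "continuous_on S a" "continuous_on S b"
  shows "continuous_on S (\<lambda>x. vector [a x, b x] :: 'a^2)"
proof -
  have "continuous_on S (\<lambda>x. \<chi> i::2. if i = 1 then a x else b x)"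
  proof (intro continuous_on_vec_lambda)
    fix i :: 2
    show "continuous_on S (\<lambda>x. if i = 1 then a x else b x)" using assms by (cases "i = 1") auto
  qed
  then show ?thesis by (rule continuous_on_eq) (simp add: vec_eq_iff forall_2)
qed

lemma continuous_on_unitary_embed:
  fixes f :: "'x::topological_space \<Rightarrow> complex mat2"
  assumes "continuous_on S f"
  shows "continuous_on S (\<lambda>x. unitary_embed (f x))"
  unfolding unitary_embed_def
  by (intro continuous_on_block_mat continuous_on_map_matrix_Re_Im continuous_on_minus assms)

lemma continuous_on_S1_section: "continuous_on SiegelS1 S1_section"
proof -
  have 1: "Im (fst x $ 1 $ 1) > 0" "im_disc (fst x) > 0" if "x \<in> SiegelS1" for x
    using that by (auto simp: SiegelS1_def Siegel_iff im_disc_def)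
  have d: "continuous_on SiegelS1 (\<lambda>x. im_disc (fst x))"
    unfolding im_disc_def by (intro continuous_intros)
  have "continuous_on SiegelS1 (\<lambda>x. chol (fst x))" "continuous_on SiegelS1 (\<lambda>x. chol_inv (fst x))"
    unfolding chol_def chol_inv_def using 1
    by (intro continuous_on_vector_2 continuous_on_divide continuous_on_real_sqrt continuous_on_mult d ballI;
        fastforce intro: continuous_intros)+
  then have "continuous_on SiegelS1 (\<lambda>x. siegel_section (fst x) **
      unitary_embed (vector [vector [cnj (snd x), 0], vector [0, 1]]))"
    unfolding siegel_section_def
    by (intro continuous_on_matrix_mult continuous_on_block_mat continuous_on_map_matrix_Re_Im
        continuous_on_unitary_embed continuous_on_vector_2 continuous_intros)
  then show ?thesis by (simp add: S1_section_def split_def)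
qed

subsection \<open>The stabilizer of the base point\<close>

lemma SU2_iff: "U \<in> carrier SU2 \<longleftrightarrow> transpose (map_matrix cnj U) ** U = mat 1 \<and> det U = 1"
  by (simp add: SU2_def)

abbreviation base_S1 :: "complex mat2 \<times> complex" where
  "base_S1 \<equiv> (base_point, 1)"

lemma stabilizer_base_iff:
  "g \<in> stabilizer Sp4 SiegelS1_act base_S1 \<longleftrightarrow>
     g \<in> carrier Sp4 \<and> Siegel_act g base_point = base_point \<and> phase g base_point = 1"
  by (auto simp: stabilizer_def SiegelS1_act_eq base_point_Siegel)

lemma unitary_embed_stabilizer:
  assumes "U \<in> carrier SU2"
  shows "unitary_embed U \<in> stabilizer Sp4 SiegelS1_act base_S1"
  using assms by (simp add: stabilizer_base_iff SU2_iff unitary_embed_Sp4 unitary_embed_act)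

text \<open>Fixing i I means num = i N, and then \<open>pairing_cnj\<close> says that N is unitary.
  Its determinant has norm 1, so a trivial phase forces it to be 1.\<close>

lemma stabilizer_base:
  assumes "g \<in> stabilizer Sp4 SiegelS1_act base_S1"
  shows "den g base_point \<in> carrier SU2" "unitary_embed (den g base_point) = g"
proof -
  have g: "g \<in> carrier Sp4" "Siegel_act g base_point = base_point" "phase g base_point = 1"
    using assms by (auto simp: stabilizer_base_iff)
  let ?N = "den g base_point"
  have nz: "det ?N \<noteq> 0" by (rule den_det_nz[OF g(1) base_point_Siegel])
  have num: "num g base_point = base_point ** ?N" using num_eq[OF nz] g(2) by simp
  have "transpose (map_matrix cnj (base_point ** ?N)) ** ?N - transpose (map_matrix cnj ?N) ** (base_point ** ?N) =
    map_matrix ((*) (-2 * \<i>)) (transpose (map_matrix cnj ?N) ** ?N)"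
    by (simp add: mat2_simps algebra_simps)
  moreover have "of_real_mat (map_matrix Im base_point) = (mat 1 :: complex mat2)"
    by (simp add: vec_eq_iff mat_def)
  ultimately have "map_matrix ((*) (-2 * \<i>)) (transpose (map_matrix cnj ?N) ** ?N) = map_matrix ((*) (-2 * \<i>)) (mat 1)"
    using pairing_cnj[OF g(1) base_point_Siegel] num by simp
  then have U: "transpose (map_matrix cnj ?N) ** ?N = mat 1" by (simp add: vec_eq_iff)
  have "det (transpose (map_matrix cnj ?N)) * det ?N = 1" using U by (metis det_mul det_I)
  then have n: "cnj (det ?N) * det ?N = 1" by (simp add: det_2 transpose_def algebra_simps)
  then have "norm (cnj (det ?N) * det ?N) = 1" by simp
  then have "(norm (det ?N))\<^sup>2 = 1\<^sup>2" by (simp add: norm_mult power2_eq_square)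
  then have "norm (det ?N) = 1" by (rule power2_eq_imp_eq) auto
  then have "det ?N = 1" using g(3) nz by (simp add: phase_def)
  with U show "?N \<in> carrier SU2" by (simp add: SU2_iff)
  have eqs: "map_matrix ((*) \<i>) (of_real_mat (block_A g)) + of_real_mat (block_B g) =
      map_matrix ((*) \<i>) (map_matrix ((*) \<i>) (of_real_mat (block_C g)) + of_real_mat (block_D g))"
    using num by (simp add: num_def den_def matrix_mult_base)
  \<comment> \<open>The blocks are real, so num = i N splits into real and imaginary parts; thus N
    determines \<open>g\<close>.\<close>
  have "block_A g = block_D g" "block_B g = - block_C g"
    using eqs by (simp_all add: vec_eq_iff complex_eq_iff)
  then show "unitary_embed ?N = g"
    by (simp add: block_eq_iff unitary_embed_def den_def matrix_mult_base vec_eq_iff)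
qed

lemma homeomorphism_stabilizer_SU2:
  "homeomorphism (stabilizer Sp4 SiegelS1_act base_S1) (carrier SU2) (\<lambda>g. den g base_point) unitary_embed"
  by (rule homeomorphismI)
    (auto simp: stabilizer_base unitary_embed_stabilizer den_unitary_embed
      intro!: continuous_on_num_den continuous_on_unitary_embed continuous_intros)

text \<open>At a fixed point the cocycle law for \<open>den\<close> becomes
  multiplicativity.\<close>

lemma den_iso_SU2:
  "(\<lambda>g. den g base_point) \<in> iso (Sp4\<lparr>carrier := stabilizer Sp4 SiegelS1_act base_S1\<rparr>) SU2"
  unfolding iso_def hom_def
proof (intro CollectI conjI)
  show "bij_betw (\<lambda>g. den g base_point) (carrier (Sp4\<lparr>carrier := stabilizer Sp4 SiegelS1_act base_S1\<rparr>)) (carrier SU2)"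
    by (rule bij_betw_byWitness[where f' = unitary_embed])
      (auto simp: stabilizer_base unitary_embed_stabilizer den_unitary_embed)
qed (auto simp: stabilizer_base stabilizer_base_iff Siegel_act_cocycle(2) base_point_Siegel SU2_def[THEN arg_cong[of _ _ mult]])

lemma topological_group_isomorphic_base:
  "topological_group_isomorphic (Sp4\<lparr>carrier := stabilizer Sp4 SiegelS1_act base_S1\<rparr>) SU2"
  unfolding topological_group_isomorphic_def
  using den_iso_SU2 homeomorphism_imp_homeomorphic_map[OF homeomorphism_stabilizer_SU2] by auto

section \<open>SU(2) as the unit sphere of pairs of complex numbers\<close>

lemma homeomorphism_SU2_sphere:
  "homeomorphism (carrier SU2) (sphere (0 :: complex \<times> complex) 1) (\<lambda>U. (U $ 1 $ 1, U $ 2 $ 1))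
     (\<lambda>(a, b). vector [vector [a, - cnj b], vector [b, cnj a]])"
proof (rule homeomorphismI)
  let ?f = "\<lambda>U :: complex mat2. (U $ 1 $ 1, U $ 2 $ 1)"
  let ?g = "\<lambda>(a, b). vector [vector [a, - cnj b], vector [b, cnj a]] :: complex mat2"
  have sph: "(a, b) \<in> sphere 0 1 \<longleftrightarrow> cnj a * a + cnj b * b = 1" for a b :: complex
  proof -
    have "norm (a, b) = 1 \<longleftrightarrow> (norm a)\<^sup>2 + (norm b)\<^sup>2 = 1" by (simp add: norm_Pair)
    also have "\<dots> \<longleftrightarrow> complex_of_real ((norm a)\<^sup>2 + (norm b)\<^sup>2) = 1" by (metis of_real_eq_1_iff)
    also have "\<dots> \<longleftrightarrow> cnj a * a + cnj b * b = 1"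
      by (simp add: complex_norm_square[symmetric] mult.commute)
    finally show ?thesis by simp
  qed
  show "continuous_on (carrier SU2) ?f" by (intro continuous_intros)
  show "continuous_on (sphere 0 1) ?g"
    unfolding split_def by (intro continuous_on_vector_2 continuous_intros)
  show "?f ` carrier SU2 \<subseteq> sphere 0 1"
  proof (rule image_subsetI)
    fix U assume "U \<in> carrier SU2"
    then have "(transpose (map_matrix cnj U) ** U) $ 1 $ 1 = 1" by (simp add: SU2_iff mat_def)
    then show "?f U \<in> sphere 0 1" unfolding sph by (simp add: matrix_matrix_mult_def sum_2 transpose_def)
  qed
  show "?g ` sphere 0 1 \<subseteq> carrier SU2"
  proof (rule image_subsetI)
    fix x :: "complex \<times> complex" assume x: "x \<in> sphere 0 1"
    obtain a b where ab: "x = (a, b)" by (cases x)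
    have "cnj a * a + cnj b * b = 1" using x unfolding ab sph .
    then show "?g x \<in> carrier SU2" by (simp add: ab SU2_iff mat2_simps algebra_simps)
  qed
  show "?g (?f U) = U" if "U \<in> carrier SU2" for U
  proof -
    have U: "transpose (map_matrix cnj U) ** U = mat 1" "det U = 1" using that by (auto simp: SU2_iff)
    then have "U ** transpose (map_matrix cnj U) = mat 1" by (simp add: matrix_left_right_inverse)
    then have "matrix_inv U = transpose (map_matrix cnj U)" by (rule matrix_inv_eqI)
    \<comment> \<open>The inverse is the adjoint by unitarity and the adjugate by determinant 1;
      comparing them expresses the second column through the first.\<close>
    then have "transpose (map_matrix cnj U) = vector [vector [U $ 2 $ 2, - U $ 1 $ 2], vector [- U $ 2 $ 1, U $ 1 $ 1]]"
      using matrix_inv_2[of U] U by (simp add: vec_eq_iff forall_2)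
    then have "cnj (U $ 1 $ 1) = U $ 2 $ 2" "cnj (U $ 2 $ 1) = - U $ 1 $ 2"
      by (simp_all add: vec_eq_iff forall_2 transpose_def)
    then show ?thesis by (simp add: vec_eq_iff forall_2)
  qed
  show "?f (?g x) = x" for x by (simp add: split_def)
qed

lemma compact_SU2: "compact (carrier SU2)"
  using compact_continuous_image[OF homeomorphism_cont2[OF homeomorphism_SU2_sphere]]
    homeomorphism_image2[OF homeomorphism_SU2_sphere] by simp

lemma compact_stabilizer_base: "compact (stabilizer Sp4 SiegelS1_act base_S1)"
  using compact_continuous_image[OF homeomorphism_cont2[OF homeomorphism_stabilizer_SU2] compact_SU2]
    homeomorphism_image2[OF homeomorphism_stabilizer_SU2] by simp

lemma simply_connected_SU2: "simply_connected (carrier SU2)"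
proof -
  \<comment> \<open>The ambient real dimension is 4, so the sphere is three-dimensional.\<close>
  have "simply_connected (sphere (0 :: complex \<times> complex) 1)" by (rule simply_connected_sphere) simp
  then show ?thesis
    using homeomorphism_SU2_sphere homeomorphic_simply_connected_eq homeomorphic_def by blast
qed

lemma locally_path_connected_homeomorphism:
  fixes S :: "'a::metric_space set" and T :: "'b::metric_space set"
  assumes "homeomorphism S T f g" "locally path_connected S"
  shows "locally path_connected T"
  using homeomorphism_locally[OF assms(1), of path_connected path_connected] assms(2)
    homeomorphic_path_connectedness unfolding homeomorphic_def by blast

lemma locally_path_connected_SU2: "locally path_connected (carrier SU2)"
  using locally_path_connected_homeomorphism[OF homeomorphism_symD[OF homeomorphism_SU2_sphere]
      locally_path_connected_sphere] .

lemma convex_Siegel: "convex Siegel"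
proof (rule convexI)
  fix Z W :: "complex mat2" and s t :: real
  assume Z: "Z \<in> Siegel" and W: "W \<in> Siegel" and st: "0 \<le> s" "0 \<le> t" "s + t = 1"
  let ?q = "\<lambda>Z v. v \<bullet> (map_matrix Im Z *v v)"
  have q: "?q (s *\<^sub>R Z + t *\<^sub>R W) v = s * ?q Z v + t * ?q W v" for v :: "real^2"
    by (simp add: inner_vec_def matrix_vector_mult_def sum_2 algebra_simps)
  have "?q (s *\<^sub>R Z + t *\<^sub>R W) v > 0" if v: "v \<noteq> 0" for v :: "real^2"
  proof -
    have "?q Z v > 0" "?q W v > 0" using Z W v by (auto simp: Siegel_def)
    then show ?thesis unfolding q using st
      by (cases "s = 0") (auto intro!: add_pos_nonneg)
  qed
  moreover have "transpose (s *\<^sub>R Z + t *\<^sub>R W) = s *\<^sub>R transpose Z + t *\<^sub>R transpose W"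
    by (simp add: vec_eq_iff transpose_def)
  ultimately show "s *\<^sub>R Z + t *\<^sub>R W \<in> Siegel" using Z W by (simp add: Siegel_def)
qed

subsection \<open>Topology of the symplectic group\<close>

lemma orbit_base: "SiegelS1_act g base_S1 = (Siegel_act g base_point, phase g base_point)" if "g \<in> carrier Sp4"
  using that by (simp add: SiegelS1_act_eq base_point_Siegel)

lemma continuous_on_orbit_base: "continuous_on (carrier Sp4) (\<lambda>g. SiegelS1_act g base_S1)"
proof -
  have "continuous_on (carrier Sp4) (\<lambda>g. (Siegel_act g base_point, phase g base_point))"
    by (intro continuous_on_Pair continuous_on_Siegel_act continuous_on_phase continuous_intros)
      (auto simp: den_det_nz base_point_Siegel)
  then show ?thesis by (rule continuous_on_eq) (simp add: orbit_base)
qed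

text \<open>Factor \<open>h\<close> as the section at its orbit point times a stabilizer element,
  and record the latter by its matrix in SU(2).\<close>

definition Sp4_coord :: "real mat4 \<Rightarrow> (complex mat2 \<times> complex) \<times> complex mat2" where
  "Sp4_coord h = (SiegelS1_act h base_S1,
     den (inv\<^bsub>Sp4\<^esub> (S1_section (SiegelS1_act h base_S1)) ** h) base_point)"

lemma homeomorphism_Sp4:
  "homeomorphism (SiegelS1 \<times> carrier SU2) (carrier Sp4) (\<lambda>(y, U). S1_section y ** unitary_embed U) Sp4_coord"
proof -
  interpret group Sp4 by (rule group_Sp4)
  interpret act: group_action Sp4 SiegelS1 SiegelS1_act by (rule group_action_SiegelS1)
  have base: "base_S1 \<in> SiegelS1" by (simp add: SiegelS1_def base_point_Siegel)
  have orb: "SiegelS1_act h base_S1 \<in> SiegelS1" if "h \<in> carrier Sp4" for h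
    using act.element_image[OF that base] by simp
  have stab: "inv\<^bsub>Sp4\<^esub> (S1_section (SiegelS1_act h base_S1)) ** h \<in> stabilizer Sp4 SiegelS1_act base_S1"
    if h: "h \<in> carrier Sp4" for h
  proof -
    let ?s = "S1_section (SiegelS1_act h base_S1)"
    have s: "?s \<in> carrier Sp4" "SiegelS1_act ?s base_S1 = SiegelS1_act h base_S1"
      using S1_section[OF orb[OF h]] by auto
    have "SiegelS1_act (inv\<^bsub>Sp4\<^esub> ?s) (SiegelS1_act h base_S1) = base_S1"
      using s base by (intro act.orbit_sym_aux) auto
    then have "SiegelS1_act (inv\<^bsub>Sp4\<^esub> ?s \<otimes>\<^bsub>Sp4\<^esub> h) base_S1 = base_S1"
      using s h base by (subst act.composition_rule) auto
    then show ?thesis using s h Sp4_closed by (simp add: stabilizer_def)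
  qed
  have emb: "unitary_embed U \<in> carrier Sp4" "SiegelS1_act (unitary_embed U) base_S1 = base_S1" if "U \<in> carrier SU2" for U
    using unitary_embed_stabilizer[OF that] by (auto simp: stabilizer_def)
  show ?thesis
  proof (rule homeomorphismI)
    show "continuous_on (SiegelS1 \<times> carrier SU2) (\<lambda>(y, U). S1_section y ** unitary_embed U)"
      unfolding split_def
      by (intro continuous_on_matrix_mult continuous_on_unitary_embed continuous_on_compose2[OF continuous_on_S1_section]
          continuous_intros) auto
    have c1: "continuous_on (carrier Sp4) (\<lambda>h. S1_section (SiegelS1_act h base_S1))"
      by (rule continuous_on_compose2[OF continuous_on_S1_section continuous_on_orbit_base]) (use orb in auto)
    then have c2: "continuous_on (carrier Sp4) (\<lambda>h. inv\<^bsub>Sp4\<^esub> (S1_section (SiegelS1_act h base_S1)))"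
      by (intro continuous_on_group_inv[OF topological_group_Sp4]) (use orb S1_section in auto)
    show "continuous_on (carrier Sp4) Sp4_coord"
      unfolding Sp4_coord_def
      by (intro continuous_on_Pair continuous_on_orbit_base continuous_on_num_den continuous_on_matrix_mult c2 continuous_intros)
    show "(\<lambda>(y, U). S1_section y ** unitary_embed U) ` (SiegelS1 \<times> carrier SU2) \<subseteq> carrier Sp4"
      using S1_section emb Sp4_closed by auto
    show "Sp4_coord ` carrier Sp4 \<subseteq> SiegelS1 \<times> carrier SU2"
      using orb stabilizer_base(1)[OF stab] by (auto simp: Sp4_coord_def)
    show "Sp4_coord (case x of (y, U) \<Rightarrow> S1_section y ** unitary_embed U) = x" if x: "x \<in> SiegelS1 \<times> carrier SU2" for x
    proof -
      obtain y U where yU: "x = (y, U)" "y \<in> SiegelS1" "U \<in> carrier SU2" using x by auto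
      have o: "SiegelS1_act (S1_section y ** unitary_embed U) base_S1 = y"
        using act.composition_rule[OF base S1_section(1)[OF yU(2)] emb(1)[OF yU(3)]] emb(2)[OF yU(3)] S1_section(2)[OF yU(2)]
        by simp
      have "inv\<^bsub>Sp4\<^esub> (S1_section y) ** (S1_section y ** unitary_embed U) = unitary_embed U"
        using inv_solve_left[of "unitary_embed U" "S1_section y" "S1_section y ** unitary_embed U"]
          S1_section(1)[OF yU(2)] emb(1)[OF yU(3)] Sp4_closed by simp
      then show ?thesis by (simp add: yU(1) Sp4_coord_def o den_unitary_embed)
    qed
    show "(case Sp4_coord h of (y, U) \<Rightarrow> S1_section y ** unitary_embed U) = h" if h: "h \<in> carrier Sp4" for h
    proof -
      have s: "S1_section (SiegelS1_act h base_S1) \<in> carrier Sp4" using S1_section orb h by blast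
      have "S1_section (SiegelS1_act h base_S1) ** (inv\<^bsub>Sp4\<^esub> (S1_section (SiegelS1_act h base_S1)) ** h) = h"
        using s h m_assoc[of "S1_section (SiegelS1_act h base_S1)" "inv\<^bsub>Sp4\<^esub> (S1_section (SiegelS1_act h base_S1))" h]
          r_inv[OF s] by simp
      then show ?thesis by (simp add: Sp4_coord_def stabilizer_base(2)[OF stab[OF h]])
    qed
  qed
qed

lemma locally_path_connected_Times:
  fixes S :: "'a::metric_space set" and T :: "'b::metric_space set"
  assumes "locally path_connected S" "locally path_connected T"
  shows "locally path_connected (S \<times> T)"
  by (rule locally_Times[OF assms]) (auto intro: path_connected_Times)

lemma locally_path_connected_Sp4: "locally path_connected (carrier Sp4)"
proof (rule locally_path_connected_homeomorphism[OF homeomorphism_Sp4])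
  show "locally path_connected (SiegelS1 \<times> carrier SU2)"
    unfolding SiegelS1_def
    by (intro locally_path_connected_Times convex_imp_locally_path_connected convex_Siegel
        locally_path_connected_SU2 locally_path_connected_sphere)
qed

definition Sp4_cover :: "(real mat4 \<times> real) set" where
  "Sp4_cover = {(h, t). h \<in> carrier Sp4 \<and> cis t = phase h base_point}"

text \<open>In the product coordinates the phase at i I is the circle coordinate, so pulling back
  \<open>cis\<close> along it replaces that coordinate by a real one.\<close>

lemma homeomorphism_Sp4_cover:
  "homeomorphism (SiegelR \<times> carrier SU2) Sp4_cover
     (\<lambda>(x, U). (S1_section (SiegelR_proj x) ** unitary_embed U, snd x))
     (\<lambda>(h, t). ((Siegel_act h base_point, t), snd (Sp4_coord h)))"
proof -
  let ?F = "\<lambda>(y, U). S1_section y ** unitary_embed U"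
  note hm = homeomorphism_Sp4
  have F_cont: "continuous_on (SiegelS1 \<times> carrier SU2) ?F" and C_cont: "continuous_on (carrier Sp4) Sp4_coord"
    and F_im: "\<And>y U. y \<in> SiegelS1 \<Longrightarrow> U \<in> carrier SU2 \<Longrightarrow> S1_section y ** unitary_embed U \<in> carrier Sp4"
    and CF: "\<And>y U. y \<in> SiegelS1 \<Longrightarrow> U \<in> carrier SU2 \<Longrightarrow> Sp4_coord (S1_section y ** unitary_embed U) = (y, U)"
    and FC: "\<And>h. h \<in> carrier Sp4 \<Longrightarrow> ?F (Sp4_coord h) = h"
    using hm unfolding homeomorphism_def by auto
  have C_im: "Sp4_coord h \<in> SiegelS1 \<times> carrier SU2" if "h \<in> carrier Sp4" for h
    using homeomorphism_image2[OF hm] that by blast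
  have fstC: "fst (Sp4_coord h) = (Siegel_act h base_point, phase h base_point)" if "h \<in> carrier Sp4" for h
    using that by (simp add: Sp4_coord_def orbit_base)
  have proj: "SiegelR_proj x \<in> SiegelS1" if "x \<in> SiegelR" for x
    using that by (auto simp: SiegelR_proj_def SiegelR_def SiegelS1_def)
  have proj_cont: "continuous_on S SiegelR_proj" for S
    unfolding SiegelR_proj_def split_def by (intro continuous_intros)
  show ?thesis
  proof (rule homeomorphismI)
    show "continuous_on (SiegelR \<times> carrier SU2) (\<lambda>(x, U). (S1_section (SiegelR_proj x) ** unitary_embed U, snd x))"
      unfolding split_def
      by (intro continuous_on_Pair continuous_on_matrix_mult continuous_on_unitary_embed
          continuous_on_compose2[OF continuous_on_S1_section] continuous_on_compose2[OF proj_cont[of UNIV]] continuous_intros)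
        (auto simp: proj)
    have c: "continuous_on Sp4_cover (\<lambda>x. snd (Sp4_coord (fst x)))"
      by (intro continuous_intros continuous_on_compose2[OF C_cont]) (auto simp: Sp4_cover_def)
    show "continuous_on Sp4_cover (\<lambda>(h, t). ((Siegel_act h base_point, t), snd (Sp4_coord h)))"
      unfolding split_def
      by (intro continuous_on_Pair continuous_on_Siegel_act c)
        (auto simp: den_det_nz base_point_Siegel Sp4_cover_def intro!: continuous_intros)
    have ph: "phase (S1_section (SiegelR_proj x) ** unitary_embed U) base_point = cis (snd x) \<and>
        Siegel_act (S1_section (SiegelR_proj x) ** unitary_embed U) base_point = fst x"
      if "x \<in> SiegelR" "U \<in> carrier SU2" for x U
      using fstC[OF F_im[OF proj[OF that(1)] that(2)]] CF[OF proj[OF that(1)] that(2)]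
      by (simp add: SiegelR_proj_def split_def)
    show "(\<lambda>(x, U). (S1_section (SiegelR_proj x) ** unitary_embed U, snd x)) ` (SiegelR \<times> carrier SU2) \<subseteq> Sp4_cover"
      using ph F_im[OF proj] by (auto simp: Sp4_cover_def simp del: split_paired_All)
    show "(\<lambda>(h, t). ((Siegel_act h base_point, t), snd (Sp4_coord h))) ` Sp4_cover \<subseteq> SiegelR \<times> carrier SU2"
      using C_im by (auto simp: Sp4_cover_def SiegelR_def Siegel_act_closed base_point_Siegel mem_Times_iff)
    show "(case case x of (x, U) \<Rightarrow> (S1_section (SiegelR_proj x) ** unitary_embed U, snd x) of
        (h, t) \<Rightarrow> ((Siegel_act h base_point, t), snd (Sp4_coord h))) = x" if "x \<in> SiegelR \<times> carrier SU2" for x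
      using that ph CF[OF proj] by (auto simp: split_def)
    show "(case case y of (h, t) \<Rightarrow> ((Siegel_act h base_point, t), snd (Sp4_coord h)) of
        (x, U) \<Rightarrow> (S1_section (SiegelR_proj x) ** unitary_embed U, snd x)) = y" if y: "y \<in> Sp4_cover" for y
    proof -
      obtain h t where ht: "y = (h, t)" "h \<in> carrier Sp4" "cis t = phase h base_point"
        using y by (auto simp: Sp4_cover_def)
      then have "SiegelR_proj (Siegel_act h base_point, t) = fst (Sp4_coord h)"
        by (simp add: fstC SiegelR_proj_def)
      then show ?thesis using FC[OF ht(2)] by (simp add: ht(1) split_def)
    qed
  qed
qed

lemma Sp4_cover_topology: "simply_connected Sp4_cover" "locally path_connected Sp4_cover"
proof -
  have "simply_connected (SiegelR \<times> carrier SU2)"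
    unfolding SiegelR_def
    by (intro simply_connected_Times convex_imp_simply_connected convex_Siegel convex_UNIV simply_connected_SU2)
  then show "simply_connected Sp4_cover"
    using homeomorphism_Sp4_cover homeomorphic_simply_connected_eq homeomorphic_def by blast
  show "locally path_connected Sp4_cover"
    unfolding SiegelR_def
    by (rule locally_path_connected_homeomorphism[OF homeomorphism_Sp4_cover[unfolded SiegelR_def]])
      (intro locally_path_connected_Times convex_imp_locally_path_connected convex_Siegel convex_UNIV
        locally_path_connected_SU2)
qed

subsection \<open>The lifted action\<close>

text \<open>The phase has to be lifted jointly in the group element and in \<open>Z\<close>. The
  lift is built on \<open>Sp4_cover \<times> Siegel\<close>, a simply connected product of metric
  sets, and then transported to \<open>G\<close>; over the base point it must reproduce the
  coordinate already present in \<open>Sp4_cover\<close>.\<close>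

lemma universal_cover_phase_lift:
  fixes G :: "('a::topological_space, 'c) monoid_scheme"
  assumes ucg: "universal_covering_group G p Sp4"
  obtains \<alpha> \<psi> where "continuous_on (carrier G \<times> Siegel) (\<lambda>(g, Z). \<alpha> g Z)"
    "\<And>g Z. g \<in> carrier G \<Longrightarrow> Z \<in> Siegel \<Longrightarrow> cis (\<alpha> g Z) = phase (p g) Z"
    "\<And>Z. Z \<in> Siegel \<Longrightarrow> \<alpha> \<one>\<^bsub>G\<^esub> Z = 0"
    "homeomorphism (carrier G) Sp4_cover (\<lambda>g. (p g, \<alpha> g base_point)) \<psi>"
proof -
  interpret Sp4: group Sp4 by (rule group_Sp4)
  have hom: "p \<in> hom G Sp4" and "group G"
    using ucg by (auto simp: universal_covering_group_def topological_group_on_def)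
  interpret G: group G by fact
  have p1: "p \<one>\<^bsub>G\<^esub> = mat 1" using hom_one[OF hom G.is_group Sp4.is_group] by simp
  have "continuous_on (carrier Sp4) (\<lambda>h. phase h base_point)"
    by (intro continuous_on_phase continuous_intros) (auto simp: base_point_Siegel)
  moreover have "simply_connected {(h, t). h \<in> carrier Sp4 \<and> cis t = phase h base_point}"
    "locally path_connected {(h, t). h \<in> carrier Sp4 \<and> cis t = phase h base_point}"
    using Sp4_cover_topology by (simp_all add: Sp4_cover_def)
  ultimately obtain \<theta> \<psi> where hm: "homeomorphism (carrier G) Sp4_cover (\<lambda>g. (p g, \<theta> g)) \<psi>" and \<theta>1: "\<theta> \<one>\<^bsub>G\<^esub> = 0"
    using universal_cover_model[OF ucg topological_group_Sp4 locally_path_connected_Sp4,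
        of "\<lambda>h. phase h base_point"] norm_phase[OF _ base_point_Siegel]
    by (auto simp: Sp4_cover_def)
  define Y where "Y = Sp4_cover \<times> Siegel"
  have one: "(mat 1, 0) \<in> Sp4_cover" using Sp4.one_closed by (simp add: Sp4_cover_def)
  have Ysc: "simply_connected Y"
    unfolding Y_def by (intro simply_connected_Times Sp4_cover_topology convex_imp_simply_connected convex_Siegel)
  have Ylc: "locally path_connected Y"
    unfolding Y_def
    by (intro locally_path_connected_Times Sp4_cover_topology convex_imp_locally_path_connected convex_Siegel)
  have Y0: "((mat 1, 0), base_point) \<in> Y" using one base_point_Siegel by (simp add: Y_def)
  have Yphase: "continuous_on Y (\<lambda>y. phase (fst (fst y)) (snd y))"
    by (intro continuous_on_phase continuous_intros) (auto simp: Y_def Sp4_cover_def)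
  obtain \<Theta> where \<Theta>: "continuous_on Y \<Theta>" "\<And>y. y \<in> Y \<Longrightarrow> cis (\<Theta> y) = phase (fst (fst y)) (snd y)"
    "\<Theta> ((mat 1, 0), base_point) = 0"
    by (rule lift_to_circle_cover[OF Ysc Ylc Y0 Yphase, of 0]) (auto simp: Y_def Sp4_cover_def norm_phase)
  have con: "connected Sp4_cover" "connected Siegel"
    using Sp4_cover_topology convex_Siegel by (auto intro: simply_connected_imp_connected convex_connected)
  \<comment> \<open>Both are lifts of the phase at i I that vanish at the identity.\<close>
  have snd: "\<Theta> (y, base_point) = snd y" if "y \<in> Sp4_cover" for y
  proof (rule cis_lift_unique[OF con(1) one that])
    show "continuous_on Sp4_cover (\<lambda>y. \<Theta> (y, base_point))"
      by (rule continuous_on_compose2[OF \<Theta>(1)]) (auto simp: Y_def base_point_Siegel intro!: continuous_intros)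
    show "cis (\<Theta> (y, base_point)) = cis (snd y)" if "y \<in> Sp4_cover" for y
      using \<Theta>(2)[of "(y, base_point)"] that by (auto simp: Y_def base_point_Siegel Sp4_cover_def)
  qed (auto simp: \<Theta>(3) intro!: continuous_intros)
  \<comment> \<open>The identity has phase 1 at every \<open>Z\<close>, and \<open>Siegel\<close> is
    connected, so normalizing at i I is enough.\<close>
  have zero: "\<Theta> ((mat 1, 0), Z) = 0" if "Z \<in> Siegel" for Z
  proof (rule cis_lift_unique[OF con(2) base_point_Siegel that])
    show "continuous_on Siegel (\<lambda>Z. \<Theta> ((mat 1, 0), Z))"
      by (rule continuous_on_compose2[OF \<Theta>(1)]) (auto simp: Y_def one intro!: continuous_intros)
    show "cis (\<Theta> ((mat 1, 0), Z)) = cis 0" if "Z \<in> Siegel" for Z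
      using \<Theta>(2)[of "((mat 1, 0), Z)"] that by (auto simp: Y_def one)
  qed (auto simp: \<Theta>(3) intro!: continuous_intros)
  have q: "(p g, \<theta> g) \<in> Sp4_cover" if "g \<in> carrier G" for g
    using homeomorphism_image1[OF hm] that by blast
  define \<alpha> where "\<alpha> = (\<lambda>g Z. \<Theta> ((p g, \<theta> g), Z))"
  show thesis
  proof (rule that[of \<alpha> \<psi>])
    show "continuous_on (carrier G \<times> Siegel) (\<lambda>(g, Z). \<alpha> g Z)"
      unfolding \<alpha>_def split_def
      by (rule continuous_on_compose2[OF \<Theta>(1)])
        (use q in \<open>auto simp: Y_def intro!: continuous_intros continuous_on_compose2[OF homeomorphism_cont1[OF hm]]\<close>)
    show "homeomorphism (carrier G) Sp4_cover (\<lambda>g. (p g, \<alpha> g base_point)) \<psi>"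
      by (rule homeomorphism_cong[OF hm refl refl]) (auto simp: \<alpha>_def snd[OF q])
    show "cis (\<alpha> g Z) = phase (p g) Z" if "g \<in> carrier G" "Z \<in> Siegel" for g Z
      using \<Theta>(2)[of "((p g, \<theta> g), Z)"] q[OF that(1)] that(2) by (simp add: \<alpha>_def Y_def)
    show "\<alpha> \<one>\<^bsub>G\<^esub> Z = 0" if "Z \<in> Siegel" for Z using zero[OF that] by (simp add: \<alpha>_def p1 \<theta>1)
  qed
qed

text \<open>Adding \<open>\<alpha>\<close> to the real coordinate is a lift of the circle action.
  Any other lift has the same real coordinate modulo 2 pi and agrees at the identity, hence
  everywhere on the connected product; this resolves the definite description.\<close>

lemma SiegelR_act_eqI:
  fixes G :: "('a::topological_space, 'c) monoid_scheme"
  assumes ucg: "universal_covering_group G p Sp4"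
    and cont: "continuous_on (carrier G \<times> Siegel) (\<lambda>(g, Z). \<alpha> g Z)"
    and cis: "\<And>g Z. g \<in> carrier G \<Longrightarrow> Z \<in> Siegel \<Longrightarrow> cis (\<alpha> g Z) = phase (p g) Z"
    and one: "\<And>Z. Z \<in> Siegel \<Longrightarrow> \<alpha> \<one>\<^bsub>G\<^esub> Z = 0"
  shows "SiegelR_act G p = (\<lambda>g\<in>carrier G. \<lambda>(Z, t)\<in>SiegelR. (Siegel_act (p g) Z, t + \<alpha> g Z))" (is "_ = ?\<phi>")
    and "continuous_on (carrier G \<times> SiegelR) (\<lambda>(g, x). SiegelR_act G p g x)"
    and "group_action G SiegelR (SiegelR_act G p)"
proof -
  have G: "topological_group_on G" and hom: "p \<in> hom G Sp4" and scG: "simply_connected (carrier G)"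
    and cov: "covering_space (carrier G) p (carrier Sp4)"
    using ucg by (auto simp: universal_covering_group_def)
  interpret Sp4: group Sp4 by (rule group_Sp4)
  interpret G: group G using G by (rule topological_group_onD)
  have p1: "p \<one>\<^bsub>G\<^esub> = mat 1" using hom_one[OF hom G.is_group Sp4.is_group] by simp
  have pS: "p g \<in> carrier Sp4" if "g \<in> carrier G" for g using hom that by (auto simp: hom_def)
  have pmult: "p (g \<otimes>\<^bsub>G\<^esub> h) = p g ** p h" if "g \<in> carrier G" "h \<in> carrier G" for g h
    using hom_mult[OF hom that] by simp
  have pc: "continuous_on (carrier G) p" using cov by (rule covering_space_imp_continuous)
  have conG: "connected (carrier G)"
    using simply_connected_imp_path_connected_gen[OF scG] by (rule path_connected_imp_connected)
  have conS: "connected Siegel" using convex_Siegel by (rule convex_connected)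
  have conR: "connected SiegelR" unfolding SiegelR_def
    by (intro connected_Times conS connected_UNIV)
  have \<phi>: "?\<phi> g (Z, t) = (Siegel_act (p g) Z, t + \<alpha> g Z)" if "g \<in> carrier G" "Z \<in> Siegel" for g Z t
    using that by (simp add: SiegelR_def)
  have \<phi>_cont: "continuous_on (carrier G \<times> SiegelR) (\<lambda>(g, x). ?\<phi> g x)"
  proof -
    have "continuous_on (carrier G \<times> SiegelR)
        (\<lambda>y. (Siegel_act (p (fst y)) (fst (snd y)), snd (snd y) + (case (fst y, fst (snd y)) of (g, Z) \<Rightarrow> \<alpha> g Z)))"
      by (intro continuous_on_Pair continuous_on_Siegel_act continuous_on_add
          continuous_on_compose2[OF cont] continuous_on_compose2[OF pc] continuous_intros)
        (auto simp: SiegelR_def den_det_nz pS)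
    then show ?thesis
      by (rule continuous_on_eq) (auto simp: SiegelR_def)
  qed
  have \<phi>_proj: "SiegelR_proj (?\<phi> g x) = SiegelS1_act (p g) (SiegelR_proj x)"
    if g: "g \<in> carrier G" and x: "x \<in> SiegelR" for g x
  proof -
    obtain Z t where Zt: "x = (Z, t)" "Z \<in> Siegel" using x by (auto simp: SiegelR_def)
    show ?thesis unfolding Zt \<phi>[OF g Zt(2)]
      using cis[OF g Zt(2)] Zt(2) pS[OF g] by (simp add: SiegelR_proj_def SiegelS1_act_eq cis_mult[symmetric])
  qed
  have \<phi>_PiE: "?\<phi> \<in> carrier G \<rightarrow>\<^sub>E SiegelR \<rightarrow>\<^sub>E SiegelR"
    unfolding restrict_PiE_iff by (auto simp: SiegelR_def Siegel_act_closed pS)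
  show eq: "SiegelR_act G p = ?\<phi>"
    unfolding SiegelR_act_def
  proof (rule the_equality)
    show "?\<phi> \<in> carrier G \<rightarrow>\<^sub>E SiegelR \<rightarrow>\<^sub>E SiegelR \<and>
      continuous_on (carrier G \<times> SiegelR) (\<lambda>(g, x). ?\<phi> g x) \<and>
      (\<forall>x\<in>SiegelR. ?\<phi> \<one>\<^bsub>G\<^esub> x = x) \<and>
      (\<forall>g\<in>carrier G. \<forall>x\<in>SiegelR. SiegelR_proj (?\<phi> g x) = SiegelS1_act (p g) (SiegelR_proj x))"
    proof (intro conjI ballI \<phi>_PiE \<phi>_cont \<phi>_proj)
      show "?\<phi> \<one>\<^bsub>G\<^esub> x = x" if "x \<in> SiegelR" for x
        using that by (auto simp: SiegelR_def p1 one)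
    qed
  next
    fix \<eta> assume "\<eta> \<in> carrier G \<rightarrow>\<^sub>E SiegelR \<rightarrow>\<^sub>E SiegelR \<and>
      continuous_on (carrier G \<times> SiegelR) (\<lambda>(g, x). \<eta> g x) \<and>
      (\<forall>x\<in>SiegelR. \<eta> \<one>\<^bsub>G\<^esub> x = x) \<and>
      (\<forall>g\<in>carrier G. \<forall>x\<in>SiegelR. SiegelR_proj (\<eta> g x) = SiegelS1_act (p g) (SiegelR_proj x))"
    then have \<eta>: "\<eta> \<in> carrier G \<rightarrow>\<^sub>E SiegelR \<rightarrow>\<^sub>E SiegelR"
      "continuous_on (carrier G \<times> SiegelR) (\<lambda>(g, x). \<eta> g x)"
      "\<And>x. x \<in> SiegelR \<Longrightarrow> \<eta> \<one>\<^bsub>G\<^esub> x = x"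
      "\<And>g x. g \<in> carrier G \<Longrightarrow> x \<in> SiegelR \<Longrightarrow> SiegelR_proj (\<eta> g x) = SiegelR_proj (?\<phi> g x)"
      using \<phi>_proj by auto
    have b: "(base_point, 0) \<in> SiegelR" by (simp add: SiegelR_def base_point_Siegel)
    have "\<eta> g x = ?\<phi> g x" if g: "g \<in> carrier G" and x: "x \<in> SiegelR" for g x
    proof -
      have fst: "fst (\<eta> g x) = fst (?\<phi> g x)" and cis: "cis (snd (\<eta> g x)) = cis (snd (?\<phi> g x))"
        if "g \<in> carrier G" "x \<in> SiegelR" for g x
        using \<eta>(4)[OF that] by (simp_all add: SiegelR_proj_def split_def)
      have "(\<lambda>y. snd (\<eta> (fst y) (snd y))) (g, x) = (\<lambda>y. snd (?\<phi> (fst y) (snd y))) (g, x)"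
      proof (rule cis_lift_unique[of "carrier G \<times> SiegelR" "(\<one>\<^bsub>G\<^esub>, (base_point, 0))"])
        show "continuous_on (carrier G \<times> SiegelR) (\<lambda>y. snd (\<eta> (fst y) (snd y)))"
          "continuous_on (carrier G \<times> SiegelR) (\<lambda>y. snd (?\<phi> (fst y) (snd y)))"
          using continuous_on_snd[OF \<eta>(2)] continuous_on_snd[OF \<phi>_cont] by (simp_all only: split_def)
        have "?\<phi> \<one>\<^bsub>G\<^esub> (base_point, 0) = (base_point, 0)"
          by (simp add: \<phi>[OF G.one_closed base_point_Siegel] p1 one base_point_Siegel del: restrict_apply)
        then show "snd (\<eta> (fst (\<one>\<^bsub>G\<^esub>, (base_point, 0))) (snd (\<one>\<^bsub>G\<^esub>, (base_point, 0)))) =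
          snd (?\<phi> (fst (\<one>\<^bsub>G\<^esub>, (base_point, 0))) (snd (\<one>\<^bsub>G\<^esub>, (base_point, 0))))"
          using \<eta>(3)[OF b] by simp
        show "cis (snd (\<eta> (fst y) (snd y))) = cis (snd (?\<phi> (fst y) (snd y)))" if "y \<in> carrier G \<times> SiegelR" for y
          using that by (intro cis) auto
      qed (use g x b conG conR in \<open>auto intro: connected_Times\<close>)
      then show ?thesis using fst[OF g x] by (simp add: prod_eq_iff del: restrict_apply)
    qed
    then have restr: "\<eta> g = ?\<phi> g" if "g \<in> carrier G" for g
      using that PiE_mem[OF \<eta>(1) that] PiE_mem[OF \<phi>_PiE that]
      by (intro PiE_ext[of "\<eta> g" SiegelR "\<lambda>_. SiegelR"]) blast+
    show "\<eta> = ?\<phi>"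
      by (rule PiE_ext[OF \<eta>(1) \<phi>_PiE restr])
  qed
  show "continuous_on (carrier G \<times> SiegelR) (\<lambda>(g, x). SiegelR_act G p g x)"
    unfolding eq by (rule \<phi>_cont)
  \<comment> \<open>By \<open>phase_mult\<close> both sides lift the same circle-valued map on a
    connected space, and both vanish at the two identities and i I. So the law holds exactly, not
    just modulo 2 pi.\<close>
  have cocycle_\<alpha>: "\<alpha> (g \<otimes>\<^bsub>G\<^esub> h) Z = \<alpha> g (Siegel_act (p h) Z) + \<alpha> h Z"
    if gh: "g \<in> carrier G" "h \<in> carrier G" and Z: "Z \<in> Siegel" for g h Z
  proof -
    let ?Y = "carrier G \<times> carrier G \<times> Siegel"
    have "(\<lambda>y. case (fst y \<otimes>\<^bsub>G\<^esub> fst (snd y), snd (snd y)) of (g, Z) \<Rightarrow> \<alpha> g Z) (g, h, Z) =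
      (\<lambda>y. (case (fst y, Siegel_act (p (fst (snd y))) (snd (snd y))) of (g, Z) \<Rightarrow> \<alpha> g Z) +
        (case snd y of (h, Z) \<Rightarrow> \<alpha> h Z)) (g, h, Z)"
    proof (rule cis_lift_unique[of ?Y "(\<one>\<^bsub>G\<^esub>, \<one>\<^bsub>G\<^esub>, base_point)"])
      show "continuous_on ?Y (\<lambda>y. case (fst y \<otimes>\<^bsub>G\<^esub> fst (snd y), snd (snd y)) of (g, Z) \<Rightarrow> \<alpha> g Z)"
        by (rule continuous_on_compose2[OF cont])
          (auto intro!: continuous_on_Pair continuous_on_group_mult[OF G] continuous_intros)
      have "continuous_on ?Y (\<lambda>y. Siegel_act (p (fst (snd y))) (snd (snd y)))"
        by (intro continuous_on_Siegel_act continuous_on_compose2[OF pc] continuous_intros) (auto simp: den_det_nz pS)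
      then have "continuous_on ?Y (\<lambda>y. (fst y, Siegel_act (p (fst (snd y))) (snd (snd y))))"
        by (intro continuous_on_Pair continuous_intros)
      then show "continuous_on ?Y (\<lambda>y. (case (fst y, Siegel_act (p (fst (snd y))) (snd (snd y))) of (g, Z) \<Rightarrow> \<alpha> g Z) +
          (case snd y of (h, Z) \<Rightarrow> \<alpha> h Z))"
        by (intro continuous_on_add continuous_on_compose2[OF cont] continuous_on_snd continuous_on_id)
          (auto simp: Siegel_act_closed pS)
      show "cis (case (fst y \<otimes>\<^bsub>G\<^esub> fst (snd y), snd (snd y)) of (g, Z) \<Rightarrow> \<alpha> g Z) =
        cis ((case (fst y, Siegel_act (p (fst (snd y))) (snd (snd y))) of (g, Z) \<Rightarrow> \<alpha> g Z) +
          (case snd y of (h, Z) \<Rightarrow> \<alpha> h Z))" if "y \<in> ?Y" for y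
        using that by (auto simp: cis cis_mult[symmetric] pmult phase_mult pS Siegel_act_closed)
    qed (use gh Z conG conS in \<open>auto simp: one p1 base_point_Siegel intro!: connected_Times\<close>)
    then show ?thesis by simp
  qed
  show "group_action G SiegelR (SiegelR_act G p)"
    unfolding eq
  proof (rule group_actionI[OF G.is_group])
    fix g x assume g: "g \<in> carrier G" and x: "x \<in> SiegelR"
    then obtain Z t where Zt: "x = (Z, t)" "Z \<in> Siegel" by (auto simp: SiegelR_def)
    show "?\<phi> g x \<in> SiegelR"
      unfolding Zt \<phi>[OF g Zt(2)] using Zt(2) pS[OF g] by (simp add: SiegelR_def Siegel_act_closed)
    fix h assume h: "h \<in> carrier G"
    show "?\<phi> (g \<otimes>\<^bsub>G\<^esub> h) x = ?\<phi> g (?\<phi> h x)"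
      unfolding Zt \<phi>[OF G.m_closed[OF g h] Zt(2)] \<phi>[OF h Zt(2)] \<phi>[OF g Siegel_act_closed[OF pS[OF h] Zt(2)]]
      using Zt(2) g h pS by (simp add: cocycle_\<alpha> pmult Siegel_act_cocycle(1))
  next
    show "?\<phi> \<one>\<^bsub>G\<^esub> x = x" if "x \<in> SiegelR" for x
      using that by (auto simp: SiegelR_def p1 one)
    show "?\<phi> g \<in> extensional SiegelR" if "g \<in> carrier G" for g
      using that by simp
  qed
qed

theorem theorem3p2:
  fixes G :: "('a::topological_space, 'c) monoid_scheme" and p :: "'a \<Rightarrow> real mat4"
  assumes "universal_covering_group G p Sp4"
  shows "transitive_action Sp4 SiegelS1 SiegelS1_act \<and>
    (\<forall>x\<in>SiegelS1.
       compact (stabilizer Sp4 SiegelS1_act x) \<and>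
       topological_group_isomorphic (Sp4\<lparr>carrier := stabilizer Sp4 SiegelS1_act x\<rparr>) SU2 \<and>
       equivariantly_identified Sp4 SiegelS1 SiegelS1_act x) \<and>
    transitive_action G SiegelR (SiegelR_act G p) \<and>
    (\<forall>x\<in>SiegelR.
       compact (stabilizer G (SiegelR_act G p) x) \<and>
       topological_group_isomorphic (G\<lparr>carrier := stabilizer G (SiegelR_act G p) x\<rparr>) SU2 \<and>
       equivariantly_identified G SiegelR (SiegelR_act G p) x)"
proof -
  have S1: "transitive_action Sp4 SiegelS1 SiegelS1_act \<and>
    (\<forall>x\<in>SiegelS1.
       compact (stabilizer Sp4 SiegelS1_act x) \<and>
       topological_group_isomorphic (Sp4\<lparr>carrier := stabilizer Sp4 SiegelS1_act x\<rparr>) SU2 \<and>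
       equivariantly_identified Sp4 SiegelS1 SiegelS1_act x)"
    by (rule homogeneous_of_section[OF topological_group_Sp4 group_action_SiegelS1 _ continuous_on_orbit_base
          continuous_on_S1_section S1_section topological_group_isomorphic_base compact_stabilizer_base])
      (auto simp: SiegelS1_def base_point_Siegel)
  have G: "topological_group_on G" and hom: "p \<in> hom G Sp4"
    and cov: "covering_space (carrier G) p (carrier Sp4)"
    using assms by (auto simp: universal_covering_group_def)
  interpret G: group G using G by (rule topological_group_onD)
  have pS: "p g \<in> carrier Sp4" if "g \<in> carrier G" for g using hom that by (auto simp: hom_def)
  have pmult: "p (g \<otimes>\<^bsub>G\<^esub> h) = p g ** p h" if "g \<in> carrier G" "h \<in> carrier G" for g h
    using hom_mult[OF hom that] by simp
  have pc: "continuous_on (carrier G) p" using cov by (rule covering_space_imp_continuous)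
  obtain \<alpha> \<psi> where \<alpha>: "continuous_on (carrier G \<times> Siegel) (\<lambda>(g, Z). \<alpha> g Z)"
    "\<And>g Z. g \<in> carrier G \<Longrightarrow> Z \<in> Siegel \<Longrightarrow> cis (\<alpha> g Z) = phase (p g) Z"
    "\<And>Z. Z \<in> Siegel \<Longrightarrow> \<alpha> \<one>\<^bsub>G\<^esub> Z = 0"
    and hm: "homeomorphism (carrier G) Sp4_cover (\<lambda>g. (p g, \<alpha> g base_point)) \<psi>"
    using universal_cover_phase_lift[OF assms] by blast
  note act = SiegelR_act_eqI[OF assms \<alpha>]
  let ?\<phi> = "SiegelR_act G p" and ?x0 = "(base_point, 0 :: real)"
  have x0: "?x0 \<in> SiegelR" by (simp add: SiegelR_def base_point_Siegel)
  have orbit: "?\<phi> g ?x0 = (Siegel_act (p g) base_point, \<alpha> g base_point)" if "g \<in> carrier G" for g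
    using that x0 by (simp add: act(1))
  have \<psi>G: "\<psi> y \<in> carrier G" and p\<psi>: "p (\<psi> y) = fst y" and \<alpha>\<psi>: "\<alpha> (\<psi> y) base_point = snd y"
    if "y \<in> Sp4_cover" for y
    using homeomorphism_image2[OF hm] homeomorphism_apply2[OF hm that] that by (auto simp: prod_eq_iff)
  have proj: "SiegelR_proj x \<in> SiegelS1" if "x \<in> SiegelR" for x
    using that by (auto simp: SiegelR_proj_def SiegelR_def SiegelS1_def)
  have sec: "(S1_section (SiegelR_proj x), snd x) \<in> Sp4_cover \<and>
      Siegel_act (S1_section (SiegelR_proj x)) base_point = fst x" if "x \<in> SiegelR" for x
    using S1_section[OF proj[OF that]] orbit_base[of "S1_section (SiegelR_proj x)"]
    by (auto simp: Sp4_cover_def SiegelR_proj_def split_def)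
  \<comment> \<open>The phase of the circle section at i I is \<open>cis\<close> of the real
    coordinate, so the pair lies in \<open>Sp4_cover\<close> and \<open>\<psi>\<close> lifts it to
    \<open>G\<close>.\<close>
  define \<sigma> where "\<sigma> = (\<lambda>x. \<psi> (S1_section (SiegelR_proj x), snd x))"
  have \<sigma>_cont: "continuous_on SiegelR \<sigma>"
  proof -
    have "continuous_on SiegelR (\<lambda>x. S1_section (SiegelR_proj x))"
      by (rule continuous_on_compose2[OF continuous_on_S1_section])
        (auto simp: proj SiegelR_proj_def split_def SiegelR_def SiegelS1_def intro!: continuous_intros)
    then show ?thesis unfolding \<sigma>_def
      by (intro continuous_on_compose2[OF homeomorphism_cont2[OF hm]] continuous_on_Pair continuous_intros)
        (use sec in auto)
  qed
  have \<sigma>G: "\<sigma> x \<in> carrier G" and \<sigma>x: "?\<phi> (\<sigma> x) ?x0 = x" if "x \<in> SiegelR" for x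
  proof -
    show "\<sigma> x \<in> carrier G" using \<psi>G sec[OF that] by (simp add: \<sigma>_def)
    then show "?\<phi> (\<sigma> x) ?x0 = x" using p\<psi> \<alpha>\<psi> sec[OF that] by (simp add: orbit) (simp add: \<sigma>_def)
  qed
  have orbit_cont: "continuous_on (carrier G) (\<lambda>g. ?\<phi> g ?x0)"
  proof -
    have "continuous_on (carrier G) (\<lambda>g. case (g, ?x0) of (g, x) \<Rightarrow> ?\<phi> g x)"
      by (rule continuous_on_compose2[OF act(2)]) (use x0 in \<open>auto intro!: continuous_intros\<close>)
    then show ?thesis by simp
  qed
  let ?K = "stabilizer G ?\<phi> ?x0"
  \<comment> \<open>Over the stabilizer downstairs \<open>\<alpha> g base_point\<close> is a
    multiple of 2 pi; requiring it to vanish selects a single sheet, a homeomorphic copy of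
    SU(2).\<close>
  have K: "g \<in> ?K \<longleftrightarrow> g \<in> carrier G \<and> p g \<in> stabilizer Sp4 SiegelS1_act base_S1 \<and> \<alpha> g base_point = 0" for g
    using orbit[of g] pS[of g] \<alpha>(2)[OF _ base_point_Siegel, of g]
    by (auto simp: stabilizer_def[of G] stabilizer_base_iff)
  have emb: "(unitary_embed U, 0) \<in> Sp4_cover" if "U \<in> carrier SU2" for U
    using unitary_embed_stabilizer[OF that] by (simp add: stabilizer_base_iff Sp4_cover_def)
  have hmK: "homeomorphism ?K (carrier SU2) (\<lambda>g. den (p g) base_point) (\<lambda>U. \<psi> (unitary_embed U, 0))"
  proof (rule homeomorphismI)
    show "continuous_on ?K (\<lambda>g. den (p g) base_point)"
      by (intro continuous_on_num_den continuous_on_subset[OF pc] continuous_intros) (auto simp: K)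
    show "continuous_on (carrier SU2) (\<lambda>U. \<psi> (unitary_embed U, 0))"
      by (intro continuous_on_compose2[OF homeomorphism_cont2[OF hm]] continuous_on_Pair continuous_on_unitary_embed
          continuous_intros) (use emb in auto)
    show "(\<lambda>g. den (p g) base_point) ` ?K \<subseteq> carrier SU2" using stabilizer_base by (auto simp: K)
    show "(\<lambda>U. \<psi> (unitary_embed U, 0)) ` carrier SU2 \<subseteq> ?K"
      using emb \<psi>G p\<psi> \<alpha>\<psi> unitary_embed_stabilizer by (auto simp: K)
    show "\<psi> (unitary_embed (den (p g) base_point), 0) = g" if "g \<in> ?K" for g
      using homeomorphism_apply1[OF hm, of g] that by (simp add: K stabilizer_base)
    show "den (p (\<psi> (unitary_embed U, 0))) base_point = U" if "U \<in> carrier SU2" for U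
      using p\<psi>[OF emb[OF that]] by (simp add: den_unitary_embed)
  qed
  have "(\<lambda>g. den (p g) base_point) \<in> iso (G\<lparr>carrier := ?K\<rparr>) SU2"
    unfolding iso_def hom_def
  proof (intro CollectI conjI)
    show "bij_betw (\<lambda>g. den (p g) base_point) (carrier (G\<lparr>carrier := ?K\<rparr>)) (carrier SU2)"
      by (rule bij_betw_byWitness[where f' = "\<lambda>U. \<psi> (unitary_embed U, 0)"])
        (use hmK in \<open>simp_all add: homeomorphism_def\<close>)
  qed (use homeomorphism_image1[OF hmK] pmult in
      \<open>auto simp: K stabilizer_base_iff stabilizer_base(1) Siegel_act_cocycle(2) base_point_Siegel SU2_def[THEN arg_cong[of _ _ mult]]\<close>)
  then have iso: "topological_group_isomorphic (G\<lparr>carrier := ?K\<rparr>) SU2"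
    unfolding topological_group_isomorphic_def
    using homeomorphism_imp_homeomorphic_map[OF hmK] by auto
  have cpt: "compact ?K"
    using compact_continuous_image[OF homeomorphism_cont2[OF hmK] compact_SU2] homeomorphism_image2[OF hmK] by simp
  show ?thesis
    using S1 homogeneous_of_section[OF G act(3) x0 orbit_cont \<sigma>_cont \<sigma>G \<sigma>x iso cpt] by blast
qed

end
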